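(* For all $p,q,a,b,c\in\mathbb{N}$, the identity \begin{align*} \mathcal{S}_{F_2}(p,q,a,b,c;s) &=2(-1)^p\sum_{j=0}^{[p/2]}\phi(2j)\sum_{\omega=0}^{p-2j}\binom{\omega+a-1}{\omega}\binom{p+c-2j-\omega-1}{c-1}\mathfrak{T}(q+a+\omega,s,p+b+c-2j-\omega;1,-1)\\ &\ +2(-1)^{p+a}\sum_{j=0}^{[c/2]}\phi(2j)\sum_{\omega=0}^{c-2j}\binom{\omega+a-1}{\omega}\binom{p+c-2j-\omega-1}{p-1}\mathfrak{T}(q,s+a+\omega,p+b+c-2j-\omega;-1,1)\\ &\ +2(-1)^p\sum_{j=0}^{[a/2]}\phi(2j)\sum_{\omega=0}^{p-1}\binom{\omega+a-2j}{\omega}\binom{p+c-2-\omega}{c-1}\mathfrak{T}(q+a-2j+\omega+1,s,p+b+c-1-\omega;-1,-1)\\ &\ +2(-1)^{p+a}\sum_{j=0}^{[a/2]}\phi(2j)\sum_{\omega=0}^{c-1}\binom{\omega+a-2j}{\omega}\binom{p+c-2-\omega}{p-1}\mathfrak{T}(q,s+a-2j+\omega+1,p+b+c-1-\omega;-1,-1) \end{align*} holds for $s\in\mathbb{C}$ except for singularities of the functions on both sides, where $F_2(\mathbf{s})=\zeta_3(\mathbf{s},\lambda_2^\vee;SU(4))$. Moreover, the right-hand side can be written in terms of the Riemann zeta-function.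
   Context: For $\mathbf{s}=(s_1,\dots,s_6)\in\mathbb{C}^6$, $\zeta_3(\mathbf{s},\lambda_2^\vee;SU(4))=\sum_{l,m,n=1}^\infty \frac{(-1)^{l+n}}{l^{s_1}m^{s_2}n^{s_3}(l+m)^{s_4}(m+n)^{s_5}(l+m+n)^{s_6}}$, absolutely convergent for real parts sufficiently large and meromorphically continued to $\mathbb{C}^6$. For a function $F$ of six complex variables, $p,q,a,b,c\in\mathbb{N}$ and $s\in\mathbb{C}$, define $\mathcal{S}_F(p,q,a,b,c;s)=F(p,q,s,a,b,c)+(-1)^pF(p,a,s,q,c,b)+(-1)^{p+a}F(q,a,c,p,s,b)+(-1)^{p+a+c}F(q,s,c,b,a,p)+(-1)^{q}F(a,q,b,p,s,c)+(-1)^{q+b}F(a,s,b,c,q,p)+(-1)^{q+a}F(a,p,b,q,c,s)+(-1)^{q+a+b}F(a,c,b,s,p,q)+(-1)^{q+a+b+c}F(s,c,p,a,b,q)+(-1)^{p+q+a}F(q,p,c,a,b,s)+(-1)^{p+q+a+c}F(q,b,c,s,p,a)+(-1)^{p+q+a+b+c}F(s,b,p,q,c,a)$. $\zeta$ is the Riemann zeta-function and $\phi(s)=(2^{1-s}-1)\zeta(s)=\sum_{n\ge1}(-1)^nn^{-s}$ (so $\phi(0)=-1/2$). For $p,q\in\mathbb{N}$, $x,y\in\mathbb{C}$ with $|x|,|y|\le1$ and $s>1$, $\mathfrak{T}(p,s,q;x,y)=\sum_{l\in\mathbb{Z}\setminus\{0\},\,m\ge1,\,l+m\neq0}\frac{x^ly^m}{l^pm^s(l+m)^q}$,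 regarded as a meromorphic function of $s$. $[x]$ is the integer part; $\binom{x}{k}=x(x-1)\cdots(x-k+1)/k!$, $\binom{x}{0}=1$. *)

theory Defs
  imports "HOL-Complex_Analysis.Complex_Analysis"
begin

section \<open>Meromorphic functions of six complex variables\<close>

type_synonym complex6 = "complex \<times> complex \<times> complex \<times> complex \<times> complex \<times> complex"

text \<open>The real derivative exists and is complex linear at every point of \<open>V\<close>.\<close>

definition holomorphic6_on :: "(complex6 \<Rightarrow> complex) \<Rightarrow> complex6 set \<Rightarrow> bool" where
  "holomorphic6_on f V \<longleftrightarrow>
     (\<forall>z\<in>V. \<exists>d1 d2 d3 d4 d5 d6.
        (f has_derivative
           (\<lambda>(v1, v2, v3, v4, v5, v6).
              d1 * v1 + d2 * v2 + d3 * v3 + d4 * v4 + d5 * v5 + d6 * v6)) (at z))"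

text \<open>
  \<open>F\<close> is meromorphic on the whole space with singular locus \<open>P\<close>: locally \<open>F = g / h\<close> with \<open>g\<close>, \<open>h\<close>
  holomorphic, and \<open>P\<close> is the zero set of \<open>h\<close> (so points of indeterminacy belong to \<open>P\<close>).
  The values of \<open>F\<close> on \<open>P\<close> are irrelevant.
\<close>

definition meromorphic6 :: "(complex6 \<Rightarrow> complex) \<Rightarrow> complex6 set \<Rightarrow> bool" where
  "meromorphic6 F P \<longleftrightarrow>
     interior P = {} \<and>
     (\<forall>z. \<exists>V g h. open V \<and> z \<in> V \<and> holomorphic6_on g V \<and> holomorphic6_on h V \<and>
        P \<inter> V = {w \<in> V. h w = 0} \<and> (\<forall>w\<in>V - P. F w = g w / h w))"

text \<open>
  \<open>F\<close> is the meromorphic continuation of the function \<open>z \<mapsto> \<Sum>k\<in>I. u z k\<close>: it is regular and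
  equal to the series at every point of absolute convergence.
\<close>

definition continues_series6 ::
  "(complex6 \<Rightarrow> complex) \<Rightarrow> (complex6 \<Rightarrow> 'i \<Rightarrow> complex) \<Rightarrow> 'i set \<Rightarrow> bool" where
  "continues_series6 F u I \<longleftrightarrow>
     (\<exists>P. meromorphic6 F P \<and>
        (\<forall>z. (\<lambda>k. norm (u z k)) summable_on I \<longrightarrow> z \<notin> P \<and> F z = (\<Sum>\<^sub>\<infinity>k\<in>I. u z k)))"


section \<open>The zeta-function of \<open>SU(4)\<close> at \<open>\<lambda>\<^sub>2\<close>\<close>

definition su4_term :: "complex6 \<Rightarrow> nat \<times> nat \<times> nat \<Rightarrow> complex" where
  "su4_term = (\<lambda>(s1, s2, s3, s4, s5, s6) (l, m, n).
     (-1) ^ (l + n) /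
       (of_nat l powr s1 * of_nat m powr s2 * of_nat n powr s3 *
        of_nat (l + m) powr s4 * of_nat (m + n) powr s5 * of_nat (l + m + n) powr s6))"

definition is_zeta3_SU4 :: "(complex6 \<Rightarrow> complex) \<Rightarrow> bool" where
  "is_zeta3_SU4 F \<longleftrightarrow> continues_series6 F su4_term ({1..} \<times> {1..} \<times> {1..})"

definition S_fun ::
  "(complex6 \<Rightarrow> complex) \<Rightarrow> nat \<Rightarrow> nat \<Rightarrow> nat \<Rightarrow> nat \<Rightarrow> nat \<Rightarrow> complex \<Rightarrow> complex" where
  "S_fun F p' q' a' b' c' s =
     (let p = of_nat p'; q = of_nat q'; a = of_nat a'; b = of_nat b'; c = of_nat c' in
        F (p, q, s, a, b, c)
      + (-1) ^ p' * F (p, a, s, q, c, b)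
      + (-1) ^ (p' + a') * F (q, a, c, p, s, b)
      + (-1) ^ (p' + a' + c') * F (q, s, c, b, a, p)
      + (-1) ^ q' * F (a, q, b, p, s, c)
      + (-1) ^ (q' + b') * F (a, s, b, c, q, p)
      + (-1) ^ (q' + a') * F (a, p, b, q, c, s)
      + (-1) ^ (q' + a' + b') * F (a, c, b, s, p, q)
      + (-1) ^ (q' + a' + b' + c') * F (s, c, p, a, b, q)
      + (-1) ^ (p' + q' + a') * F (q, p, c, a, b, s)
      + (-1) ^ (p' + q' + a' + c') * F (q, b, c, s, p, a)
      + (-1) ^ (p' + q' + a' + b' + c') * F (s, b, p, q, c, a))"


section \<open>Functions of one variable\<close>

text \<open>
  The meromorphic continuation to the plane of a function given on the half-plane \<open>Re s > 1\<close>.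
  The continuation is unique because removable singularities are filled in and poles get value 0.
\<close>

definition mero_ext :: "(complex \<Rightarrow> complex) \<Rightarrow> complex \<Rightarrow> complex" where
  "mero_ext f = (THE g. g nicely_meromorphic_on UNIV \<and> (\<forall>s. Re s > 1 \<longrightarrow> g s = f s))"

definition riemann_zeta :: "complex \<Rightarrow> complex" where
  "riemann_zeta = mero_ext (\<lambda>s. \<Sum>\<^sub>\<infinity>n\<in>{1::nat..}. 1 / of_nat n powr s)"

definition phi :: "complex \<Rightarrow> complex" where
  "phi s = (2 powr (1 - s) - 1) * riemann_zeta s"

definition T_fun :: "nat \<Rightarrow> complex \<Rightarrow> nat \<Rightarrow> complex \<Rightarrow> complex \<Rightarrow> complex" where
  "T_fun p s q x y =
     mero_ext (\<lambda>s. \<Sum>\<^sub>\<infinity>(l, m)\<in>{(l :: int, m :: nat). l \<noteq> 0 \<and> m \<ge> 1 \<and> l + int m \<noteq> 0}.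
       x powi l * y ^ m / (of_int l ^ p * of_nat m powr s * of_int (l + int m) ^ q)) s"

text \<open>
  For \<open>p, q, a, b, c \<ge> 1\<close> none of the subtractions of natural numbers below is truncated.
\<close>

definition rhs_fun :: "nat \<Rightarrow> nat \<Rightarrow> nat \<Rightarrow> nat \<Rightarrow> nat \<Rightarrow> complex \<Rightarrow> complex" where
  "rhs_fun p q a b c s =
     2 * (-1) ^ p *
       (\<Sum>j = 0..p div 2. phi (of_nat (2 * j)) *
         (\<Sum>w = 0..p - 2 * j.
            of_nat ((w + a - 1) choose w) * of_nat ((p + c - 2 * j - w - 1) choose (c - 1)) *
            T_fun (q + a + w) s (p + b + c - 2 * j - w) 1 (-1)))
   + 2 * (-1) ^ (p + a) *
       (\<Sum>j = 0..c div 2. phi (of_nat (2 * j)) *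
         (\<Sum>w = 0..c - 2 * j.
            of_nat ((w + a - 1) choose w) * of_nat ((p + c - 2 * j - w - 1) choose (p - 1)) *
            T_fun q (s + of_nat (a + w)) (p + b + c - 2 * j - w) (-1) 1))
   + 2 * (-1) ^ p *
       (\<Sum>j = 0..a div 2. phi (of_nat (2 * j)) *
         (\<Sum>w = 0..p - 1.
            of_nat ((w + a - 2 * j) choose w) * of_nat ((p + c - 2 - w) choose (c - 1)) *
            T_fun (q + a - 2 * j + w + 1) s (p + b + c - 1 - w) (-1) (-1)))
   + 2 * (-1) ^ (p + a) *
       (\<Sum>j = 0..a div 2. phi (of_nat (2 * j)) *
         (\<Sum>w = 0..c - 1.
            of_nat ((w + a - 2 * j) choose w) * of_nat ((p + c - 2 - w) choose (p - 1)) *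
            T_fun q (s + of_nat (a - 2 * j + w + 1)) (p + b + c - 1 - w) (-1) (-1)))"

text \<open>
  Functions of \<open>s\<close> that can be written in terms of the Riemann zeta-function: polynomial
  expressions with rational coefficients in its values at integers, its shifts by integers, and
  the elementary factor \<open>2 powr (- s)\<close> that enters through \<open>\<phi>(s) = (2 powr (1 - s) - 1) \<zeta>(s)\<close>.
\<close>

inductive_set zeta_expressible :: "(complex \<Rightarrow> complex) set" where
  const: "(\<lambda>s. of_rat r) \<in> zeta_expressible"
| two_powr: "(\<lambda>s. 2 powr (- s)) \<in> zeta_expressible"
| zeta_value: "(\<lambda>s. riemann_zeta (of_int k)) \<in> zeta_expressible"
| zeta_shift: "(\<lambda>s. riemann_zeta (s + of_int k)) \<in> zeta_expressible"
| add: "f \<in> zeta_expressible \<Longrightarrow> g \<in> zeta_expressible \<Longrightarrow> (\<lambda>s. f s + g s) \<in> zeta_expressible"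
| mult: "f \<in> zeta_expressible \<Longrightarrow> g \<in> zeta_expressible \<Longrightarrow> (\<lambda>s. f s * g s) \<in> zeta_expressible"

end

theory Submission
  imports Defs
begin
text \<open>
  For \<open>Re s > 1\<close> all series converge absolutely. The twelve terms of \<open>S_fun\<close> are the parts, over the
  twelve sign patterns of \<open>l, m, l + m, m + n, l + m + n\<close>, of the one sum over \<open>l, m \<in> \<int>\<close>, \<open>n \<ge> 1\<close> of
  \<open>(-1)^(l+n) / (l^p m^q n^s (l+m)^a (m+n)^b (l+m+n)^c)\<close>, taken over the points where no factor vanishes.
  Sum over \<open>l\<close> first. For a rational function \<open>G\<close> with integer poles that vanishes at infinity, the
  symmetric limit of \<open>\<Sum> (-1)^l [w^0] G(l + w)\<close> equals
  \<open>\<Sum> (-1)^P 2 \<phi>(2j) [w^(-2j)] G(P + w)\<close> over the poles \<open>P\<close> and \<open>j \<ge> 1\<close>: both sides are linear in \<open>G\<close>,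
  and for \<open>G = 1/(z - P)^i\<close> this is a shift of the summation window. Moving the constant terms at the
  poles to the right supplies the summand \<open>j = 0\<close>, because \<open>2 \<phi>(0) = -1\<close>. Expanding at the three poles
  gives the right-hand side. The same argument with two poles writes \<open>T_fun\<close> through zeta values, which
  also continues it meromorphically. The identity theorem then removes the condition on \<open>s\<close>; the lines
  \<open>s \<mapsto> (p, q, s, a, b, c)\<close> cannot lie in the singular locus because they meet the region of absolute convergence.
\<close>

text \<open>After partial fractions in \<open>l\<close>, a simple pole gives the series of x^l / (l
  - P), which converges only as a symmetric limit when x = 1 and at best conditionally otherwise. So
  the evaluation uses windows from -K to K, and unconditional summability of the whole inner series
  serves to identify the window limit with the unordered sum. Formal Laurent series turn the
  splitting of a product of inverse linear forms into an identity in a field, valid at the poles and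
  elsewhere alike. At the middle pole a Cauchy product would raise the exponents of m and n
  together. Partial fractions with denominator m + n raise only one of them, which is the shape of
  the last two lines of the right-hand side. \<open>mero_ext\<close> is a definite description, so
  zeta, \<open>phi\<close> and \<open>T_fun\<close> are usable only once a continuation is
  exhibited. It comes from the alternating zeta series, which continues to an entire function, and
  from division by 2^(1-s) - 1. The same construction yields phi(0) = -1/2. A continuation may take
  any values on its singular locus; equality is therefore carried through punctured
  neighbourhoods.\<close>

section \<open>Analytic continuation of the alternating zeta series\<close>

text \<open>
  Iterated differences of \<open>x powr (-s)\<close>. Each Abel summation of the alternating series replaces the
  terms by such differences, which decay faster by one power and so enlarge the half-plane of convergence.
\<close>

fun bdiff :: "nat \<Rightarrow> complex \<Rightarrow> real \<Rightarrow> complex" where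
  "bdiff 0 s x = of_real x powr (-s)"
| "bdiff (Suc k) s x = bdiff k s x - bdiff k s (x + 1)"

text \<open>Differentiation in \<open>x\<close> commutes with differencing and replaces
  \<open>s\<close> by \<open>s + 1\<close> up to the factor \<open>-s\<close>. This feeds the
  inductive decay estimate.\<close>

lemma has_vector_derivative_bdiff:
  assumes "x > 0"
  shows "(bdiff k s has_vector_derivative (- s * bdiff k (s + 1) x)) (at x)"
  using assms
proof (induction k arbitrary: x)
  case 0
  have "((\<lambda>z. z powr (-s)) has_field_derivative (-s) * of_real x powr (-(s + 1))) (at (of_real x))"
    using 0 has_field_derivative_powr[of "of_real x" "-s"] by (simp add: complex_nonpos_Reals_iff)
  from has_vector_derivative_real_field[OF this]
  have "((\<lambda>x. of_real x powr (-s)) has_vector_derivative (-s) * of_real x powr (-(s + 1))) (at x)" .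
  moreover have "bdiff 0 s = (\<lambda>x. of_real x powr (-s))" by auto
  ultimately show ?case by simp
next
  case (Suc k)
  have "(bdiff k s has_vector_derivative (- s * bdiff k (s + 1) (x + 1))) (at (x + 1))"
    using Suc by simp
  moreover have "((\<lambda>x. x + 1) has_vector_derivative 1) (at x)"
    by (auto intro!: derivative_eq_intros)
  ultimately have "((\<lambda>x. bdiff k s (x + 1)) has_vector_derivative (- s * bdiff k (s + 1) (x + 1))) (at x)"
    using vector_diff_chain_at[of "\<lambda>x. x + 1" 1 x "bdiff k s"] by (simp add: o_def)
  from has_vector_derivative_diff[OF Suc.IH[OF Suc.prems] this]
  have "((\<lambda>x. bdiff k s x - bdiff k s (x + 1)) has_vector_derivative
          - s * bdiff (Suc k) (s + 1) x) (at x)"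
    by (simp add: algebra_simps)
  moreover have "bdiff (Suc k) s = (\<lambda>x. bdiff k s x - bdiff k s (x + 1))" by auto
  ultimately show ?case by simp
qed

text \<open>Moves a bound from any point of a unit interval to its left end; the absolute value in
  the exponent covers growing and decaying powers.\<close>

lemma powr_shift_le:
  fixes x y e :: real
  assumes "x \<ge> 1" "y \<ge> x" "y \<le> x + 1"
  shows "y powr e \<le> 2 powr \<bar>e\<bar> * x powr e"
proof (cases "e \<ge> 0")
  case True
  have "y powr e \<le> (2 * x) powr e" using assms True by (intro powr_mono2) auto
  thus ?thesis using True assms by (simp add: powr_mult)
next
  case False
  have "y powr e \<le> x powr e" using assms False by (intro powr_mono2') auto
  moreover have "1 * x powr e \<le> 2 powr \<bar>e\<bar> * x powr e"
    by (intro mult_right_mono ge_one_powr_ge_zero) auto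
  ultimately show ?thesis by simp
qed

text \<open>By the mean value theorem a unit difference is bounded by a derivative, which costs a
  factor \<open>norm s\<close> and gains one power of \<open>x\<close>. Uniformity in
  \<open>s\<close> on bounded parts of a half-plane is what locally uniform convergence
  needs.\<close>

lemma norm_bdiff_le:
  "\<exists>C\<ge>0. \<forall>s x. norm s \<le> R \<longrightarrow> Re s \<ge> -r \<longrightarrow> x \<ge> 1 \<longrightarrow> norm (bdiff k s x) \<le> C * x powr (r - real k)"
proof (induction k arbitrary: R r)
  case 0
  show ?case
  proof (intro exI[of _ 1] conjI allI impI)
    fix s :: complex and x :: real assume "norm s \<le> R" "Re s \<ge> -r" "x \<ge> 1"
    thus "norm (bdiff 0 s x) \<le> 1 * x powr (r - real 0)"
      by (auto simp: norm_powr_real_powr intro!: powr_mono)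
  qed auto
next
  case (Suc k)
  \<comment> \<open>The derivative involves \<open>s + 1\<close>, so the bounds on \<open>s\<close>
    move to \<open>R + 1\<close> and \<open>r - 1\<close>.\<close>
  from Suc[of "R + 1" "r - 1"] obtain C where C: "C \<ge> 0"
    "\<And>s x. norm s \<le> R + 1 \<Longrightarrow> Re s \<ge> -(r-1) \<Longrightarrow> x \<ge> 1 \<Longrightarrow> norm (bdiff k s x) \<le> C * x powr (r - 1 - real k)"
    by blast
  define e where "e = r - 1 - real k"
  show ?case
  proof (intro exI[of _ "\<bar>R\<bar> * (C * 2 powr \<bar>e\<bar>)"] conjI allI impI)
    show "\<bar>R\<bar> * (C * 2 powr \<bar>e\<bar>) \<ge> 0" using C(1) by simp
    fix s :: complex and x :: real assume s: "norm s \<le> R" "Re s \<ge> -r" "x \<ge> 1"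
    have "norm (bdiff k s x - bdiff k s (x + 1)) \<le> (\<bar>R\<bar> * (C * (2 powr \<bar>e\<bar> * x powr e))) * norm (x - (x + 1))"
    proof (rule differentiable_bound[where S = "{x..x+1}" and f' = "\<lambda>y h. h *\<^sub>R (- s * bdiff k (s + 1) y)"])
      fix y assume y: "y \<in> {x..x+1}"
      show "(bdiff k s has_derivative (\<lambda>h. h *\<^sub>R (- s * bdiff k (s + 1) y))) (at y within {x..x+1})"
        using has_vector_derivative_bdiff[of y k s] y s
        by (auto simp: has_vector_derivative_def intro: has_derivative_at_withinI)
      have "norm (s + 1) \<le> R + 1" using norm_triangle_ineq[of s 1] s by simp
      hence "norm (bdiff k (s + 1) y) \<le> C * y powr e" unfolding e_def
        using y s by (intro C(2)) auto
      also have "\<dots> \<le> C * (2 powr \<bar>e\<bar> * x powr e)"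
        using y s C(1) by (intro mult_left_mono powr_shift_le) auto
      finally have *: "norm (- s * bdiff k (s + 1) y) \<le> \<bar>R\<bar> * (C * (2 powr \<bar>e\<bar> * x powr e))"
        using s unfolding norm_mult norm_minus_cancel by (intro mult_mono) auto
      show "onorm (\<lambda>h. h *\<^sub>R (- s * bdiff k (s + 1) y)) \<le> \<bar>R\<bar> * (C * (2 powr \<bar>e\<bar> * x powr e))"
        using mult_left_mono[OF *, of "\<bar>h\<bar>" for h] by (intro onorm_le) (simp add: mult.commute)
    qed auto
    thus "norm (bdiff (Suc k) s x) \<le> \<bar>R\<bar> * (C * 2 powr \<bar>e\<bar>) * x powr (r - real (Suc k))"
      by (simp add: e_def algebra_simps)
  qed
qed

lemma summable_Suc_powr:
  assumes "e < -1" shows "summable (\<lambda>n. real (Suc n) powr e)"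
  using assms by (subst summable_Suc_iff[of "\<lambda>n. real n powr e"]) (simp add: summable_real_powr_iff)

lemma summable_bdiff:
  assumes "Re s > 1 - real k"
  shows "summable (\<lambda>n. norm ((-1) ^ Suc n * bdiff k s (real (Suc n))))"
proof -
  obtain C where C: "\<And>x. x \<ge> 1 \<Longrightarrow> norm (bdiff k s x) \<le> C * x powr (- Re s - real k)"
    using norm_bdiff_le[of "norm s" "- Re s" k] by auto
  show ?thesis
  proof (rule summable_comparison_test')
    show "summable (\<lambda>n. C * real (Suc n) powr (- Re s - real k))"
      using assms by (intro summable_mult summable_Suc_powr) auto
    show "norm (norm ((-1) ^ Suc n * bdiff k s (real (Suc n)))) \<le> C * real (Suc n) powr (- Re s - real k)"
      if "n \<ge> 0" for n
      using C[of "real (Suc n)"] by (simp add: norm_mult norm_power)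
  qed
qed

definition eta_sum :: "nat \<Rightarrow> complex \<Rightarrow> complex" where
  "eta_sum k s = (\<Sum>n. (-1) ^ Suc n * bdiff k s (real (Suc n)))"

text \<open>Euler's transformation of the alternating series after \<open>k\<close> steps, including
  the remainder series. The series starts with a negative term, so this is minus the Dirichlet eta
  function.\<close>

definition eta_approx :: "nat \<Rightarrow> complex \<Rightarrow> complex" where
  "eta_approx k s = eta_sum k s / 2 ^ k - (\<Sum>j<k. bdiff j s 1 / 2 ^ Suc j)"

text \<open>Adding the series to its shift by one index turns the alternating terms into
  differences; the shift loses only the first term, which becomes the boundary term.\<close>

lemma eta_sum_Suc:
  assumes "Re s > 1 - real k"
  shows "eta_sum k s = eta_sum (Suc k) s / 2 - bdiff k s 1 / 2"
proof -
  define f where "f n = (-1) ^ Suc n * bdiff k s (real (Suc n))" for n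
  have sf: "summable f" unfolding f_def using summable_bdiff[OF assms] by (rule summable_norm_cancel)
  have "eta_sum (Suc k) s = (\<Sum>n. f n + f (Suc n))"
    unfolding eta_sum_def f_def by (intro suminf_cong) (simp add: algebra_simps)
  also have "\<dots> = suminf f + (\<Sum>n. f (Suc n))"
    using sf by (intro suminf_add[symmetric]) (auto simp: summable_Suc_iff)
  also have "(\<Sum>n. f (Suc n)) = suminf f - f 0"
    by (rule suminf_minus_initial_segment[OF sf, of 1, simplified])
  finally have "eta_sum (Suc k) s = 2 * suminf f - f 0" by simp
  moreover have "suminf f = eta_sum k s" unfolding f_def eta_sum_def ..
  moreover have "f 0 = - bdiff k s 1" by (simp add: f_def)
  ultimately show ?thesis by (simp add: add_divide_distrib)
qed

lemma eta_approx_Suc: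
  assumes "Re s > 1 - real k"
  shows "eta_approx (Suc k) s = eta_approx k s"
  proof -
  have *: "eta_sum (Suc k) s = 2 * eta_sum k s + bdiff k s 1"
    using eta_sum_Suc[OF assms] by simp
  show ?thesis unfolding eta_approx_def * by (simp add: field_simps)
qed

lemma eta_approx_mono:
  assumes "Re s > 1 - real k" "k \<le> k'"
  shows "eta_approx k' s = eta_approx k s"
  using assms(2,1) by (induction rule: dec_induct) (auto simp: eta_approx_Suc)

lemma holomorphic_bdiff:
  assumes "x > 0" shows "(\<lambda>s. bdiff k s x) holomorphic_on A"
  using assms by (induction k arbitrary: x) (auto intro!: holomorphic_intros)

lemma holomorphic_eta_sum: "eta_sum k holomorphic_on {s. Re s > 1 - real k}"
proof -
  let ?S = "{s. Re s > 1 - real k}"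
  let ?f = "\<lambda>n s. (-1) ^ Suc n * bdiff k s (real (Suc n))"
  have op: "open ?S" by (simp add: open_halfspace_Re_gt)
  have "\<exists>g g'. \<forall>x\<in>?S. ((\<lambda>n. ?f n x) sums g x) \<and> ((\<lambda>n. deriv (?f n) x) sums g' x) \<and> (g has_field_derivative g' x) (at x)"
  proof (rule series_and_derivative_comparison_local[OF op])
    show "(?f n has_field_derivative deriv (?f n) x) (at x)" if "x \<in> ?S" for n x
      by (rule holomorphic_derivI[of _ UNIV]) (auto intro!: holomorphic_intros holomorphic_bdiff simp del: power_Suc)
    fix s assume s: "s \<in> ?S"
    \<comment> \<open>Half the distance from \<open>s\<close> to the boundary line keeps the
      exponent of the majorant below -1 on the whole ball.\<close>
    define d where "d = (Re s - (1 - real k)) / 2"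
    have d: "d > 0" using s by (auto simp: d_def)
    obtain C where C: "\<And>t x. norm t \<le> norm s + d \<Longrightarrow> Re t \<ge> Re s - d \<Longrightarrow> x \<ge> 1 \<Longrightarrow>
         norm (bdiff k t x) \<le> C * x powr (- (Re s - d) - real k)"
      using norm_bdiff_le[of "norm s + d" "- (Re s - d)" k] by auto
    have "summable (\<lambda>n. C * real (Suc n) powr (- (Re s - d) - real k))"
      using d by (intro summable_mult summable_Suc_powr) (auto simp: d_def field_simps)
    moreover have "norm (?f n t) \<le> C * real (Suc n) powr (- (Re s - d) - real k)" if "t \<in> ball s d" for n t
    proof -
      have "norm (t - s) < d" using that by (simp add: dist_norm norm_minus_commute)
      moreover have "\<bar>Re (t - s)\<bar> \<le> norm (t - s)" by (rule abs_Re_le_cmod)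
      moreover have "norm t \<le> norm s + norm (t - s)" using norm_triangle_ineq[of s "t - s"] by simp
      ultimately show ?thesis using C[of t "real (Suc n)"] by (simp add: norm_mult norm_power)
    qed
    ultimately show "\<exists>d h. 0 < d \<and> summable h \<and> (\<forall>\<^sub>F n in sequentially. \<forall>t\<in>ball s d \<inter> ?S. norm (?f n t) \<le> h n)"
      using d by (intro exI[of _ d] exI[of _ "\<lambda>n. C * real (Suc n) powr (- (Re s - d) - real k)"]) auto
  qed
  then obtain g g' where g: "\<And>x. x \<in> ?S \<Longrightarrow> (\<lambda>n. ?f n x) sums g x" "\<And>x. x \<in> ?S \<Longrightarrow> (g has_field_derivative g' x) (at x)"
    by blast
  have "g holomorphic_on ?S" using op g(2) by (auto simp: holomorphic_on_open)
  moreover have "eta_sum k x = g x" if "x \<in> ?S" for x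
    using g(1)[OF that] by (simp add: eta_sum_def sums_iff)
  ultimately show ?thesis by (metis (no_types, lifting) holomorphic_cong)
qed

text \<open>\<open>eta_approx k\<close> no longer depends on \<open>k\<close> once \<open>Re s > 1 - k\<close>.\<close>

definition eta :: "complex \<Rightarrow> complex" where
  "eta s = eta_approx (nat \<lceil>norm s\<rceil> + 2) s"

lemma eta_eq: assumes "Re s > 1 - real k" shows "eta s = eta_approx k s"
proof -
  let ?m = "nat \<lceil>norm s\<rceil> + 2"
  have "- Re s \<le> norm s" using abs_Re_le_cmod[of s] by linarith
  moreover have "norm s \<le> real (nat \<lceil>norm s\<rceil>)" by (rule real_nat_ceiling_ge)
  ultimately have "Re s > 1 - real ?m" unfolding of_nat_add of_nat_numeral by linarith
  from eta_approx_mono[OF this, of "max k ?m"] eta_approx_mono[OF assms, of "max k ?m"]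
  show ?thesis by (simp add: eta_def)
qed

lemma holomorphic_eta: "eta holomorphic_on A"
proof -
  have "eta holomorphic_on {s. Re s > 1 - real k}" for k
  proof -
    have "eta_approx k holomorphic_on {s. Re s > 1 - real k}"
      unfolding eta_approx_def
      by (intro holomorphic_intros holomorphic_eta_sum holomorphic_bdiff) auto
    thus ?thesis using eta_eq by (metis (no_types, lifting) holomorphic_cong mem_Collect_eq)
  qed
  hence "eta holomorphic_on (\<Union>k. {s. Re s > 1 - real k})"
    by (intro holomorphic_on_UN_open) (auto simp: open_halfspace_Re_gt)
  moreover have "\<exists>k::nat. Re s > 1 - real k" for s
    using reals_Archimedean2[of "1 - Re s"] by (auto simp: algebra_simps)
  hence "(\<Union>k. {s. Re s > 1 - real k}) = UNIV" by auto
  ultimately show ?thesis by (auto intro: holomorphic_on_subset)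
qed

text \<open>At \<open>s = 0\<close> all powers are 1, so every difference of order at least one
  vanishes and only the boundary term \<open>j = 0\<close> survives.\<close>

lemma eta_0: "eta 0 = -1/2"
proof -
  have "complex_of_real y \<noteq> 0" if "y > 0" for y using that by simp
  hence *: "bdiff 0 0 y = 1" if "y > 0" for y using that by simp
  have **: "bdiff (Suc 0) 0 x = 0" if "x > 0" for x using that by (simp del: bdiff.simps(1) add: *)
  \<comment> \<open>Level 2 is the first whose half-plane \<open>Re s > 1 - k\<close> contains
    0.\<close>
  have "bdiff 2 0 x = 0" if "x > 0" for x
    using that unfolding numeral_2_eq_2 by (subst bdiff.simps(2)) (simp del: bdiff.simps add: **)
  hence "eta_sum 2 0 = 0" by (simp add: eta_sum_def)
  thus ?thesis using eta_eq[of 2 0] by (simp add: eta_approx_def numeral_2_eq_2)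
qed

lemma eta_has_sum:
  assumes "Re s > 1"
  shows "((\<lambda>n. (-1) ^ n * of_nat n powr (-s)) has_sum eta s) {1..}"
proof -
  have 1: "summable (\<lambda>n. norm ((-1) ^ Suc n * bdiff 0 s (real (Suc n))))"
    using assms by (intro summable_bdiff) auto
  have "((\<lambda>n. (-1) ^ Suc n * bdiff 0 s (real (Suc n))) has_sum eta s) UNIV"
    using eta_eq[of 0 s] assms norm_summable_imp_has_sum[OF 1 summable_sums[OF summable_norm_cancel[OF 1]]]
    by (simp add: eta_approx_def eta_sum_def)
  hence "((\<lambda>n. (-1) ^ n * of_nat n powr (-s)) \<circ> Suc has_sum eta s) UNIV"
    by (simp add: o_def)
  moreover have "Suc ` UNIV = {1..}" by (auto simp: image_iff) (metis Suc_le_D)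
  ultimately show ?thesis by (subst (asm) has_sum_reindex[symmetric]) auto
qed

section \<open>Comparison of the alternating series with the zeta series\<close>

lemma norm_powr_summable_on:
  assumes "Re s > 1"
  shows "(\<lambda>n. norm (of_nat n powr (-s) :: complex)) summable_on ({1..} :: nat set)"
proof -
  have "summable (\<lambda>n. norm (real n powr (- Re s)))" using assms by (simp add: summable_real_powr_iff)
  hence "(\<lambda>n. real n powr (- Re s)) summable_on UNIV" by (rule norm_summable_imp_summable_on)
  hence "(\<lambda>n. real n powr (- Re s)) summable_on {1..}" by (rule summable_on_subset_banach) auto
  moreover have "norm (of_nat n powr (-s) :: complex) = real n powr (- Re s)" if "n \<in> {1..}" for n :: nat
    using that norm_powr_real_powr[of "of_nat n" "-s"] by simp
  ultimately show ?thesis by (subst summable_on_cong) auto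
qed

definition zeta_sum :: "complex \<Rightarrow> complex" where
  "zeta_sum s = (\<Sum>\<^sub>\<infinity>n\<in>{1::nat..}. 1 / of_nat n powr s)"

lemma zeta_sum_has_sum:
  assumes "Re s > 1"
  shows "((\<lambda>n. of_nat n powr (-s)) has_sum zeta_sum s) ({1..} :: nat set)"
proof -
  have "zeta_sum s = (\<Sum>\<^sub>\<infinity>n\<in>{1::nat..}. of_nat n powr (-s))"
    unfolding zeta_sum_def by (simp add: powr_minus field_simps)
  thus ?thesis using abs_summable_summable[OF norm_powr_summable_on[OF assms]] by simp
qed

text \<open>The alternating series is twice its even-indexed part minus the full series, and the
  even-indexed part is \<open>2 powr (-s)\<close> times the full series.\<close>

lemma eta_eq_zeta_sum:
  assumes "Re s > 1"
  shows "eta s = (2 powr (1 - s) - 1) * zeta_sum s"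
proof -
  let ?f = "\<lambda>n::nat. of_nat n powr (-s) :: complex"
  have z: "(?f has_sum zeta_sum s) {1..}" by (rule zeta_sum_has_sum[OF assms])
  have "((\<lambda>n. 2 powr (-s) * ?f n) has_sum (2 powr (-s) * zeta_sum s)) {1..}"
    by (rule has_sum_cmult_right[OF z])
  also have "?this \<longleftrightarrow> (?f \<circ> (\<lambda>n. 2 * n) has_sum (2 powr (-s) * zeta_sum s)) {1..}"
  proof (intro has_sum_cong)
    fix n :: nat assume "n \<in> {1..}"
    have "of_nat (2 * n) powr (- s) = (of_real 2 * of_real (real n)) powr (-s)" by simp
    also have "\<dots> = of_real 2 powr (-s) * of_real (real n) powr (-s)"
      by (rule powr_times_real) auto
    finally show "2 powr (-s) * ?f n = (?f \<circ> (\<lambda>n. 2 * n)) n" by simp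
  qed
  also have "\<dots> \<longleftrightarrow> (?f has_sum (2 powr (-s) * zeta_sum s)) ((\<lambda>n. 2 * n) ` {1..})"
    by (intro has_sum_reindex[symmetric]) (auto intro: inj_onI)
  also have "\<dots> \<longleftrightarrow> ((\<lambda>n. if even n then ?f n else 0) has_sum (2 powr (-s) * zeta_sum s)) {1..}"
    by (intro has_sum_cong_neutral) (auto simp: image_iff elim!: evenE)
  finally have "((\<lambda>n. 2 * (if even n then ?f n else 0) + (-1) * ?f n) has_sum (2 * (2 powr (-s) * zeta_sum s) + (-1) * zeta_sum s)) {1..}"
    by (intro has_sum_add has_sum_cmult_right z)
  also have "(\<lambda>n. 2 * (if even n then ?f n else 0) + (-1) * ?f n) = (\<lambda>n. (-1) ^ n * ?f n)"
    by auto
  finally have "eta s = 2 * (2 powr (-s) * zeta_sum s) + (-1) * zeta_sum s"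
    using eta_has_sum[OF assms] by (meson has_sum_unique)
  thus ?thesis by (simp add: powr_diff powr_minus field_simps)
qed

section \<open>Unique meromorphic continuation\<close>

text \<open>On the connected plane the difference either vanishes off a sparse set or is nonzero off
  a sparse set; agreement near the point 2 excludes the latter.\<close>

lemma meromorphic_eq_eventually:
  assumes "f meromorphic_on UNIV" "g meromorphic_on UNIV"
    and eq: "\<And>s. Re s > 1 \<Longrightarrow> f s = g s"
  shows "eventually (\<lambda>w. f w = g w) (at s)"
proof -
  have "eventually (\<lambda>z. f z - g z = 0) (cosparse UNIV) \<or> eventually (\<lambda>z. f z - g z \<noteq> 0) (cosparse UNIV)"
    by (rule meromorphic_imp_constant_or_avoid) (auto intro!: meromorphic_intros assms)
  moreover have "\<not> eventually (\<lambda>z. f z - g z \<noteq> 0) (cosparse UNIV)"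
  proof
    assume "eventually (\<lambda>z. f z - g z \<noteq> 0) (cosparse UNIV)"
    hence 1: "eventually (\<lambda>z. f z - g z \<noteq> 0) (at 2)"
      by (auto simp: eventually_cosparse_open_eq)
    have 2: "eventually (\<lambda>z. z \<in> {z. Re z > 1}) (at (2 :: complex))"
      by (intro eventually_at_in_open') (auto simp: open_halfspace_Re_gt)
    from 1 2 have "eventually (\<lambda>z. False) (at (2 :: complex))"
      by eventually_elim (use eq in auto)
    thus False by simp
  qed
  ultimately show ?thesis by (auto simp: eventually_cosparse_open_eq)
qed

text \<open>Continuity at \<open>s\<close> passes agreement from the punctured neighbourhood to the
  point itself.\<close>

lemma analytic_eq_of_eventually_eq:
  assumes "f analytic_on {s}" "g analytic_on {s}" "eventually (\<lambda>w. f w = g w) (at s)"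
  shows "f s = g s"
proof -
  have "f \<midarrow>s\<rightarrow> f s" "g \<midarrow>s\<rightarrow> g s"
    using assms(1,2) by (auto intro: isContD analytic_at_imp_isCont)
  moreover have "f \<midarrow>s\<rightarrow> g s \<longleftrightarrow> g \<midarrow>s\<rightarrow> g s" by (rule tendsto_cong[OF assms(3)])
  ultimately show ?thesis by (meson LIM_unique)
qed

text \<open>\<open>remove_sings\<close> depends only on the function in a punctured neighbourhood
  and fixes nicely meromorphic functions, so all candidates for the definite description coincide.
  Analyticity on the half-plane ensures that \<open>remove_sings\<close> keeps the prescribed values
  there.\<close>

lemma mero_ext_eq:
  assumes mero: "f meromorphic_on UNIV" and ana: "f analytic_on {s. Re s > 1}"
    and eq: "\<And>s. Re s > 1 \<Longrightarrow> f s = f0 s"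
  shows "mero_ext f0 = remove_sings f"
  unfolding mero_ext_def
proof (rule the_equality, intro conjI allI impI)
  show "remove_sings f nicely_meromorphic_on UNIV"
    by (rule remove_sings_nicely_meromorphic[OF mero])
  show *: "remove_sings f s = f0 s" if "Re s > 1" for s
    using that eq[of s] analytic_on_subset[OF ana, of "{s}"] by simp
  fix g assume g: "g nicely_meromorphic_on UNIV \<and> (\<forall>s. Re s > 1 \<longrightarrow> g s = f0 s)"
  have "g s = remove_sings f s" for s
  proof -
    have ev: "eventually (\<lambda>w. g w = remove_sings f w) (at s)"
      by (rule meromorphic_eq_eventually)
         (use g mero * in \<open>auto simp: nicely_meromorphic_on_def intro: remove_sings_meromorphic\<close>)
    have "remove_sings g s = remove_sings (remove_sings f) s"
      by (rule remove_sings_cong) (use ev in auto)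
    moreover have "remove_sings h s = h s" if "h nicely_meromorphic_on UNIV" for h
      using that unfolding nicely_meromorphic_on_def by (metis UNIV_I remove_sings_at_pole remove_sings_eqI)
    ultimately show ?thesis using g remove_sings_nicely_meromorphic[OF mero] by metis
  qed
  thus "g = remove_sings f" by auto
qed

text \<open>The factor has modulus 1 + its zeros only where \<open>Re s = 1\<close>: in the open
  half-plane \<open>2 powr (1 - s)\<close> has modulus below 1, so dividing by the difference
  creates no pole there.\<close>

lemma two_powr_neq_1:
  assumes "Re s > 1" shows "2 powr (1 - s) - 1 \<noteq> (0::complex)"
proof
  assume "2 powr (1 - s) - 1 = (0::complex)"
  hence "norm (2 powr (1 - s) :: complex) = 1" by simp
  moreover have "norm (2 powr (1 - s) :: complex) = 2 powr (1 - Re s)"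
    using norm_powr_real_powr[of 2 "1 - s"] by simp
  ultimately have "2 powr (1 - Re s) = 2 powr (0 :: real)" by simp
  thus False using assms by simp
qed

lemma eta_analytic: "eta analytic_on A"
  using holomorphic_eta[of UNIV] analytic_on_subset[of eta UNIV A] by (simp add: analytic_on_open)

text \<open>The quotient is meromorphic on the plane because \<open>eta\<close> is entire;
  \<open>remove_sings\<close> takes care of the zeros of the denominator on the line
  \<open>Re s = 1\<close>.\<close>

lemma riemann_zeta_eq: "riemann_zeta = remove_sings (\<lambda>s. eta s / (2 powr (1 - s) - 1))"
  unfolding riemann_zeta_def
proof (rule mero_ext_eq)
  show "(\<lambda>s. eta s / (2 powr (1 - s) - 1)) meromorphic_on UNIV"
    by (intro meromorphic_intros analytic_on_imp_meromorphic_on eta_analytic analytic_intros) auto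
  show "(\<lambda>s. eta s / (2 powr (1 - s) - 1)) analytic_on {s. Re s > 1}"
    using two_powr_neq_1 by (intro analytic_intros eta_analytic) auto
  show "eta s / (2 powr (1 - s) - 1) = (\<Sum>\<^sub>\<infinity>n\<in>{1::nat..}. 1 / of_nat n powr s)" if "Re s > 1" for s
    using eta_eq_zeta_sum[OF that] two_powr_neq_1[OF that] by (simp add: zeta_sum_def field_simps)
qed

lemma riemann_zeta_meromorphic: "riemann_zeta meromorphic_on A"
proof -
  have "(\<lambda>s. eta s / (2 powr (1 - s) - 1)) meromorphic_on UNIV"
    by (intro meromorphic_intros analytic_on_imp_meromorphic_on eta_analytic analytic_intros) auto
  thus ?thesis unfolding riemann_zeta_eq by (metis remove_sings_meromorphic meromorphic_on_subset subset_UNIV)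
qed

lemma riemann_zeta_analytic: "riemann_zeta analytic_on {s. Re s > 1}"
  unfolding riemann_zeta_eq
  using two_powr_neq_1 by (intro remove_sings_analytic_on analytic_intros eta_analytic) auto

lemma riemann_zeta_eq_eta_divide:
  assumes "2 powr (1 - s) \<noteq> 1"
  shows "riemann_zeta s = eta s / (2 powr (1 - s) - 1)"
  unfolding riemann_zeta_eq
  by (rule remove_sings_at_analytic) (use assms in \<open>auto intro!: analytic_intros eta_analytic\<close>)

lemma phi_eq_eta:
  assumes "2 powr (1 - s) \<noteq> 1" shows "phi s = eta s"
  using riemann_zeta_eq_eta_divide[OF assms] assms by (simp add: phi_def)

lemma riemann_zeta_has_sum:
  assumes "Re s > 1"
  shows "((\<lambda>n. of_nat n powr (-s)) has_sum riemann_zeta s) ({1..} :: nat set)"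
proof -
  have "riemann_zeta s = zeta_sum s"
    using riemann_zeta_eq_eta_divide[of s] two_powr_neq_1[OF assms] eta_eq_zeta_sum[OF assms] by simp
  thus ?thesis using zeta_sum_has_sum[OF assms] by simp
qed

lemma phi_has_sum:
  assumes "Re s > 1"
  shows "((\<lambda>n. (-1) ^ n * of_nat n powr (-s)) has_sum phi s) ({1..} :: nat set)"
  using phi_eq_eta[of s] two_powr_neq_1[OF assms] eta_has_sum[OF assms] by simp

lemma phi_0: "phi 0 = -1/2"
  by (simp add: phi_eq_eta eta_0)

lemma zeta_expressible_meromorphic:
  assumes "f \<in> zeta_expressible" shows "f meromorphic_on A"
  using assms
proof induction
  case (zeta_shift k)
  show ?case
    by (rule meromorphic_on_compose[of riemann_zeta UNIV "\<lambda>s. s + of_int k" A])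
       (auto intro!: analytic_intros riemann_zeta_meromorphic)
next
  case two_powr
  show ?case by (intro analytic_on_imp_meromorphic_on analytic_intros) auto
qed (auto intro!: meromorphic_intros)

section \<open>Partial fractions and symmetric summation\<close>

text \<open>With \<open>u = 1/X\<close> and \<open>n = 1/N\<close> this is the principal part at
  \<open>X = 0\<close> of 1 / (X^(p+1) (X+N)^(c+1)); both parameters are one less than the
  exponents. Written without division, it also makes sense for formal power series.\<close>

definition pfrac :: "'a::comm_ring_1 \<Rightarrow> 'a \<Rightarrow> nat \<Rightarrow> nat \<Rightarrow> 'a" where
  "pfrac u n p c = (\<Sum>j\<le>p. (-1) ^ j * of_nat ((c + j) choose c) * n ^ (c + 1 + j) * u ^ (p + 1 - j))"

text \<open>Pascal's rule for the coefficients. It mirrors the recursion of the products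
  \<open>u ^ Suc p * v ^ Suc c\<close> when one factor \<open>u * v\<close> is replaced by
  \<open>n * (u - v)\<close>.\<close>

lemma pfrac_Suc_Suc: "pfrac u n (Suc p) (Suc c) = n * (pfrac u n (Suc p) c - pfrac u n p (Suc c))"
proof -
  let ?t = "\<lambda>j. (-1) ^ j * n ^ (c + 2 + j) * u ^ (p + 2 - j)"
  have "n * pfrac u n (Suc p) c = (\<Sum>j\<le>Suc p. of_nat ((c + j) choose c) * ?t j)"
    unfolding pfrac_def sum_distrib_left by (intro sum.cong) (auto simp: algebra_simps)
  also have "\<dots> = ?t 0 + (\<Sum>j\<le>p. of_nat ((c + Suc j) choose c) * ?t (Suc j))"
    by (subst sum.atMost_Suc_shift) simp
  finally have 1: "n * pfrac u n (Suc p) c = ?t 0 + (\<Sum>j\<le>p. of_nat ((c + Suc j) choose c) * ?t (Suc j))" .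
  have 2: "n * pfrac u n p (Suc c) = - (\<Sum>j\<le>p. of_nat ((Suc c + j) choose Suc c) * ?t (Suc j))"
    unfolding pfrac_def sum_distrib_left sum_negf[symmetric]
    by (intro sum.cong) (auto simp: algebra_simps)
  have "pfrac u n (Suc p) (Suc c) = (\<Sum>j\<le>Suc p. of_nat ((Suc c + j) choose Suc c) * ?t j)"
    unfolding pfrac_def by (intro sum.cong) (auto simp: algebra_simps)
  also have "\<dots> = ?t 0 + (\<Sum>j\<le>p. of_nat ((Suc c + Suc j) choose Suc c) * ?t (Suc j))"
    by (subst sum.atMost_Suc_shift) simp
  also have "(\<Sum>j\<le>p. of_nat ((Suc c + Suc j) choose Suc c) * ?t (Suc j)) =
      (\<Sum>j\<le>p. of_nat ((c + Suc j) choose c) * ?t (Suc j)) + (\<Sum>j\<le>p. of_nat ((Suc c + j) choose Suc c) * ?t (Suc j))"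
    unfolding sum.distrib[symmetric] by (intro sum.cong refl) (simp add: distrib_right)
  finally show ?thesis unfolding right_diff_distrib 1 2 by simp
qed

lemma pfrac_0_left: "pfrac u n 0 c = n ^ (c + 1) * u"
  by (simp add: pfrac_def)

lemma pfrac_Suc_0: "pfrac u n (Suc p) 0 = n * u ^ (p + 2) - n * pfrac u n p 0"
  unfolding pfrac_def
  by (subst sum.atMost_Suc_shift) (simp add: sum_distrib_left sum_negf algebra_simps)

text \<open>The hypothesis is the relation between \<open>u = 1/X\<close>, \<open>v = 1/(X + N)\<close> and \<open>n = 1/N\<close>.\<close>

lemma partial_fraction:
  fixes u v n :: "'a::comm_ring_1"
  assumes uv: "u * v = n * (u - v)"
  shows "u ^ Suc p * v ^ Suc c = pfrac u n p c + pfrac v (- n) c p"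
proof (induction "p + c" arbitrary: p c rule: less_induct)
  case less
  \<comment> \<open>Exchanging \<open>u\<close> and \<open>v\<close> and negating \<open>n\<close>
    preserves the relation, so the base case for \<open>p = 0\<close> also settles
    \<open>c = 0\<close>.\<close>
  have vu: "v * u = (- n) * (v - u)" using uv by (simp add: algebra_simps)
  have base: "u * v ^ Suc c = pfrac u n 0 c + pfrac v (- n) c 0"
    if "u * v = n * (u - v)" for u v n :: 'a and c
  proof (induction c)
    case 0 thus ?case using that by (simp add: pfrac_0_left algebra_simps)
  next
    case (Suc c)
    have "u * v ^ Suc (Suc c) = (u * v) * v ^ Suc c" by (simp add: algebra_simps)
    also have "\<dots> = n * (u * v ^ Suc c) - n * v ^ (c + 2)" unfolding that by (simp add: algebra_simps)
    also have "\<dots> = pfrac u n 0 (Suc c) + pfrac v (- n) (Suc c) 0"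
      unfolding Suc pfrac_0_left pfrac_Suc_0 by (simp add: algebra_simps)
    finally show ?case .
  qed
  show ?case
  proof (cases p)
    case 0 thus ?thesis using base[OF uv] by simp
  next
    case p: (Suc p')
    show ?thesis
    proof (cases c)
      case 0 thus ?thesis using base[OF vu, of p] by (simp add: algebra_simps)
    next
      case c: (Suc c')
      have "u ^ Suc p * v ^ Suc c = (u * v) * u ^ p * v ^ c" by (simp add: algebra_simps)
      also have "\<dots> = n * (u ^ Suc p * v ^ Suc c' - u ^ Suc p' * v ^ Suc c)"
        unfolding uv p c by (simp add: algebra_simps)
      also have "\<dots> = n * ((pfrac u n p c' + pfrac v (- n) c' p) - (pfrac u n p' c + pfrac v (- n) c p'))"
        using less[of p c'] less[of p' c] p c by simp
      also have "\<dots> = pfrac u n p c + pfrac v (- n) c p"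
        unfolding p c pfrac_Suc_Suc by (simp add: algebra_simps)
      finally show ?thesis .
    qed
  qed
qed

section \<open>Laurent expansions of inverse linear forms\<close>

abbreviation lin :: "complex \<Rightarrow> complex fps" where
  "lin c \<equiv> fps_X + fps_const c"

text \<open>The expansion of 1 / (z - P) at z = l is \<open>lin_inv (l - P)\<close>. The Laurent
  field is needed for \<open>c = 0\<close>, where the form has no inverse power series.\<close>

definition lin_inv :: "complex \<Rightarrow> complex fls" where
  "lin_inv c = inverse (fps_to_fls (lin c))"

lemma lin_nonzero [simp]: "lin c \<noteq> 0"
proof
  assume "lin c = 0"
  hence "fps_nth (lin c) 1 = 0" by simp
  thus False by simp
qed

lemma lin_inv_0: "lin_inv 0 = fls_X_inv"
  by (simp add: lin_inv_def fls_inverse_X)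

lemma lin_inv_power: "c \<noteq> 0 \<Longrightarrow> lin_inv c ^ n = fps_to_fls (inverse (lin c ^ n))"
  unfolding lin_inv_def
  by (subst fls_inverse_fps_to_fls) (auto simp: fps_to_fls_power fps_inverse_power intro!: subdegree_eq_0)

text \<open>Negative binomial series, once the constant \<open>c\<close> is pulled out of the linear
  form.\<close>

lemma lin_inverse_power_nth:
  assumes "c \<noteq> 0"
  shows "fps_nth (inverse (lin c ^ Suc n)) k = (-1) ^ k * of_nat ((n + k) choose k) / c ^ (Suc n + k)"
proof -
  have "lin c = fps_const c * (1 - fps_const (- inverse c) * fps_X)"
    using assms by (simp add: algebra_simps flip: fps_const_neg mult.assoc)
  hence "inverse (lin c ^ Suc n) = fps_const (inverse c ^ Suc n) * inverse ((1 - fps_const (- inverse c) * fps_X) ^ Suc n)"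
    using assms by (simp only: power_mult_distrib fps_inverse_mult fps_const_power fps_const_inverse power_inverse)
  also have "\<dots> = fps_const (inverse c ^ Suc n) * Abs_fps (\<lambda>k. of_nat ((Suc n + k - 1) choose k) * (- inverse c) ^ k)"
    by (subst one_minus_const_fps_X_neg_power') auto
  finally show ?thesis
    by (simp add: power_minus[of "inverse c"] divide_inverse power_inverse power_add inverse_mult_distrib)
qed

text \<open>The two linear forms differ by a constant, so the product of their inverses is a
  multiple of the difference of the inverses. Each splitting below uses this.\<close>

lemma lin_inv_mult:
  assumes "d \<noteq> c"
  shows "lin_inv c * lin_inv d = fls_const (1 / (d - c)) * (lin_inv c - lin_inv d)"
proof -
  have "fps_to_fls (lin d) - fps_to_fls (lin c) = fls_const (d - c)"
    by (simp add: fls_minus_const)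
  moreover have "fps_to_fls (lin d) \<noteq> 0" "fps_to_fls (lin c) \<noteq> 0" by (simp_all del: fps_to_fls_plus)
  ultimately have "lin_inv c - lin_inv d = fls_const (d - c) * (lin_inv c * lin_inv d)"
    unfolding lin_inv_def by (simp add: field_simps del: fps_to_fls_plus)
  moreover have "fls_const (1 / (d - c)) * fls_const (d - c) = 1"
    using assms by simp
  ultimately show ?thesis by (simp flip: mult.assoc)
qed

section \<open>Symmetric sums and Laurent coefficients at the poles\<close>

text \<open>
  The value at \<open>l\<close> is the Laurent expansion of \<open>1 / (z^p (z + M)^a (z + N)^c)\<close> at \<open>z = l\<close>.
\<close>

definition laurent_family :: "nat \<Rightarrow> nat \<Rightarrow> nat \<Rightarrow> complex \<Rightarrow> complex \<Rightarrow> int \<Rightarrow> complex fls" where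
  "laurent_family p a c M N l = lin_inv (of_int l) ^ p * lin_inv (of_int l + M) ^ a * lin_inv (of_int l + N) ^ c"

text \<open>\<open>E i\<close> stands for the symmetric sum of x^m / m^i. The set \<open>S\<close>
  may contain points that are not poles and \<open>n\<close> may exceed the pole orders, so that one
  choice serves all terms of a linear combination.\<close>

definition symmetric_sum :: "complex \<Rightarrow> (nat \<Rightarrow> complex) \<Rightarrow> int set \<Rightarrow> nat \<Rightarrow> (int \<Rightarrow> complex fls) \<Rightarrow> bool" where
  "symmetric_sum x E S n G \<longleftrightarrow>
     (\<lambda>K. \<Sum>l\<in>{- int K..int K}. x powi l * (fls_nth (G l) 0)) \<longlonglongrightarrow>
        (\<Sum>P\<in>S. x powi P * (\<Sum>i=1..n. E i * (fls_nth (G P) (- int i))))"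

lemma symmetric_sum_diff:
  assumes "symmetric_sum x E S n G" "symmetric_sum x E S n H"
  shows "symmetric_sum x E S n (\<lambda>l. G l - H l)"
  using tendsto_diff[OF assms[unfolded symmetric_sum_def]] unfolding symmetric_sum_def
  by (simp add: ring_distribs sum_subtractf)

lemma symmetric_sum_cmult:
  assumes "symmetric_sum x E S n G"
  shows "symmetric_sum x E S n (\<lambda>l. fls_const k * G l)"
  using tendsto_mult_left[OF assms[unfolded symmetric_sum_def], of k] unfolding symmetric_sum_def
  by (simp add: sum_distrib_left mult_ac)

lemma window_shift:
  fixes e :: "int \<Rightarrow> complex"
  assumes lim: "(\<lambda>K. \<Sum>m\<in>{- int K..int K}. e m) \<longlonglongrightarrow> L"
    and up: "\<And>j. (\<lambda>K. e (int K + j)) \<longlonglongrightarrow> 0" and down: "\<And>j. (\<lambda>K. e (- int K + j)) \<longlonglongrightarrow> 0"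
  shows "(\<lambda>K. \<Sum>m\<in>{- int K - P..int K - P}. e m) \<longlonglongrightarrow> L"
proof -
  have step: "(\<Sum>m\<in>{- int K - (Q + 1)..int K - (Q + 1)}. e m) =
               (\<Sum>m\<in>{- int K - Q..int K - Q}. e m) + (e (- int K - Q - 1) - e (int K - Q))" for K Q
  proof -
    have "{- int K - Q - 1..int K - Q} = insert (int K - Q) {- int K - (Q + 1)..int K - (Q + 1)}"
         "{- int K - Q - 1..int K - Q} = insert (- int K - Q - 1) {- int K - Q..int K - Q}"
      by auto
    hence "e (int K - Q) + (\<Sum>m\<in>{- int K - (Q + 1)..int K - (Q + 1)}. e m)
        = e (- int K - Q - 1) + (\<Sum>m\<in>{- int K - Q..int K - Q}. e m)"
      by (metis (no_types, lifting) sum.insert finite_atLeastAtMost_int atLeastAtMost_iff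
            add_0 diff_add_cancel not_less order_refl zless_add1_eq diff_diff_eq less_add_one)
    thus ?thesis by (simp add: algebra_simps)
  qed
  have z: "(\<lambda>K. e (- int K - Q - 1) - e (int K - Q)) \<longlonglongrightarrow> 0" for Q
  proof -
    have "- int K - Q - 1 = - int K + (- Q - 1)" "int K - Q = int K + (- Q)" for K by simp_all
    thus ?thesis using tendsto_diff[OF down[of "- Q - 1"] up[of "- Q"]] by (simp only: diff_zero)
  qed
  show ?thesis
  proof (induction P rule: int_induct[of _ 0])
    case base thus ?case using lim by simp
  next
    case (step1 i)
    thus ?case using tendsto_add[OF step1(2) z[of i]] unfolding step by simp
  next
    case (step2 i)
    have "(\<Sum>m\<in>{- int K - i..int K - i}. e m) - (e (- int K - (i - 1) - 1) - e (int K - (i - 1)))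
        = (\<Sum>m\<in>{- int K - (i - 1)..int K - (i - 1)}. e m)" for K
      using step[of K "i - 1"] by simp
    thus ?case using tendsto_diff[OF step2(2) z[of "i - 1"]] by simp
  qed
qed

text \<open>The substitution \<open>m = l - P\<close> moves the pole to 0 at the price of the factor
  \<open>x powi P\<close> and a shifted window.\<close>

lemma symmetric_sum_simple:
  fixes x :: complex
  assumes x: "x = 1 \<or> x = -1" and S: "finite S" "P \<in> S" and i: "1 \<le> i" "i \<le> n"
    and E: "(\<lambda>K. \<Sum>m\<in>{- int K..int K}. x powi m / of_int m ^ i) \<longlonglongrightarrow> E i"
  shows "symmetric_sum x E S n (\<lambda>l. lin_inv (of_int l - of_int P) ^ i)"
proof -
  let ?e = "\<lambda>m. x powi m / of_int m ^ i"
  have nx: "norm (x powi m) = 1" for m using x by (auto simp: norm_power_int)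
  have x0: "x \<noteq> 0" using x by auto
  have bd: "norm (?e m) \<le> 1 / \<bar>real_of_int m\<bar>" for m
  proof (cases "m = 0")
    case False
    have "\<bar>real_of_int m\<bar> ^ 1 \<le> \<bar>real_of_int m\<bar> ^ i" using False i by (intro power_increasing) auto
    thus ?thesis using False by (simp add: norm_divide norm_power nx divide_simps)
  qed (use i in auto)
  have 1: "(\<lambda>K. ?e (int K + j)) \<longlonglongrightarrow> 0" for j
  proof (rule Lim_null_comparison)
    show "\<forall>\<^sub>F K in sequentially. norm (?e (int K + j)) \<le> 1 / \<bar>real K + of_int j\<bar>"
      using bd[of "int K + j" for K] by simp
    show "(\<lambda>K. 1 / \<bar>real K + of_int j\<bar>) \<longlonglongrightarrow> 0" by real_asymp
  qed
  have 2: "(\<lambda>K. ?e (- int K + j)) \<longlonglongrightarrow> 0" for j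
  proof (rule Lim_null_comparison)
    show "\<forall>\<^sub>F K in sequentially. norm (?e (- int K + j)) \<le> 1 / \<bar>- real K + of_int j\<bar>"
      using bd[of "- int K + j" for K] by simp
    show "(\<lambda>K. 1 / \<bar>- real K + of_int j\<bar>) \<longlonglongrightarrow> 0" by real_asymp
  qed
  have "(\<lambda>K. \<Sum>m\<in>{- int K - P..int K - P}. ?e m) \<longlonglongrightarrow> E i"
    by (rule window_shift[OF E 1 2])
  hence "(\<lambda>K. x powi P * (\<Sum>m\<in>{- int K - P..int K - P}. ?e m)) \<longlonglongrightarrow> x powi P * E i"
    by (rule tendsto_mult_left)
  \<comment> \<open>At \<open>l = P\<close> both sides are 0: a pure pole has no constant term since
    \<open>i \<ge> 1\<close>, and division by zero gives 0 on the right.\<close>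
  moreover have c0: "fls_nth (lin_inv (of_int l - of_int P) ^ i) 0 = 1 / of_int (l - P) ^ i" for l
  proof (cases "l = P")
    case True thus ?thesis using i by (simp add: lin_inv_0 fls_X_inv_power_conv_shift_1)
  next
    case False
    hence "complex_of_int l - of_int P \<noteq> 0" by simp
    thus ?thesis
      using lin_inverse_power_nth[of "of_int l - of_int P" "i - 1" 0] i
      by (simp add: lin_inv_power del: power_Suc)
  qed
  have "(\<Sum>l\<in>{- int K..int K}. x powi l * (fls_nth (lin_inv (of_int l - of_int P) ^ i) 0)) =
        x powi P * (\<Sum>m\<in>{- int K - P..int K - P}. ?e m)" for K
    unfolding sum_distrib_left c0
    by (rule sum.reindex_bij_witness[of _ "\<lambda>m. m + P" "\<lambda>l. l - P"])
       (use x0 in \<open>auto simp: power_int_diff\<close>)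
  \<comment> \<open>Only \<open>Q = P\<close> has negative powers, and there only the power
    \<open>- i\<close>.\<close>
  moreover have "(\<Sum>Q\<in>S. x powi Q * (\<Sum>j=1..n. E j * fls_nth (lin_inv (of_int Q - of_int P) ^ i) (- int j))) = x powi P * E i"
  proof -
    have "(\<Sum>Q\<in>S. x powi Q * (\<Sum>j=1..n. E j * fls_nth (lin_inv (of_int Q - of_int P) ^ i) (- int j))) =
          (\<Sum>Q\<in>S. if Q = P then x powi P * E i else 0)"
    proof (intro sum.cong refl)
      fix Q assume "Q \<in> S"
      show "x powi Q * (\<Sum>j=1..n. E j * fls_nth (lin_inv (of_int Q - of_int P) ^ i) (- int j)) = (if Q = P then x powi P * E i else 0)"
      proof (cases "Q = P")
        case True
        have "(\<Sum>j=1..n. E j * fls_nth (lin_inv 0 ^ i) (- int j)) = (\<Sum>j=1..n. if j = i then E i else 0)"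
          by (intro sum.cong) (auto simp: lin_inv_0 fls_X_inv_power_conv_shift_1)
        thus ?thesis using True i by simp
      next
        case False
        hence "complex_of_int Q - of_int P \<noteq> 0" by simp
        thus ?thesis using False by (auto simp: lin_inv_power intro!: sum.neutral)
      qed
    qed
    thus ?thesis using S by simp
  qed
  ultimately show ?thesis unfolding symmetric_sum_def by simp
qed

text \<open>Induction on the total order: splitting two factors lowers it by one in each summand
  until a single pole remains. The conditions on \<open>n\<close> and \<open>S\<close> are inherited
  because exponents only drop; distinctness of 0, \<open>M\<close>, \<open>N\<close> makes the
  splitting constants finite.\<close>

lemma symmetric_sum_laurent_family:
  fixes x :: complex and M N :: int
  assumes x: "x = 1 \<or> x = -1" and S: "finite S"
    and E: "\<And>i. i \<ge> 1 \<Longrightarrow> (\<lambda>K. \<Sum>m\<in>{- int K..int K}. x powi m / of_int m ^ i) \<longlonglongrightarrow> E i"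
    and MN: "M \<noteq> 0" "N \<noteq> 0" "M \<noteq> N"
    and "p + a + c \<ge> 1" "p + a + c \<le> n"
    and "p > 0 \<longrightarrow> 0 \<in> S" "a > 0 \<longrightarrow> - M \<in> S" "c > 0 \<longrightarrow> - N \<in> S"
  shows "symmetric_sum x E S n (laurent_family p a c (of_int M) (of_int N))"
  using assms(7-)
proof (induction "p + a + c" arbitrary: p a c rule: less_induct)
  case less
  note IH = less(1) and pr = less(2-)
  have simple: "symmetric_sum x E S n (\<lambda>l. lin_inv (of_int l - of_int P) ^ i)" if "P \<in> S" "1 \<le> i" "i \<le> n" for P i
    using that by (intro symmetric_sum_simple x S E)
  have ex: "u ^ Suc i * v ^ Suc j * w = fls_const k * (u ^ Suc i * v ^ j * w - u ^ i * v ^ Suc j * w)"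
    if "u * v = fls_const k * (u - v)" for u v w :: "complex fls" and k i j
  proof -
    have "u ^ Suc i * v ^ Suc j * w = (u * v) * (u ^ i * v ^ j * w)" by (simp add: algebra_simps)
    thus ?thesis unfolding that by (simp add: algebra_simps)
  qed
  consider "p > 0" "a > 0" | "p > 0" "c > 0" | "a > 0" "c > 0" | "p = 0" "a = 0" | "p = 0" "c = 0" | "a = 0" "c = 0"
    by auto
  thus ?case
  proof cases
    case 1
    then obtain p' a' where eq: "p = Suc p'" "a = Suc a'" by (metis Suc_pred)
    have *: "laurent_family p a c (of_int M) (of_int N) = (\<lambda>l. fls_const (1 / of_int M) *
        (laurent_family p a' c (of_int M) (of_int N) l - laurent_family p' a c (of_int M) (of_int N) l))"
      unfolding laurent_family_def eq by (intro ext ex) (use lin_inv_mult[of "of_int l + of_int M" "of_int l" for l] MN in simp)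
    show ?thesis
      unfolding * using pr eq by (intro symmetric_sum_cmult symmetric_sum_diff IH) auto
  next
    case 2
    then obtain p' c' where eq: "p = Suc p'" "c = Suc c'" by (metis Suc_pred)
    have *: "laurent_family p a c (of_int M) (of_int N) = (\<lambda>l. fls_const (1 / of_int N) *
        (laurent_family p a c' (of_int M) (of_int N) l - laurent_family p' a c (of_int M) (of_int N) l))"
    proof
      fix l
      have "lin_inv (of_int l) ^ Suc p' * lin_inv (of_int l + of_int N) ^ Suc c' * lin_inv (of_int l + of_int M) ^ a =
            fls_const (1 / of_int N) * (lin_inv (of_int l) ^ Suc p' * lin_inv (of_int l + of_int N) ^ c' * lin_inv (of_int l + of_int M) ^ a
              - lin_inv (of_int l) ^ p' * lin_inv (of_int l + of_int N) ^ Suc c' * lin_inv (of_int l + of_int M) ^ a)"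
        by (rule ex) (use lin_inv_mult[of "of_int l + of_int N" "of_int l"] MN in simp)
      thus "laurent_family p a c (of_int M) (of_int N) l = fls_const (1 / of_int N) *
        (laurent_family p a c' (of_int M) (of_int N) l - laurent_family p' a c (of_int M) (of_int N) l)"
        unfolding laurent_family_def eq by (simp only: mult_ac)
    qed
    show ?thesis
      unfolding * using pr eq by (intro symmetric_sum_cmult symmetric_sum_diff IH) auto
  next
    case 3
    then obtain a' c' where eq: "a = Suc a'" "c = Suc c'" by (metis Suc_pred)
    have *: "laurent_family p a c (of_int M) (of_int N) = (\<lambda>l. fls_const (1 / (of_int N - of_int M)) *
        (laurent_family p a c' (of_int M) (of_int N) l - laurent_family p a' c (of_int M) (of_int N) l))"
    proof
      fix l
      have "lin_inv (of_int l + of_int M) ^ Suc a' * lin_inv (of_int l + of_int N) ^ Suc c' * lin_inv (of_int l) ^ p =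
            fls_const (1 / (of_int N - of_int M)) * (lin_inv (of_int l + of_int M) ^ Suc a' * lin_inv (of_int l + of_int N) ^ c' * lin_inv (of_int l) ^ p
              - lin_inv (of_int l + of_int M) ^ a' * lin_inv (of_int l + of_int N) ^ Suc c' * lin_inv (of_int l) ^ p)"
        by (rule ex) (use lin_inv_mult[of "of_int l + of_int N" "of_int l + of_int M"] MN in simp)
      thus "laurent_family p a c (of_int M) (of_int N) l = fls_const (1 / (of_int N - of_int M)) *
        (laurent_family p a c' (of_int M) (of_int N) l - laurent_family p a' c (of_int M) (of_int N) l)"
        unfolding laurent_family_def eq by (simp only: mult_ac)
    qed
    show ?thesis
      unfolding * using pr eq by (intro symmetric_sum_cmult symmetric_sum_diff IH) auto
  next
    case 4
    thus ?thesis using simple[of "-N" c] pr unfolding laurent_family_def by simp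
  next
    case 5
    thus ?thesis using simple[of "-M" a] pr unfolding laurent_family_def by simp
  next
    case 6
    thus ?thesis using simple[of 0 p] pr unfolding laurent_family_def by simp
  qed
qed

text \<open>An unordered sum is a limit over all finite subsets, and any windows that eventually
  capture each point are cofinal among them.\<close>

lemma has_sum_imp_tendsto:
  assumes "(f has_sum s) A" "\<And>K. finite (W K)" "\<And>K. W K \<subseteq> A"
    and ev: "\<And>x. x \<in> A \<Longrightarrow> eventually (\<lambda>K. x \<in> W K) sequentially"
  shows "(\<lambda>K::nat. \<Sum>x\<in>W K. f x) \<longlonglongrightarrow> s"
proof -
  have "filterlim W (finite_subsets_at_top A) sequentially"
    unfolding filterlim_finite_subsets_at_top
  proof (intro allI impI)
    fix X assume X: "finite X \<and> X \<subseteq> A"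
    hence "eventually (\<lambda>K. \<forall>x\<in>X. x \<in> W K) sequentially"
      by (intro eventually_ball_finite) (auto intro: ev)
    thus "eventually (\<lambda>K. finite (W K) \<and> X \<subseteq> W K \<and> W K \<subseteq> A) sequentially"
      by eventually_elim (use assms in auto)
  qed
  thus ?thesis using assms(1) unfolding has_sum_def by (rule filterlim_compose[rotated])
qed

text \<open>
  The symmetric sum of \<open>x^m / m^i\<close> over nonzero integers \<open>m\<close>. The value at \<open>i = 0\<close> is chosen so that it
  accounts for the constant terms at the poles.
\<close>

definition window_coeff :: "complex \<Rightarrow> nat \<Rightarrow> complex" where
  "window_coeff x i = (if i = 0 then -1 else if odd i then 0 else
     2 * (if x = 1 then riemann_zeta (of_nat i) else phi (of_nat i)))"

lemma window_coeff_minus1: "window_coeff (-1) (2 * j) = 2 * phi (of_nat (2 * j))"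
  by (auto simp: window_coeff_def phi_0)

lemma window_coeff_odd: "odd i \<Longrightarrow> window_coeff x i = 0"
  by (auto simp: window_coeff_def elim: oddE)

text \<open>The terms at \<open>m\<close> and \<open>- m\<close> cancel for odd \<open>i\<close> and
  coincide for even \<open>i\<close>. For \<open>x = 1\<close> and \<open>i = 1\<close> this
  cancellation is the only reason for convergence.\<close>

lemma window_coeff_tendsto:
  assumes x: "x = 1 \<or> x = -1" and i: "i \<ge> 1"
  shows "(\<lambda>K. \<Sum>m\<in>{- int K..int K}. x powi m / of_int m ^ i) \<longlonglongrightarrow> window_coeff x i"
proof -
  let ?f = "\<lambda>m. x powi m / of_int m ^ i"
  let ?g = "\<lambda>m::nat. x ^ m / of_nat m ^ i"
  \<comment> \<open>The term \<open>m = 0\<close> contributes 0 by division by zero, as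
    \<open>i \<ge> 1\<close>.\<close>
  have eq: "(\<Sum>m\<in>{- int K..int K}. ?f m) = (1 + (-1) ^ i) * (\<Sum>m\<in>{1..K}. ?g m)" for K
  proof (induction K)
    case 0 thus ?case using i by simp
  next
    case (Suc K)
    have "{- int (Suc K)..int (Suc K)} = insert (int (Suc K)) (insert (- int (Suc K)) {- int K..int K})" by auto
    moreover have "x powi (- int (Suc K)) = x ^ Suc K"
      unfolding power_int_minus power_int_of_nat power_inverse[symmetric] using x by auto
    moreover have "x powi (int (Suc K)) = x ^ Suc K" unfolding power_int_of_nat ..
    ultimately have "(\<Sum>m\<in>{- int (Suc K)..int (Suc K)}. ?f m) =
        ?g (Suc K) + (x ^ Suc K / (- of_nat (Suc K)) ^ i + (\<Sum>m\<in>{- int K..int K}. ?f m))"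
      by (simp del: power_Suc of_nat_Suc of_int_of_nat_eq add: of_int_minus of_int_of_nat_eq)
    also have "x ^ Suc K / (- of_nat (Suc K)) ^ i = (-1) ^ i * ?g (Suc K)"
      by (subst power_minus) (auto simp: uminus_power_if)
    finally show ?case unfolding Suc
      by (simp only: sum.cl_ivl_Suc) (simp add: algebra_simps add_divide_distrib del: of_nat_Suc power_Suc)
  qed
  show ?thesis
  proof (cases "odd i")
    case True thus ?thesis unfolding eq by (simp add: window_coeff_odd)
  next
    case False
    hence i2: "i \<ge> 2" using i by presburger
    have "(?g has_sum (if x = 1 then riemann_zeta (of_nat i) else phi (of_nat i))) {1..}"
    proof -
      have "?g m = x ^ m * of_nat m powr - of_nat i" if "m \<in> {1..}" for m :: nat
        using that by (simp add: powr_minus divide_inverse)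
      hence *: "(?g has_sum z) {1..} \<longleftrightarrow> ((\<lambda>m. x ^ m * of_nat m powr - of_nat i) has_sum z) {1..}" for z
        by (rule has_sum_cong)
      show ?thesis unfolding *
        using riemann_zeta_has_sum[of "of_nat i"] phi_has_sum[of "of_nat i"] x i2 by auto
    qed
    hence "(\<lambda>K. \<Sum>m\<in>{1..K}. ?g m) \<longlonglongrightarrow> (if x = 1 then riemann_zeta (of_nat i) else phi (of_nat i))"
      by (rule has_sum_imp_tendsto) (auto simp: eventually_at_top_linorder)
    from tendsto_mult_left[OF this, of 2] show ?thesis
      unfolding eq using False i by (simp add: window_coeff_def)
  qed
qed

lemma lin_inv_power': "c \<noteq> 0 \<or> n = 0 \<Longrightarrow> lin_inv c ^ n = fps_to_fls (inverse (lin c ^ n))"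
  using lin_inv_power[of c n] by auto

lemma laurent_family_nth_0:
  assumes "of_int l \<noteq> (0::complex) \<or> p = 0" "of_int l + M \<noteq> 0 \<or> a = 0" "of_int l + N \<noteq> 0 \<or> c = 0"
  shows "fls_nth (laurent_family p a c M N l) 0 = 1 / (of_int l ^ p * (of_int l + M) ^ a * (of_int l + N) ^ c)"
  unfolding laurent_family_def using assms
  by (simp add: lin_inv_power' fls_times_fps_to_fls[symmetric] divide_inverse fps_nth_power_0)

text \<open>Off \<open>S\<close> the constant coefficient is the value of the function, so the
  window splits into the wanted sum and the constant terms at the points of \<open>S\<close>, which
  are finitely many.\<close>

lemma laurent_family_has_sum:
  fixes x :: complex and M N :: int
  assumes x: "x = 1 \<or> x = -1" and S: "finite S"
    and MN: "M \<noteq> 0" "N \<noteq> 0" "M \<noteq> N"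
    and pac: "p + a + c \<ge> 1" "p + a + c \<le> n"
    and poles: "p > 0 \<longrightarrow> 0 \<in> S" "a > 0 \<longrightarrow> - M \<in> S" "c > 0 \<longrightarrow> - N \<in> S"
    and sm: "(\<lambda>l. x powi l / (of_int l ^ p * of_int (l + M) ^ a * of_int (l + N) ^ c)) summable_on (- S)"
  shows "((\<lambda>l. x powi l / (of_int l ^ p * of_int (l + M) ^ a * of_int (l + N) ^ c)) has_sum
            (\<Sum>P\<in>S. x powi P * (\<Sum>i=0..n. window_coeff x i * fls_nth (laurent_family p a c (of_int M) (of_int N) P) (- int i)))) (- S)"
proof -
  let ?f = "\<lambda>l. x powi l / (of_int l ^ p * of_int (l + M) ^ a * of_int (l + N) ^ c)"
  let ?G = "laurent_family p a c (of_int M) (of_int N)"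
  let ?c = "\<lambda>l. x powi l * fls_nth (?G l) 0"
  define V where "V = (\<Sum>P\<in>S. x powi P * (\<Sum>i=1..n. window_coeff x i * fls_nth (?G P) (- int i)))"
  from sm obtain s where s: "(?f has_sum s) (- S)" by (auto simp: summable_on_def)
  have "symmetric_sum x (window_coeff x) S n ?G"
    by (rule symmetric_sum_laurent_family) (use assms window_coeff_tendsto in auto)
  hence 1: "(\<lambda>K. \<Sum>l\<in>{- int K..int K}. ?c l) \<longlonglongrightarrow> V" by (simp add: symmetric_sum_def V_def)
  have eqf: "?c l = ?f l" if "l \<notin> S" for l
  proof -
    have "of_int l \<noteq> (0::complex) \<or> p = 0" using that poles by auto
    moreover have "complex_of_int l + of_int M \<noteq> 0 \<or> a = 0"
      using that poles by (simp flip: of_int_add) (metis add.commute eq_neg_iff_add_eq_0 neg_equal_iff_equal add_eq_0_iff gr0I)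
    moreover have "complex_of_int l + of_int N \<noteq> 0 \<or> c = 0"
      using that poles by (simp flip: of_int_add) (metis add.commute eq_neg_iff_add_eq_0 neg_equal_iff_equal add_eq_0_iff gr0I)
    ultimately show ?thesis by (simp add: laurent_family_nth_0)
  qed
  have 2: "(\<lambda>K. \<Sum>l\<in>{- int K..int K} - S. ?f l) \<longlonglongrightarrow> s"
  proof (rule has_sum_imp_tendsto[OF s])
    show "eventually (\<lambda>K. l \<in> {- int K..int K} - S) sequentially" if "l \<in> - S" for l
      using eventually_ge_at_top[of "nat \<bar>l\<bar>"] by eventually_elim (use that in auto)
  qed auto
  \<comment> \<open>A common bound for all \<open>\<bar>P\<bar>\<close>: from \<open>K = B\<close>
    on, the window contains \<open>S\<close>.\<close>
  define B where "B = nat (\<Sum>P\<in>S. \<bar>P\<bar>)"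
  have B: "\<bar>P\<bar> \<le> int B" if "P \<in> S" for P
    using member_le_sum[of P S "\<lambda>P. \<bar>P\<bar>"] that S by (simp add: B_def)
  have 3: "(\<lambda>K. \<Sum>l\<in>{- int K..int K} \<inter> S. ?c l) \<longlonglongrightarrow> (\<Sum>l\<in>S. ?c l)"
  proof (rule tendsto_eventually)
    show "eventually (\<lambda>K. (\<Sum>l\<in>{- int K..int K} \<inter> S. ?c l) = (\<Sum>l\<in>S. ?c l)) sequentially"
      using eventually_ge_at_top[of B]
    proof eventually_elim
      fix K assume "B \<le> K"
      hence "{- int K..int K} \<inter> S = S" using B by force
      thus "(\<Sum>l\<in>{- int K..int K} \<inter> S. ?c l) = (\<Sum>l\<in>S. ?c l)" by simp
    qed
  qed
  have "(\<Sum>l\<in>{- int K..int K}. ?c l) = (\<Sum>l\<in>{- int K..int K} - S. ?f l) + (\<Sum>l\<in>{- int K..int K} \<inter> S. ?c l)" for K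
  proof -
    have "(\<Sum>l\<in>{- int K..int K} - S. ?f l) = (\<Sum>l\<in>{- int K..int K} - S. ?c l)"
      by (intro sum.cong refl eqf[symmetric]) auto
    thus ?thesis by (simp add: sum.Int_Diff[of "{- int K..int K}" _ S] add.commute)
  qed
  with 1 tendsto_add[OF 2 3] have "V = s + (\<Sum>l\<in>S. ?c l)" by (auto intro: LIMSEQ_unique)
  hence "s = V - (\<Sum>l\<in>S. ?c l)" by simp
  \<comment> \<open>The subtracted constant terms become the summand \<open>i = 0\<close>, where
    \<open>window_coeff\<close> equals -1.\<close>
  also have "\<dots> = (\<Sum>P\<in>S. x powi P * (\<Sum>i=0..n. window_coeff x i * fls_nth (?G P) (- int i)))"
    unfolding V_def sum_subtractf[symmetric] right_diff_distrib[symmetric]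
    by (intro sum.cong refl) (simp add: sum.atLeast_Suc_atMost[of 0] window_coeff_def)
  finally show ?thesis using s by simp
qed

lemma X_inv_power_mult_nth:
  "fls_nth (fls_X_inv ^ p * fps_to_fls F) (- int i) = (if i \<le> p then fps_nth F (p - i) else 0)"
  by (auto simp: fls_X_inv_power_times_conv_shift nat_diff_distrib)

text \<open>Odd coefficients vanish and a pole of order \<open>p\<close> has no coefficients beyond
  \<open>p\<close>, which leaves \<open>i = 2 * j\<close> with \<open>j\<close> up to
  \<open>p div 2\<close>.\<close>

lemma sum_window_coeff_even:
  assumes "p \<le> n"
  shows "(\<Sum>i=0..n. window_coeff x i * (if i \<le> p then g (p - i) else 0)) = (\<Sum>j=0..p div 2. window_coeff x (2 * j) * g (p - 2 * j))"
proof -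
  have "(\<Sum>j=0..p div 2. window_coeff x (2 * j) * g (p - 2 * j)) = (\<Sum>i\<in>(*) 2 ` {0..p div 2}. window_coeff x i * g (p - i))"
    by (subst sum.reindex) (auto simp: inj_on_def)
  also have "\<dots> = (\<Sum>i=0..n. window_coeff x i * (if i \<le> p then g (p - i) else 0))"
  proof (intro sum.mono_neutral_cong_left ballI)
    fix i assume i: "i \<in> {0..n} - (*) 2 ` {0..p div 2}"
    show "window_coeff x i * (if i \<le> p then g (p - i) else 0) = 0"
    proof (cases "odd i \<or> i > p")
      case False
      hence "i = 2 * (i div 2)" "i div 2 \<in> {0..p div 2}" by auto
      thus ?thesis using i by blast
    qed (auto simp: window_coeff_odd)
  qed (use assms in auto)
  finally show ?thesis ..
qed

text \<open>Cauchy product of two negative binomial series; the signs combine to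
  \<open>(-1) ^ k\<close>. This form is used at the two outer poles.\<close>

lemma lin_inverse_mult_nth:
  assumes "c \<noteq> 0" "d \<noteq> 0" "a \<ge> 1" "b \<ge> 1"
  shows "fps_nth (inverse (lin c ^ a) * inverse (lin d ^ b)) k =
    (-1) ^ k * (\<Sum>w=0..k. of_nat ((w + a - 1) choose w) * of_nat ((k + b - w - 1) choose (b - 1)) /
        (c ^ (a + w) * d ^ (b + k - w)))"
proof -
  obtain a' b' where ab: "a = Suc a'" "b = Suc b'" using assms by (metis Suc_le_D One_nat_def)
  have "fps_nth (inverse (lin c ^ a) * inverse (lin d ^ b)) k =
     (\<Sum>w=0..k. ((-1) ^ w * of_nat ((a' + w) choose w) / c ^ (a + w)) *
         ((-1) ^ (k - w) * of_nat ((b' + (k - w)) choose (k - w)) / d ^ (b + (k - w))))"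
    unfolding fps_mult_nth ab lin_inverse_power_nth[OF assms(1)] lin_inverse_power_nth[OF assms(2)] ..
  also have "\<dots> = (\<Sum>w=0..k. (-1) ^ k * (of_nat ((w + a - 1) choose w) * of_nat ((k + b - w - 1) choose (b - 1)) /
        (c ^ (a + w) * d ^ (b + k - w))))"
  proof (intro sum.cong refl)
    fix w assume w: "w \<in> {0..k}"
    hence "(-1) ^ k = (-1) ^ w * ((-1) ^ (k - w) :: complex)" by (simp flip: power_add)
    moreover have "(b' + (k - w)) choose (k - w) = (k + b - w - 1) choose (b - 1)"
      using w ab binomial_symmetric[of "k - w" "b' + (k - w)"] by (simp add: algebra_simps)
    moreover have "(a' + w) choose w = (w + a - 1) choose w" using ab by (simp add: add.commute)
    moreover have "b + (k - w) = b + k - w" using w by simp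
    ultimately show "((-1) ^ w * of_nat ((a' + w) choose w) / c ^ (a + w)) *
         ((-1) ^ (k - w) * of_nat ((b' + (k - w)) choose (k - w)) / d ^ (b + (k - w))) =
         (-1) ^ k * (of_nat ((w + a - 1) choose w) * of_nat ((k + b - w - 1) choose (b - 1)) /
        (c ^ (a + w) * d ^ (b + k - w)))"
      by simp
  qed
  finally show ?thesis by (simp add: sum_distrib_left)
qed

section \<open>Summation over the first variable\<close>

text \<open>The summation index of \<open>pfrac\<close> is reversed to \<open>w = p - 1 - j\<close>,
  so that the linear form occurs with exponent \<open>w + 1\<close>.\<close>

lemma pfrac_lin_nth:
  fixes c n :: complex
  assumes "c \<noteq> 0" "p \<ge> 1"
  shows "fps_nth (pfrac (inverse (lin c)) (fps_const n) (p - 1) q) k =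
     (-1) ^ (p - 1 + k) * (\<Sum>w=0..p-1. (-1) ^ w * of_nat ((w + k) choose w) * of_nat ((q + p - 1 - w) choose q) *
        n ^ (q + p - w) / c ^ (w + 1 + k))"
proof -
  obtain p' where p: "p = Suc p'" using assms by (metis Suc_le_D One_nat_def)
  have fc: "(-1) ^ j * of_nat b * fps_const n ^ e = fps_const ((-1) ^ j * of_nat b * n ^ e)" for j b e
    by (cases "even j") (simp_all add: fps_of_nat[symmetric] fps_const_power)
  have "fps_nth (pfrac (inverse (lin c)) (fps_const n) (p - 1) q) k =
     (\<Sum>j\<le>p'. fps_nth (fps_const ((-1) ^ j * of_nat ((q + j) choose q) * n ^ (q + 1 + j)) * inverse (lin c ^ Suc (p' - j))) k)"
    unfolding pfrac_def fps_sum_nth p fc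
    by (intro sum.cong refl arg_cong2[of _ _ _ _ fps_nth] arg_cong2[of _ _ _ _ "(*)"])
       (auto simp: fps_inverse_power Suc_diff_le simp del: power_Suc)
  also have "\<dots> = (\<Sum>j\<le>p'. ((-1) ^ j * of_nat ((q + j) choose q) * n ^ (q + 1 + j)) *
       ((-1) ^ k * of_nat ((p' - j + k) choose k) / c ^ (Suc (p' - j) + k)))"
    by (simp add: lin_inverse_power_nth[OF assms(1)] del: power_Suc)
  also have "\<dots> = (\<Sum>w=0..p-1. ((-1) ^ (p' - w) * of_nat ((q + (p' - w)) choose q) * n ^ (q + 1 + (p' - w))) *
       ((-1) ^ k * of_nat ((w + k) choose k) / c ^ (Suc w + k)))"
    by (rule sum.reindex_bij_witness[of _ "\<lambda>w. p' - w" "\<lambda>w. p' - w"]) (auto simp: p)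
  also have "\<dots> = (\<Sum>w=0..p-1. (-1) ^ (p - 1 + k) * ((-1) ^ w * of_nat ((w + k) choose w) * of_nat ((q + p - 1 - w) choose q) *
        n ^ (q + p - w) / c ^ (w + 1 + k)))"
  proof (intro sum.cong refl)
    fix w assume w: "w \<in> {0..p-1}"
    hence "(-1) ^ p' = (-1) ^ w * ((-1) ^ (p' - w) :: complex)" by (simp add: p flip: power_add)
    hence sg: "(-1) ^ (p - 1 + k) * (-1) ^ w = ((-1) ^ (p' - w) * (-1) ^ k :: complex)"
      by (simp add: p power_add)
    have "(w + k) choose k = (w + k) choose w" using binomial_symmetric[of k "w + k"] by simp
    moreover have "q + (p' - w) = q + p - 1 - w" "q + 1 + (p' - w) = q + p - w" using w p by auto
    ultimately show "((-1) ^ (p' - w) * of_nat ((q + (p' - w)) choose q) * n ^ (q + 1 + (p' - w))) *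
       ((-1) ^ k * of_nat ((w + k) choose k) / c ^ (Suc w + k)) =
       (-1) ^ (p - 1 + k) * ((-1) ^ w * of_nat ((w + k) choose w) * of_nat ((q + p - 1 - w) choose q) *
        n ^ (q + p - w) / c ^ (w + 1 + k))"
      using sg by (simp add: mult_ac del: power_Suc)
  qed
  finally show ?thesis by (simp add: sum_distrib_left)
qed

text \<open>The version for the middle pole. The two forms differ by \<open>M + n\<close>, so
  partial fractions give terms in which powers of \<open>M + n\<close> meet powers of only one of
  \<open>M\<close> and \<open>n\<close>.\<close>

lemma lin_inverse_mult_nth':
  fixes M n :: complex
  assumes "M \<noteq> 0" "n \<noteq> 0" "M + n \<noteq> 0" "p \<ge> 1" "c \<ge> 1"
  shows "fps_nth (inverse (lin (- M) ^ p) * inverse (lin n ^ c)) k =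
     (-1) ^ p * (\<Sum>w=0..p-1. of_nat ((w + k) choose w) * of_nat ((p + c - 2 - w) choose (c - 1)) /
         (M ^ (w + 1 + k) * (M + n) ^ (p + c - 1 - w)))
   + (-1) ^ (p + k) * (\<Sum>w=0..c-1. of_nat ((w + k) choose w) * of_nat ((p + c - 2 - w) choose (p - 1)) /
         (n ^ (w + 1 + k) * (M + n) ^ (p + c - 1 - w)))"
proof -
  let ?u = "inverse (lin (- M))" and ?v = "inverse (lin n)" and ?N = "1 / (M + n)"
  obtain p' c' where pc: "p = Suc p'" "c = Suc c'" using assms by (metis Suc_le_D One_nat_def)
  have lu: "?u * lin (- M) = 1" using assms by (intro inverse_mult_eq_1) auto
  have lv: "?v * lin n = 1" using assms by (intro inverse_mult_eq_1) auto
  have "u - v = (u * v) * (B - A)" if "u * A = 1" "v * B = 1" for u v A B :: "complex fps"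
  proof -
    have "(u * v) * (B - A) = u * (v * B) - v * (u * A)" by (simp add: algebra_simps)
    thus ?thesis using that by simp
  qed
  from this[OF lu lv] have "?u - ?v = (?u * ?v) * (lin n - lin (- M))" .
  also have "lin n - lin (- M) = fps_const (M + n)" by (simp add: algebra_simps flip: fps_const_add)
  finally have uv: "?u * ?v = fps_const ?N * (?u - ?v)"
    using assms by (simp add: mult.left_commute[of "fps_const _"])
  have "inverse (lin (- M) ^ p) * inverse (lin n ^ c) = ?u ^ Suc p' * ?v ^ Suc c'"
    by (simp only: pc fps_inverse_power)
  also have "\<dots> = pfrac ?u (fps_const ?N) (p - 1) c' + pfrac ?v (fps_const (- ?N)) (c - 1) p'"
    using partial_fraction[OF uv, of p' c'] pc by simp
  finally have "fps_nth (inverse (lin (- M) ^ p) * inverse (lin n ^ c)) k =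
     fps_nth (pfrac ?u (fps_const ?N) (p - 1) c') k + fps_nth (pfrac ?v (fps_const (- ?N)) (c - 1) p') k"
    by simp
  also have "fps_nth (pfrac ?u (fps_const ?N) (p - 1) c') k =
     (-1) ^ p * (\<Sum>w=0..p-1. of_nat ((w + k) choose w) * of_nat ((p + c - 2 - w) choose (c - 1)) /
         (M ^ (w + 1 + k) * (M + n) ^ (p + c - 1 - w)))"
  proof -
    have "(-1) ^ (p - 1 + k) * ((-1) ^ w * of_nat ((w + k) choose w) * of_nat ((c' + p - 1 - w) choose c') *
        ?N ^ (c' + p - w) / (- M) ^ (w + 1 + k)) =
       (-1) ^ p * (of_nat ((w + k) choose w) * of_nat ((p + c - 2 - w) choose (c - 1)) /
         (M ^ (w + 1 + k) * (M + n) ^ (p + c - 1 - w)))" for w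
    proof -
      have "(- M) ^ (w + 1 + k) = (-1) ^ (w + 1 + k) * M ^ (w + 1 + k)" by (rule power_minus)
      thus ?thesis using assms by (simp add: pc power_add power_divide add.commute)
    qed
    thus ?thesis
      by (subst pfrac_lin_nth) (use assms in \<open>auto simp: sum_distrib_left intro!: sum.cong\<close>)
  qed
  also have "fps_nth (pfrac ?v (fps_const (- ?N)) (c - 1) p') k =
     (-1) ^ (p + k) * (\<Sum>w=0..c-1. of_nat ((w + k) choose w) * of_nat ((p + c - 2 - w) choose (p - 1)) /
         (n ^ (w + 1 + k) * (M + n) ^ (p + c - 1 - w)))"
  proof -
    have "(-1) ^ (c - 1 + k) * ((-1) ^ w * of_nat ((w + k) choose w) * of_nat ((p' + c - 1 - w) choose p') *
        (- ?N) ^ (p' + c - w) / n ^ (w + 1 + k)) =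
       (-1) ^ (p + k) * (of_nat ((w + k) choose w) * of_nat ((p + c - 2 - w) choose (p - 1)) /
         (n ^ (w + 1 + k) * (M + n) ^ (p + c - 1 - w)))" if "w \<in> {0..c-1}" for w
    proof -
      \<comment> \<open>The exponents add up to \<open>2 * (c - 1) + p + k\<close>.\<close>
      have "(-1) ^ (c - 1 + k) * (-1) ^ w * (-1) ^ (p' + c - w) = ((-1) ^ (p + k) :: complex)"
      proof -
        have "(-1) ^ (c - 1 + k) * (-1) ^ w * (-1) ^ (p' + c - w) = ((-1) ^ (c' + c' + (p + k)) :: complex)"
          unfolding power_add[symmetric] using that pc by (intro arg_cong[of _ _ "\<lambda>n. (-1) ^ n"]) auto
        also have "\<dots> = (-1) ^ (p + k)" by (simp add: power_add)
        finally show ?thesis .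
      qed
      moreover have "A * (B * x * y * (C * z) / t) = (A * B * C) * (x * y * z / t)" for A B C x y z t :: complex
        by simp
      ultimately have "(-1) ^ (c - 1 + k) * ((-1) ^ w * of_nat ((w + k) choose w) * of_nat ((p' + c - 1 - w) choose p') *
        (- ?N) ^ (p' + c - w) / n ^ (w + 1 + k)) =
        (-1) ^ (p + k) * (of_nat ((w + k) choose w) * of_nat ((p' + c - 1 - w) choose p') * ?N ^ (p' + c - w) / n ^ (w + 1 + k))"
        unfolding power_minus[of ?N] by metis
      moreover have "p' + c - 1 - w = p + c - 2 - w" "p' + c - w = p + c - 1 - w" "p' = p - 1" using pc by auto
      ultimately show ?thesis by (simp only: power_divide) simp
    qed
    thus ?thesis
      by (subst pfrac_lin_nth) (use assms in \<open>auto simp: sum_distrib_left intro!: sum.cong\<close>)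
  qed
  finally show ?thesis .
qed

text \<open>The contributions of the poles \<open>0\<close>, \<open>- N\<close> and (split by partial fractions) \<open>- M\<close>.\<close>

definition outer_pole_sum :: "nat \<Rightarrow> nat \<Rightarrow> nat \<Rightarrow> complex \<Rightarrow> complex \<Rightarrow> complex" where
  "outer_pole_sum p a c m N = (\<Sum>j = 0..p div 2. phi (of_nat (2 * j)) *
         (\<Sum>w = 0..p - 2 * j. of_nat ((w + a - 1) choose w) * of_nat ((p + c - 2 * j - w - 1) choose (c - 1)) /
            (m ^ (a + w) * N ^ (p + c - 2 * j - w))))"

definition middle_pole_sum :: "nat \<Rightarrow> nat \<Rightarrow> nat \<Rightarrow> complex \<Rightarrow> complex \<Rightarrow> complex" where
  "middle_pole_sum p a c m N = (\<Sum>j = 0..a div 2. phi (of_nat (2 * j)) *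
         (\<Sum>w = 0..p - 1. of_nat ((w + a - 2 * j) choose w) * of_nat ((p + c - 2 - w) choose (c - 1)) /
            (m ^ (a - 2 * j + w + 1) * N ^ (p + c - 1 - w))))"

lemma minus_one_power_diff_even: "2 * j \<le> n \<Longrightarrow> (-1) ^ (n - 2 * j) = ((-1) ^ n :: 'a::ring_1)"
  by (auto simp: uminus_power_if)

text \<open>At the pole 0 the other two forms have constant terms \<open>m\<close> and
  \<open>m + n\<close>, at \<open>- (m + n)\<close> they have \<open>- (m + n)\<close> and
  \<open>- n\<close>, at \<open>- m\<close> they have \<open>- m\<close> and \<open>n\<close>. The
  last outer pole thus repeats the first with \<open>p\<close> and \<open>c\<close> exchanged and
  \<open>n\<close> for \<open>m\<close>, up to sign.\<close>

lemma alternating_l_sum: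
  fixes m n :: int
  assumes "p \<ge> 1" "a \<ge> 1" "c \<ge> 1" "m \<noteq> 0" "n \<noteq> 0" "m + n \<noteq> 0"
    and sm: "(\<lambda>l. (-1) powi l / (of_int l ^ p * of_int (l + m) ^ a * of_int (l + (m + n)) ^ c :: complex))
               summable_on (- {0, - m, - (m + n)})"
  shows "((\<lambda>l. (-1) powi l / (of_int l ^ p * of_int (l + m) ^ a * of_int (l + (m + n)) ^ c)) has_sum
     (2 * (-1) ^ p * outer_pole_sum p a c (of_int m) (of_int (m + n))
      + (-1) powi (m + n) * (2 * (-1) ^ (p + a) * outer_pole_sum c a p (of_int n) (of_int (m + n)))
      + (-1) powi m * (2 * (-1) ^ p * middle_pole_sum p a c (of_int m) (of_int (m + n))
                     + 2 * (-1) ^ (p + a) * middle_pole_sum c a p (of_int n) (of_int (m + n)))))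
     (- {0, - m, - (m + n)})"
proof -
  define N where "N = m + n"
  define M' n' N' :: complex where "M' = of_int m" and "n' = of_int n" and "N' = of_int N"
  have nz: "M' \<noteq> 0" "n' \<noteq> 0" "N' \<noteq> 0" "M' + n' = N'"
    unfolding M'_def n'_def N'_def N_def of_int_add[symmetric] of_int_eq_0_iff using assms by auto
  let ?n = "p + a + c"
  let ?G = "laurent_family p a c M' N'"
  have hs: "((\<lambda>l. (-1) powi l / (of_int l ^ p * of_int (l + m) ^ a * of_int (l + N) ^ c)) has_sum
       (\<Sum>P\<in>{0, - m, - N}. (-1) powi P * (\<Sum>i=0..?n. window_coeff (-1) i * fls_nth (?G P) (- int i)))) (- {0, - m, - N})"
    unfolding M'_def N'_def using assms by (intro laurent_family_has_sum) (auto simp: N_def)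
  have dist: "0 \<noteq> - m" "0 \<noteq> - N" "- m \<noteq> - N" using assms by (auto simp: N_def)
  have minus: "(-1) powi (- k) = ((-1) powi k :: complex)" for k
    by (simp add: power_int_minus power_int_minus_left)
  have 0: "(\<Sum>i=0..?n. window_coeff (-1) i * fls_nth (?G 0) (- int i)) = 2 * (-1) ^ p * outer_pole_sum p a c M' N'"
  proof -
    have G: "?G 0 = fls_X_inv ^ p * fps_to_fls (inverse (lin M' ^ a) * inverse (lin N' ^ c))"
      using nz by (simp add: laurent_family_def lin_inv_0 lin_inv_power fls_times_fps_to_fls mult.assoc)
    have "(\<Sum>i=0..?n. window_coeff (-1) i * fls_nth (?G 0) (- int i)) =
          (\<Sum>j=0..p div 2. window_coeff (-1) (2 * j) * fps_nth (inverse (lin M' ^ a) * inverse (lin N' ^ c)) (p - 2 * j))"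
      unfolding G X_inv_power_mult_nth by (rule sum_window_coeff_even) simp
    also have "\<dots> = 2 * (-1) ^ p * outer_pole_sum p a c M' N'"
      unfolding outer_pole_sum_def sum_distrib_left[of "2 * (-1) ^ p :: complex"]
    proof (intro sum.cong refl)
      fix j assume j: "j \<in> {0..p div 2}"
      hence "2 * j \<le> p" by auto
      moreover from this have "p - 2 * j + c - w - 1 = p + c - 2 * j - w - 1" "c + (p - 2 * j) - w = p + c - 2 * j - w" for w by auto
      ultimately show "window_coeff (-1) (2 * j) * fps_nth (inverse (lin M' ^ a) * inverse (lin N' ^ c)) (p - 2 * j) =
         2 * (-1) ^ p * (phi (of_nat (2 * j)) *
         (\<Sum>w = 0..p - 2 * j. of_nat ((w + a - 1) choose w) * of_nat ((p + c - 2 * j - w - 1) choose (c - 1)) /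
            (M' ^ (a + w) * N' ^ (p + c - 2 * j - w))))"
        using assms nz by (simp add: lin_inverse_mult_nth window_coeff_minus1 minus_one_power_diff_even)
    qed
    finally show ?thesis .
  qed
  have 1: "(\<Sum>i=0..?n. window_coeff (-1) i * fls_nth (?G (- N)) (- int i)) = 2 * (-1) ^ (p + a) * outer_pole_sum c a p n' N'"
  proof -
    have e: "of_int (- N) = - N'" "- N' + M' = - n'" using nz by (simp_all add: N'_def[symmetric] algebra_simps)
    have G: "?G (- N) = fls_X_inv ^ c * fps_to_fls (inverse (lin (- n') ^ a) * inverse (lin (- N') ^ p))"
      using nz by (simp only: laurent_family_def e) (simp add: lin_inv_0 lin_inv_power fls_times_fps_to_fls mult_ac)
    have "(\<Sum>i=0..?n. window_coeff (-1) i * fls_nth (?G (- N)) (- int i)) =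
          (\<Sum>j=0..c div 2. window_coeff (-1) (2 * j) * fps_nth (inverse (lin (- n') ^ a) * inverse (lin (- N') ^ p)) (c - 2 * j))"
      unfolding G X_inv_power_mult_nth by (rule sum_window_coeff_even) simp
    also have "\<dots> = 2 * (-1) ^ (p + a) * outer_pole_sum c a p n' N'"
      unfolding outer_pole_sum_def sum_distrib_left[of "2 * (-1) ^ (p + a) :: complex"]
    proof (intro sum.cong refl)
      fix j assume j: "j \<in> {0..c div 2}"
      hence j': "2 * j \<le> c" by auto
      hence ex: "c - 2 * j + p - w - 1 = c + p - 2 * j - w - 1" "p + (c - 2 * j) - w = c + p - 2 * j - w" for w by auto
      have "(-1) ^ (c - 2 * j) * (of_nat ((w + a - 1) choose w) * of_nat ((c + p - 2 * j - w - 1) choose (p - 1)) /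
            ((- n') ^ (a + w) * (- N') ^ (c + p - 2 * j - w))) =
            (-1) ^ (p + a) * (of_nat ((w + a - 1) choose w) * of_nat ((c + p - 2 * j - w - 1) choose (p - 1)) /
            (n' ^ (a + w) * N' ^ (c + p - 2 * j - w)))" if "w \<in> {0..c - 2 * j}" for w
      proof -
        \<comment> \<open>The series contributes \<open>c - 2 * j\<close> signs and the negated
          bases \<open>a + w\<close> and \<open>c + p - 2 * j - w\<close>; \<open>w\<close> and all
          even parts cancel.\<close>
        have "even (c - 2 * j + (a + w) + (c + p - 2 * j - w)) \<longleftrightarrow> even (p + a)" using that j' by auto
        hence "(-1) ^ (c - 2 * j + (a + w) + (c + p - 2 * j - w)) = ((-1) ^ (p + a) :: complex)"
          by (auto simp: uminus_power_if)
        hence sg: "(-1) ^ (c - 2 * j) * (-1) ^ (a + w) * (-1) ^ (c + p - 2 * j - w) = ((-1) ^ (p + a) :: complex)"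
          by (simp only: power_add)
        have "S * (x / ((-1) ^ i * y * ((-1) ^ k * z))) = (S * (-1) ^ i * (-1) ^ k) * (x / (y * z))" for S x y z :: complex and i k
          by (auto simp: uminus_power_if)
        thus ?thesis
          unfolding power_minus[of n'] power_minus[of N'] sg[symmetric] .
      qed
      hence "(-1) ^ (c - 2 * j) * (\<Sum>w = 0..c - 2 * j. of_nat ((w + a - 1) choose w) * of_nat ((c + p - 2 * j - w - 1) choose (p - 1)) /
            ((- n') ^ (a + w) * (- N') ^ (c + p - 2 * j - w))) =
            (-1) ^ (p + a) * (\<Sum>w = 0..c - 2 * j. of_nat ((w + a - 1) choose w) * of_nat ((c + p - 2 * j - w - 1) choose (p - 1)) /
            (n' ^ (a + w) * N' ^ (c + p - 2 * j - w)))"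
        unfolding sum_distrib_left by (rule sum.cong[OF refl])
      hence "fps_nth (inverse (lin (- n') ^ a) * inverse (lin (- N') ^ p)) (c - 2 * j) = (-1) ^ (p + a) *
           (\<Sum>w = 0..c - 2 * j. of_nat ((w + a - 1) choose w) * of_nat ((c + p - 2 * j - w - 1) choose (p - 1)) /
            (n' ^ (a + w) * N' ^ (c + p - 2 * j - w)))"
        using assms nz by (subst lin_inverse_mult_nth) (simp_all only: ex, auto)
      thus "window_coeff (-1) (2 * j) * fps_nth (inverse (lin (- n') ^ a) * inverse (lin (- N') ^ p)) (c - 2 * j) =
         2 * (-1) ^ (p + a) * (phi (of_nat (2 * j)) *
         (\<Sum>w = 0..c - 2 * j. of_nat ((w + a - 1) choose w) * of_nat ((c + p - 2 * j - w - 1) choose (p - 1)) /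
            (n' ^ (a + w) * N' ^ (c + p - 2 * j - w))))"
        by (simp only: window_coeff_minus1) (simp only: mult_ac)
    qed
    finally show ?thesis .
  qed
  have 2: "(\<Sum>i=0..?n. window_coeff (-1) i * fls_nth (?G (- m)) (- int i)) = 2 * (-1) ^ p * middle_pole_sum p a c M' N' + 2 * (-1) ^ (p + a) * middle_pole_sum c a p n' N'"
  proof -
    have e: "of_int (- m) = - M'" "- M' + N' = n'" using nz by (simp_all add: M'_def[symmetric] algebra_simps)
    have G: "?G (- m) = fls_X_inv ^ a * fps_to_fls (inverse (lin (- M') ^ p) * inverse (lin n' ^ c))"
      using nz by (simp only: laurent_family_def e) (simp add: lin_inv_0 lin_inv_power fls_times_fps_to_fls mult_ac)
    have "(\<Sum>i=0..?n. window_coeff (-1) i * fls_nth (?G (- m)) (- int i)) =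
          (\<Sum>j=0..a div 2. window_coeff (-1) (2 * j) * fps_nth (inverse (lin (- M') ^ p) * inverse (lin n' ^ c)) (a - 2 * j))"
      unfolding G X_inv_power_mult_nth by (rule sum_window_coeff_even) simp
    also have "\<dots> = 2 * (-1) ^ p * middle_pole_sum p a c M' N' + 2 * (-1) ^ (p + a) * middle_pole_sum c a p n' N'"
      unfolding middle_pole_sum_def sum_distrib_left[of "2 * (-1) ^ p :: complex"] sum_distrib_left[of "2 * (-1) ^ (p + a) :: complex"] sum.distrib[symmetric]
    proof (intro sum.cong refl)
      fix j assume j: "j \<in> {0..a div 2}"
      hence j': "2 * j \<le> a" by auto
      hence ex: "w + (a - 2 * j) = w + a - 2 * j" "w + 1 + a - 2 * j = a - 2 * j + w + 1" for w by auto
      have sg: "(-1) ^ (p + a - 2 * j) = ((-1) ^ (p + a) :: complex)"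
        using j' by (simp add: minus_one_power_diff_even)
      have pc: "p + c = c + p" by simp
      have "fps_nth (inverse (lin (- M') ^ p) * inverse (lin n' ^ c)) (a - 2 * j) =
         (-1) ^ p * (\<Sum>w=0..p-1. of_nat ((w + a - 2 * j) choose w) * of_nat ((p + c - 2 - w) choose (c - 1)) /
         (M' ^ (a - 2 * j + w + 1) * N' ^ (p + c - 1 - w)))
       + (-1) ^ (p + a) * (\<Sum>w=0..c-1. of_nat ((w + a - 2 * j) choose w) * of_nat ((c + p - 2 - w) choose (p - 1)) /
         (n' ^ (a - 2 * j + w + 1) * N' ^ (c + p - 1 - w)))"
        using lin_inverse_mult_nth'[of M' n' p c "a - 2 * j", unfolded nz(4), OF nz(1-3) assms(1,3)]
        unfolding ex sg pc .
      thus "window_coeff (-1) (2 * j) * fps_nth (inverse (lin (- M') ^ p) * inverse (lin n' ^ c)) (a - 2 * j) =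
         2 * (-1) ^ p * (phi (of_nat (2 * j)) * (\<Sum>w=0..p-1. of_nat ((w + a - 2 * j) choose w) * of_nat ((p + c - 2 - w) choose (c - 1)) /
         (M' ^ (a - 2 * j + w + 1) * N' ^ (p + c - 1 - w)))) +
         2 * (-1) ^ (p + a) * (phi (of_nat (2 * j)) * (\<Sum>w=0..c-1. of_nat ((w + a - 2 * j) choose w) * of_nat ((c + p - 2 - w) choose (p - 1)) /
         (n' ^ (a - 2 * j + w + 1) * N' ^ (c + p - 1 - w))))"
        by (simp only: window_coeff_minus1 distrib_left) (simp only: mult_ac)
    qed
    finally show ?thesis .
  qed
  have "(\<Sum>P\<in>{0, - m, - N}. (-1) powi P * (\<Sum>i=0..?n. window_coeff (-1) i * fls_nth (?G P) (- int i))) =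
     2 * (-1) ^ p * outer_pole_sum p a c M' N'
      + (-1) powi N * (2 * (-1) ^ (p + a) * outer_pole_sum c a p n' N')
      + (-1) powi m * (2 * (-1) ^ p * middle_pole_sum p a c M' N' + 2 * (-1) ^ (p + a) * middle_pole_sum c a p n' N')"
    using dist by (simp add: 0 1 2 minus del: of_int_minus)
  with hs show ?thesis unfolding N_def M'_def n'_def N'_def by simp
qed

section \<open>The twelve chambers\<close>

definition index_triples :: "(nat \<times> nat \<times> nat) set" where
  "index_triples = {1..} \<times> {1..} \<times> {1..}"

text \<open>The index is nested as \<open>((m, n), l)\<close> so that \<open>l\<close> is the inner
  variable of a dependent sum.\<close>

definition lattice_term :: "nat \<Rightarrow> nat \<Rightarrow> nat \<Rightarrow> nat \<Rightarrow> nat \<Rightarrow> complex \<Rightarrow> (int \<times> nat) \<times> int \<Rightarrow> complex" where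
  "lattice_term p q a b c s = (\<lambda>((m, n), l). (-1) powi (l + int n) /
     (of_int l ^ p * of_int m ^ q * of_nat n powr s * of_int (l + m) ^ a *
      of_int (m + int n) ^ b * of_int (l + m + int n) ^ c))"

lemma powr_of_nat_eq_power: "X \<ge> 1 \<Longrightarrow> of_nat X powr of_nat e = (of_nat X ^ e :: complex)"
  by simp

text \<open>A sign is its own inverse, so all signs move to the numerator. In every chamber
  \<open>l + n\<close> has the parity of \<open>L + N\<close>, hence the same alternating series
  arises twelve times.\<close>

lemma lattice_term_sign:
  fixes Xp Xq Xa Xb Xc :: int
  assumes X: "Xp \<in> {1, -1}" "Xq \<in> {1, -1}" "Xa \<in> {1, -1}" "Xb \<in> {1, -1}" "Xc \<in> {1, -1}"
    and eq: "l = Xp * int Ap" "m = Xq * int Aq" "l + m = Xa * int Aa"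
      "m + int n = Xb * int Ab" "l + m + int n = Xc * int Ac"
    and par: "even (l + int n) = even j"
  shows "lattice_term p q a b c s ((m, n), l) =
    of_int Xp ^ p * of_int Xq ^ q * of_int Xa ^ a * of_int Xb ^ b * of_int Xc ^ c *
     ((-1) ^ j / (of_nat Ap ^ p * of_nat Aq ^ q * of_nat n powr s * of_nat Aa ^ a * of_nat Ab ^ b * of_nat Ac ^ c))"
proof -
  have h: "of_int k ^ e = (of_int X ^ e * of_nat A ^ e :: complex)" if "k = X * int A" for k X A e
    using that by (simp add: power_mult_distrib)
  have inv: "inverse (of_int X ^ e) = (of_int X ^ e :: complex)" if "X \<in> {1, -1}" for X :: int and e
    using that by (auto simp flip: power_inverse)
  have "(-1) powi (l + int n) = ((-1) ^ j :: complex)"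
    using par by (auto simp: power_int_minus_left uminus_power_if)
  thus ?thesis
    unfolding lattice_term_def prod.case h[OF eq(1)] h[OF eq(2)] h[OF eq(3)] h[OF eq(4)] h[OF eq(5)]
    by (simp add: divide_inverse inverse_mult_distrib inv[OF X(1)] inv[OF X(2)] inv[OF X(3)] inv[OF X(4)] inv[OF X(5)] mult_ac)
qed

text \<open>Transport along a bijection: \<open>j\<close> parametrizes the chamber by positive
  triples and \<open>i\<close> reads the triple off.\<close>

lemma chamber_has_sum:
  assumes "(f has_sum F) index_triples"
    and "\<And>L M N. L \<ge> 1 \<Longrightarrow> M \<ge> 1 \<Longrightarrow> N \<ge> 1 \<Longrightarrow> h (j (L, M, N)) = sg * f (L, M, N)"
    and "\<And>x. x \<in> index_triples \<Longrightarrow> i (j x) = x" "\<And>x. x \<in> index_triples \<Longrightarrow> j x \<in> D"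
    and "\<And>d. d \<in> D \<Longrightarrow> j (i d) = d" "\<And>d. d \<in> D \<Longrightarrow> i d \<in> index_triples"
  shows "(h has_sum (sg * F :: complex)) D"
proof -
  have "((\<lambda>x. sg * f x) has_sum (sg * F)) index_triples" by (rule has_sum_cmult_right[OF assms(1)])
  also have "?this \<longleftrightarrow> ?thesis"
    by (rule has_sum_reindex_bij_witness[of _ i j]) (use assms in \<open>auto simp: index_triples_def\<close>)
  finally show ?thesis .
qed

section \<open>Absolute convergence of the SU(4) series\<close>

lemma summable_on_times:
  fixes f :: "'a \<Rightarrow> real" and g :: "'b \<Rightarrow> real"
  assumes "f summable_on A" "g summable_on B" "\<And>x. x \<in> A \<Longrightarrow> f x \<ge> 0" "\<And>x. x \<in> B \<Longrightarrow> g x \<ge> 0"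
  shows "(\<lambda>(x, y). f x * g y) summable_on (A \<times> B)"
proof (rule summable_on_SigmaI)
  show "((\<lambda>y. case (x, y) of (x, y) \<Rightarrow> f x * g y) has_sum (f x * infsum g B)) B" if "x \<in> A" for x
    using assms(2) by (auto intro: has_sum_cmult_right has_sum_infsum)
  show "(\<lambda>x. f x * infsum g B) summable_on A" by (rule summable_on_cmult_left[OF assms(1)])
qed (use assms in auto)

lemma inverse_squares_summable_on: "(\<lambda>n::nat. 1 / real n ^ 2) summable_on A"
proof -
  have "(\<lambda>n::nat. 1 / real n ^ 2) summable_on UNIV"
    by (intro norm_summable_imp_summable_on) (use inverse_power_summable[of 2, where ?'a = real] in \<open>simp add: divide_inverse\<close>)
  thus ?thesis by (rule summable_on_subset_banach) auto
qed

text \<open>Since (L+M)(M+N)(L+M+N) is at least LMN, six factors of exponent 1 already dominate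
  (LMN)^2. So convergence holds even with all real parts equal to 1, as parameters equal to 1
  require.\<close>

lemma su4_term_norm_le:
  assumes "Re s1 \<ge> 1" "Re s2 \<ge> 1" "Re s3 \<ge> 1" "Re s4 \<ge> 1" "Re s5 \<ge> 1" "Re s6 \<ge> 1" "L \<ge> 1" "M \<ge> 1" "N \<ge> 1"
  shows "norm (su4_term (s1, s2, s3, s4, s5, s6) (L, M, N)) \<le> 1 / real L ^ 2 * (1 / real M ^ 2 * (1 / real N ^ 2))"
proof -
  have powr_of_nat_eq_power: "real X \<le> norm (of_nat X powr t :: complex)" if "X \<ge> 1" "Re t \<ge> 1" for X t
  proof -
    have "real X powr 1 \<le> real X powr Re t" using that by (intro powr_mono) auto
    thus ?thesis using that norm_powr_real_powr[of "of_nat X" t] by simp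
  qed
  \<comment> \<open>Squared, the left side is the product of LM, MN and LN, each bounded by the
    square of one of the sums.\<close>
  have "(real L * real M * real N) ^ 2 \<le> ((real L + real M) * (real M + real N) * (real L + real M + real N)) ^ 2"
  proof -
    have "real L * real M * (real M * real N) * (real L * real N) \<le>
       (real L + real M) ^ 2 * (real M + real N) ^ 2 * (real L + real M + real N) ^ 2"
      by (intro mult_mono) (auto simp: power2_eq_square algebra_simps)
    thus ?thesis by (simp add: power2_eq_square algebra_simps)
  qed
  hence le: "real L * real M * real N \<le> (real L + real M) * (real M + real N) * (real L + real M + real N)"
    by (rule power2_le_imp_le) auto
  have "real L ^ 2 * (real M ^ 2 * real N ^ 2) \<le>
      (real L * real M * real N) * ((real L + real M) * (real M + real N) * (real L + real M + real N))"
    using mult_left_mono[of _ _ "real L * real M * real N", OF le] by (simp add: power2_eq_square mult_ac)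
  also have "\<dots> = real L * real M * real N * real (L + M) * real (M + N) * real (L + M + N)"
    by (simp add: mult.assoc)
  also have "\<dots> \<le> norm (of_nat L powr s1 :: complex) * norm (of_nat M powr s2 :: complex) * norm (of_nat N powr s3 :: complex) *
     norm (of_nat (L + M) powr s4 :: complex) * norm (of_nat (M + N) powr s5 :: complex) * norm (of_nat (L + M + N) powr s6 :: complex)"
    using assms by (intro mult_mono powr_of_nat_eq_power mult_nonneg_nonneg) auto
  finally have "real L ^ 2 * (real M ^ 2 * real N ^ 2) \<le> \<dots>" .
  moreover have "real L ^ 2 * (real M ^ 2 * real N ^ 2) > 0" using assms by auto
  ultimately show ?thesis
    unfolding su4_term_def by (simp add: norm_divide norm_mult norm_power divide_simps del: of_nat_add)
qed

lemma su4_term_abs_summable: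
  assumes "Re s1 \<ge> 1" "Re s2 \<ge> 1" "Re s3 \<ge> 1" "Re s4 \<ge> 1" "Re s5 \<ge> 1" "Re s6 \<ge> 1"
  shows "(\<lambda>k. norm (su4_term (s1, s2, s3, s4, s5, s6) k)) summable_on index_triples"
proof (rule Infinite_Sum.abs_summable_on_comparison_test')
  have "(\<lambda>(M, N). 1 / real M ^ 2 * (1 / real N ^ 2)) summable_on ({1..} \<times> {1..})"
    by (intro summable_on_times inverse_squares_summable_on) auto
  hence "(\<lambda>(L, y). 1 / real L ^ 2 * (case y of (M, N) \<Rightarrow> 1 / real M ^ 2 * (1 / real N ^ 2))) summable_on ({1..} \<times> {1..} \<times> {1..})"
    by (intro summable_on_times inverse_squares_summable_on) auto
  thus "(\<lambda>(L, M, N). 1 / real L ^ 2 * (1 / real M ^ 2 * (1 / real N ^ 2))) summable_on index_triples"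
    unfolding index_triples_def by (simp add: case_prod_unfold)
qed (use su4_term_norm_le[OF assms] in \<open>auto simp: index_triples_def\<close>)

text \<open>
  In each chamber \<open>L\<close>, \<open>M\<close>, \<open>N\<close> are the absolute values of the three forms whose exponents stand in the
  first three slots of \<open>su4_term\<close>; the other three forms are then \<open>L + M\<close>, \<open>M + N\<close>, \<open>L + M + N\<close> up to sign.
\<close>

lemma chamber1:
  assumes "(su4_term (of_nat p, of_nat q, s, of_nat a, of_nat b, of_nat c) has_sum F) index_triples"
  shows "(lattice_term p q a b c s has_sum 1 * F) {((m, n), l). n \<ge> 1 \<and> l > 0 \<and> m > 0 \<and> l + m > 0 \<and> m + int n > 0 \<and> l + m + int n > 0}"
proof (rule chamber_has_sum[OF assms, where
    j = "\<lambda>(L, M, N). ((int M, N), int L)" and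
    i = "\<lambda>((m, n), l). (nat ((l)), nat ((m)), nat ((int n)))"])
  fix L M N :: nat assume *: "L \<ge> 1" "M \<ge> 1" "N \<ge> 1"
  have "lattice_term p q a b c s ((int M, N), int L) = 1 * su4_term (of_nat p, of_nat q, s, of_nat a, of_nat b, of_nat c) (L, M, N)"
    by (subst lattice_term_sign[where Xp = "1" and Ap = "L" and Xq = "1" and Aq = "M"
          and Xa = "1" and Aa = "L + M" and Xb = "1" and Ab = "M + N"
          and Xc = "1" and Ac = "L + M + N" and j = "L + N"])
       (use * in \<open>auto simp: su4_term_def powr_of_nat_eq_power mult_ac power_add simp del: of_nat_add\<close>)
  thus "lattice_term p q a b c s ((\<lambda>(L, M, N). ((int M, N), int L)) (L, M, N)) =
      1 * su4_term (of_nat p, of_nat q, s, of_nat a, of_nat b, of_nat c) (L, M, N)"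
    by simp
qed (auto simp: index_triples_def)

lemma chamber2:
  assumes "(su4_term (of_nat p, of_nat a, s, of_nat q, of_nat c, of_nat b) has_sum F) index_triples"
  shows "(lattice_term p q a b c s has_sum (-1) ^ (p) * F) {((m, n), l). n \<ge> 1 \<and> l < 0 \<and> m > 0 \<and> l + m > 0 \<and> m + int n > 0 \<and> l + m + int n > 0}"
proof (rule chamber_has_sum[OF assms, where
    j = "\<lambda>(L, M, N). ((int (L + M), N), - int L)" and
    i = "\<lambda>((m, n), l). (nat (- (l)), nat ((l + m)), nat ((int n)))"])
  fix L M N :: nat assume *: "L \<ge> 1" "M \<ge> 1" "N \<ge> 1"
  have "lattice_term p q a b c s ((int (L + M), N), - int L) = (-1) ^ (p) * su4_term (of_nat p, of_nat a, s, of_nat q, of_nat c, of_nat b) (L, M, N)"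
    by (subst lattice_term_sign[where Xp = "-1" and Ap = "L" and Xq = "1" and Aq = "L + M"
          and Xa = "1" and Aa = "M" and Xb = "1" and Ab = "L + M + N"
          and Xc = "1" and Ac = "M + N" and j = "L + N"])
       (use * in \<open>auto simp: su4_term_def powr_of_nat_eq_power mult_ac power_add simp del: of_nat_add\<close>)
  thus "lattice_term p q a b c s ((\<lambda>(L, M, N). ((int (L + M), N), - int L)) (L, M, N)) =
      (-1) ^ (p) * su4_term (of_nat p, of_nat a, s, of_nat q, of_nat c, of_nat b) (L, M, N)"
    by simp
qed (auto simp: index_triples_def)

lemma chamber3:
  assumes "(su4_term (of_nat q, of_nat a, of_nat c, of_nat p, s, of_nat b) has_sum F) index_triples"
  shows "(lattice_term p q a b c s has_sum (-1) ^ (p + a) * F) {((m, n), l). n \<ge> 1 \<and> l < 0 \<and> m > 0 \<and> l + m < 0 \<and> m + int n > 0 \<and> l + m + int n > 0}"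
proof (rule chamber_has_sum[OF assms, where
    j = "\<lambda>(L, M, N). ((int L, M + N), - int (L + M))" and
    i = "\<lambda>((m, n), l). (nat ((m)), nat (- (l + m)), nat ((l + m + int n)))"])
  fix L M N :: nat assume *: "L \<ge> 1" "M \<ge> 1" "N \<ge> 1"
  have "lattice_term p q a b c s ((int L, M + N), - int (L + M)) = (-1) ^ (p + a) * su4_term (of_nat q, of_nat a, of_nat c, of_nat p, s, of_nat b) (L, M, N)"
    by (subst lattice_term_sign[where Xp = "-1" and Ap = "L + M" and Xq = "1" and Aq = "L"
          and Xa = "-1" and Aa = "M" and Xb = "1" and Ab = "L + M + N"
          and Xc = "1" and Ac = "N" and j = "L + N"])
       (use * in \<open>auto simp: su4_term_def powr_of_nat_eq_power mult_ac power_add simp del: of_nat_add\<close>)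
  thus "lattice_term p q a b c s ((\<lambda>(L, M, N). ((int L, M + N), - int (L + M))) (L, M, N)) =
      (-1) ^ (p + a) * su4_term (of_nat q, of_nat a, of_nat c, of_nat p, s, of_nat b) (L, M, N)"
    by simp
qed (auto simp: index_triples_def)

lemma chamber4:
  assumes "(su4_term (of_nat q, s, of_nat c, of_nat b, of_nat a, of_nat p) has_sum F) index_triples"
  shows "(lattice_term p q a b c s has_sum (-1) ^ (p + a + c) * F) {((m, n), l). n \<ge> 1 \<and> l < 0 \<and> m > 0 \<and> l + m < 0 \<and> m + int n > 0 \<and> l + m + int n < 0}"
proof (rule chamber_has_sum[OF assms, where
    j = "\<lambda>(L, M, N). ((int L, M), - int (L + M + N))" and
    i = "\<lambda>((m, n), l). (nat ((m)), nat ((int n)), nat (- (l + m + int n)))"])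
  fix L M N :: nat assume *: "L \<ge> 1" "M \<ge> 1" "N \<ge> 1"
  have "lattice_term p q a b c s ((int L, M), - int (L + M + N)) = (-1) ^ (p + a + c) * su4_term (of_nat q, s, of_nat c, of_nat b, of_nat a, of_nat p) (L, M, N)"
    by (subst lattice_term_sign[where Xp = "-1" and Ap = "L + M + N" and Xq = "1" and Aq = "L"
          and Xa = "-1" and Aa = "M + N" and Xb = "1" and Ab = "L + M"
          and Xc = "-1" and Ac = "N" and j = "L + N"])
       (use * in \<open>auto simp: su4_term_def powr_of_nat_eq_power mult_ac power_add simp del: of_nat_add\<close>)
  thus "lattice_term p q a b c s ((\<lambda>(L, M, N). ((int L, M), - int (L + M + N))) (L, M, N)) =
      (-1) ^ (p + a + c) * su4_term (of_nat q, s, of_nat c, of_nat b, of_nat a, of_nat p) (L, M, N)"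
    by simp
qed (auto simp: index_triples_def)

lemma chamber5:
  assumes "(su4_term (of_nat a, of_nat q, of_nat b, of_nat p, s, of_nat c) has_sum F) index_triples"
  shows "(lattice_term p q a b c s has_sum (-1) ^ (q) * F) {((m, n), l). n \<ge> 1 \<and> l > 0 \<and> m < 0 \<and> l + m > 0 \<and> m + int n > 0 \<and> l + m + int n > 0}"
proof (rule chamber_has_sum[OF assms, where
    j = "\<lambda>(L, M, N). ((- int M, M + N), int (L + M))" and
    i = "\<lambda>((m, n), l). (nat ((l + m)), nat (- (m)), nat ((m + int n)))"])
  fix L M N :: nat assume *: "L \<ge> 1" "M \<ge> 1" "N \<ge> 1"
  have "lattice_term p q a b c s ((- int M, M + N), int (L + M)) = (-1) ^ (q) * su4_term (of_nat a, of_nat q, of_nat b, of_nat p, s, of_nat c) (L, M, N)"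
    by (subst lattice_term_sign[where Xp = "1" and Ap = "L + M" and Xq = "-1" and Aq = "M"
          and Xa = "1" and Aa = "L" and Xb = "1" and Ab = "N"
          and Xc = "1" and Ac = "L + M + N" and j = "L + N"])
       (use * in \<open>auto simp: su4_term_def powr_of_nat_eq_power mult_ac power_add simp del: of_nat_add\<close>)
  thus "lattice_term p q a b c s ((\<lambda>(L, M, N). ((- int M, M + N), int (L + M))) (L, M, N)) =
      (-1) ^ (q) * su4_term (of_nat a, of_nat q, of_nat b, of_nat p, s, of_nat c) (L, M, N)"
    by simp
qed (auto simp: index_triples_def)

lemma chamber6:
  assumes "(su4_term (of_nat a, s, of_nat b, of_nat c, of_nat q, of_nat p) has_sum F) index_triples"
  shows "(lattice_term p q a b c s has_sum (-1) ^ (q + b) * F) {((m, n), l). n \<ge> 1 \<and> l > 0 \<and> m < 0 \<and> l + m > 0 \<and> m + int n < 0 \<and> l + m + int n > 0}"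
proof (rule chamber_has_sum[OF assms, where
    j = "\<lambda>(L, M, N). ((- int (M + N), M), int (L + M + N))" and
    i = "\<lambda>((m, n), l). (nat ((l + m)), nat ((int n)), nat (- (m + int n)))"])
  fix L M N :: nat assume *: "L \<ge> 1" "M \<ge> 1" "N \<ge> 1"
  have "lattice_term p q a b c s ((- int (M + N), M), int (L + M + N)) = (-1) ^ (q + b) * su4_term (of_nat a, s, of_nat b, of_nat c, of_nat q, of_nat p) (L, M, N)"
    by (subst lattice_term_sign[where Xp = "1" and Ap = "L + M + N" and Xq = "-1" and Aq = "M + N"
          and Xa = "1" and Aa = "L" and Xb = "-1" and Ab = "N"
          and Xc = "1" and Ac = "L + M" and j = "L + N"])
       (use * in \<open>auto simp: su4_term_def powr_of_nat_eq_power mult_ac power_add simp del: of_nat_add\<close>)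
  thus "lattice_term p q a b c s ((\<lambda>(L, M, N). ((- int (M + N), M), int (L + M + N))) (L, M, N)) =
      (-1) ^ (q + b) * su4_term (of_nat a, s, of_nat b, of_nat c, of_nat q, of_nat p) (L, M, N)"
    by simp
qed (auto simp: index_triples_def)

lemma chamber7:
  assumes "(su4_term (of_nat a, of_nat p, of_nat b, of_nat q, of_nat c, s) has_sum F) index_triples"
  shows "(lattice_term p q a b c s has_sum (-1) ^ (q + a) * F) {((m, n), l). n \<ge> 1 \<and> l > 0 \<and> m < 0 \<and> l + m < 0 \<and> m + int n > 0 \<and> l + m + int n > 0}"
proof (rule chamber_has_sum[OF assms, where
    j = "\<lambda>(L, M, N). ((- int (L + M), L + M + N), int M)" and
    i = "\<lambda>((m, n), l). (nat (- (l + m)), nat ((l)), nat ((m + int n)))"])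
  fix L M N :: nat assume *: "L \<ge> 1" "M \<ge> 1" "N \<ge> 1"
  have "lattice_term p q a b c s ((- int (L + M), L + M + N), int M) = (-1) ^ (q + a) * su4_term (of_nat a, of_nat p, of_nat b, of_nat q, of_nat c, s) (L, M, N)"
    by (subst lattice_term_sign[where Xp = "1" and Ap = "M" and Xq = "-1" and Aq = "L + M"
          and Xa = "-1" and Aa = "L" and Xb = "1" and Ab = "N"
          and Xc = "1" and Ac = "M + N" and j = "L + N"])
       (use * in \<open>auto simp: su4_term_def powr_of_nat_eq_power mult_ac power_add simp del: of_nat_add\<close>)
  thus "lattice_term p q a b c s ((\<lambda>(L, M, N). ((- int (L + M), L + M + N), int M)) (L, M, N)) =
      (-1) ^ (q + a) * su4_term (of_nat a, of_nat p, of_nat b, of_nat q, of_nat c, s) (L, M, N)"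
    by simp
qed (auto simp: index_triples_def)

lemma chamber8:
  assumes "(su4_term (of_nat a, of_nat c, of_nat b, s, of_nat p, of_nat q) has_sum F) index_triples"
  shows "(lattice_term p q a b c s has_sum (-1) ^ (q + a + b) * F) {((m, n), l). n \<ge> 1 \<and> l > 0 \<and> m < 0 \<and> l + m < 0 \<and> m + int n < 0 \<and> l + m + int n > 0}"
proof (rule chamber_has_sum[OF assms, where
    j = "\<lambda>(L, M, N). ((- int (L + M + N), L + M), int (M + N))" and
    i = "\<lambda>((m, n), l). (nat (- (l + m)), nat ((l + m + int n)), nat (- (m + int n)))"])
  fix L M N :: nat assume *: "L \<ge> 1" "M \<ge> 1" "N \<ge> 1"
  have "lattice_term p q a b c s ((- int (L + M + N), L + M), int (M + N)) = (-1) ^ (q + a + b) * su4_term (of_nat a, of_nat c, of_nat b, s, of_nat p, of_nat q) (L, M, N)"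
    by (subst lattice_term_sign[where Xp = "1" and Ap = "M + N" and Xq = "-1" and Aq = "L + M + N"
          and Xa = "-1" and Aa = "L" and Xb = "-1" and Ab = "N"
          and Xc = "1" and Ac = "M" and j = "L + N"])
       (use * in \<open>auto simp: su4_term_def powr_of_nat_eq_power mult_ac power_add simp del: of_nat_add\<close>)
  thus "lattice_term p q a b c s ((\<lambda>(L, M, N). ((- int (L + M + N), L + M), int (M + N))) (L, M, N)) =
      (-1) ^ (q + a + b) * su4_term (of_nat a, of_nat c, of_nat b, s, of_nat p, of_nat q) (L, M, N)"
    by simp
qed (auto simp: index_triples_def)

lemma chamber9:
  assumes "(su4_term (s, of_nat c, of_nat p, of_nat a, of_nat b, of_nat q) has_sum F) index_triples"
  shows "(lattice_term p q a b c s has_sum (-1) ^ (q + a + b + c) * F) {((m, n), l). n \<ge> 1 \<and> l > 0 \<and> m < 0 \<and> l + m < 0 \<and> m + int n < 0 \<and> l + m + int n < 0}"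
proof (rule chamber_has_sum[OF assms, where
    j = "\<lambda>(L, M, N). ((- int (L + M + N), L), int N)" and
    i = "\<lambda>((m, n), l). (nat ((int n)), nat (- (l + m + int n)), nat ((l)))"])
  fix L M N :: nat assume *: "L \<ge> 1" "M \<ge> 1" "N \<ge> 1"
  have "lattice_term p q a b c s ((- int (L + M + N), L), int N) = (-1) ^ (q + a + b + c) * su4_term (s, of_nat c, of_nat p, of_nat a, of_nat b, of_nat q) (L, M, N)"
    by (subst lattice_term_sign[where Xp = "1" and Ap = "N" and Xq = "-1" and Aq = "L + M + N"
          and Xa = "-1" and Aa = "L + M" and Xb = "-1" and Ab = "M + N"
          and Xc = "-1" and Ac = "M" and j = "L + N"])
       (use * in \<open>auto simp: su4_term_def powr_of_nat_eq_power mult_ac power_add simp del: of_nat_add\<close>)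
  thus "lattice_term p q a b c s ((\<lambda>(L, M, N). ((- int (L + M + N), L), int N)) (L, M, N)) =
      (-1) ^ (q + a + b + c) * su4_term (s, of_nat c, of_nat p, of_nat a, of_nat b, of_nat q) (L, M, N)"
    by simp
qed (auto simp: index_triples_def)

lemma chamber10:
  assumes "(su4_term (of_nat q, of_nat p, of_nat c, of_nat a, of_nat b, s) has_sum F) index_triples"
  shows "(lattice_term p q a b c s has_sum (-1) ^ (p + q + a) * F) {((m, n), l). n \<ge> 1 \<and> l < 0 \<and> m < 0 \<and> l + m < 0 \<and> m + int n > 0 \<and> l + m + int n > 0}"
proof (rule chamber_has_sum[OF assms, where
    j = "\<lambda>(L, M, N). ((- int L, L + M + N), - int M)" and
    i = "\<lambda>((m, n), l). (nat (- (m)), nat (- (l)), nat ((l + m + int n)))"])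
  fix L M N :: nat assume *: "L \<ge> 1" "M \<ge> 1" "N \<ge> 1"
  have "lattice_term p q a b c s ((- int L, L + M + N), - int M) = (-1) ^ (p + q + a) * su4_term (of_nat q, of_nat p, of_nat c, of_nat a, of_nat b, s) (L, M, N)"
    by (subst lattice_term_sign[where Xp = "-1" and Ap = "M" and Xq = "-1" and Aq = "L"
          and Xa = "-1" and Aa = "L + M" and Xb = "1" and Ab = "M + N"
          and Xc = "1" and Ac = "N" and j = "L + N"])
       (use * in \<open>auto simp: su4_term_def powr_of_nat_eq_power mult_ac power_add simp del: of_nat_add\<close>)
  thus "lattice_term p q a b c s ((\<lambda>(L, M, N). ((- int L, L + M + N), - int M)) (L, M, N)) =
      (-1) ^ (p + q + a) * su4_term (of_nat q, of_nat p, of_nat c, of_nat a, of_nat b, s) (L, M, N)"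
    by simp
qed (auto simp: index_triples_def)

lemma chamber11:
  assumes "(su4_term (of_nat q, of_nat b, of_nat c, s, of_nat p, of_nat a) has_sum F) index_triples"
  shows "(lattice_term p q a b c s has_sum (-1) ^ (p + q + a + c) * F) {((m, n), l). n \<ge> 1 \<and> l < 0 \<and> m < 0 \<and> l + m < 0 \<and> m + int n > 0 \<and> l + m + int n < 0}"
proof (rule chamber_has_sum[OF assms, where
    j = "\<lambda>(L, M, N). ((- int L, L + M), - int (M + N))" and
    i = "\<lambda>((m, n), l). (nat (- (m)), nat ((m + int n)), nat (- (l + m + int n)))"])
  fix L M N :: nat assume *: "L \<ge> 1" "M \<ge> 1" "N \<ge> 1"
  have "lattice_term p q a b c s ((- int L, L + M), - int (M + N)) = (-1) ^ (p + q + a + c) * su4_term (of_nat q, of_nat b, of_nat c, s, of_nat p, of_nat a) (L, M, N)"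
    by (subst lattice_term_sign[where Xp = "-1" and Ap = "M + N" and Xq = "-1" and Aq = "L"
          and Xa = "-1" and Aa = "L + M + N" and Xb = "1" and Ab = "M"
          and Xc = "-1" and Ac = "N" and j = "L + N"])
       (use * in \<open>auto simp: su4_term_def powr_of_nat_eq_power mult_ac power_add simp del: of_nat_add\<close>)
  thus "lattice_term p q a b c s ((\<lambda>(L, M, N). ((- int L, L + M), - int (M + N))) (L, M, N)) =
      (-1) ^ (p + q + a + c) * su4_term (of_nat q, of_nat b, of_nat c, s, of_nat p, of_nat a) (L, M, N)"
    by simp
qed (auto simp: index_triples_def)

lemma chamber12:
  assumes "(su4_term (s, of_nat b, of_nat p, of_nat q, of_nat c, of_nat a) has_sum F) index_triples"
  shows "(lattice_term p q a b c s has_sum (-1) ^ (p + q + a + b + c) * F) {((m, n), l). n \<ge> 1 \<and> l < 0 \<and> m < 0 \<and> l + m < 0 \<and> m + int n < 0 \<and> l + m + int n < 0}"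
proof (rule chamber_has_sum[OF assms, where
    j = "\<lambda>(L, M, N). ((- int (L + M), L), - int N)" and
    i = "\<lambda>((m, n), l). (nat ((int n)), nat (- (m + int n)), nat (- (l)))"])
  fix L M N :: nat assume *: "L \<ge> 1" "M \<ge> 1" "N \<ge> 1"
  have "lattice_term p q a b c s ((- int (L + M), L), - int N) = (-1) ^ (p + q + a + b + c) * su4_term (s, of_nat b, of_nat p, of_nat q, of_nat c, of_nat a) (L, M, N)"
    by (subst lattice_term_sign[where Xp = "-1" and Ap = "N" and Xq = "-1" and Aq = "L + M"
          and Xa = "-1" and Aa = "L + M + N" and Xb = "-1" and Ab = "M"
          and Xc = "-1" and Ac = "M + N" and j = "L + N"])
       (use * in \<open>auto simp: su4_term_def powr_of_nat_eq_power mult_ac power_add simp del: of_nat_add\<close>)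
  thus "lattice_term p q a b c s ((\<lambda>(L, M, N). ((- int (L + M), L), - int N)) (L, M, N)) =
      (-1) ^ (p + q + a + b + c) * su4_term (s, of_nat b, of_nat p, of_nat q, of_nat c, of_nat a) (L, M, N)"
    by simp
qed (auto simp: index_triples_def)


text \<open>Under renaming of the variables this is also the index set of \<open>T_fun\<close>,
  which allows the comparison term by term.\<close>

definition index_pairs :: "(int \<times> nat) set" where
  "index_pairs = {(m, n). m \<noteq> 0 \<and> n \<ge> 1 \<and> m + int n \<noteq> 0}"

definition su4_sum :: "complex6 \<Rightarrow> complex" where
  "su4_sum z = infsum (su4_term z) index_triples"

text \<open>The six forms are the positive roots of type A3. Their hyperplanes cut space into 24
  Weyl chambers, and \<open>n \<ge> 1\<close> keeps twelve, one for each term of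
  \<open>S_fun\<close>.\<close>

lemma lattice_term_has_sum:
  assumes "p \<ge> 1" "q \<ge> 1" "a \<ge> 1" "b \<ge> 1" "c \<ge> 1" "Re s > 1"
  shows "(lattice_term p q a b c s has_sum S_fun su4_sum p q a b c s) (Sigma index_pairs (\<lambda>(m, n). - {0, - m, - (m + int n)}))"
proof -
  let ?f = "lattice_term p q a b c s" and ?F = su4_sum
  let ?D1 = "{((m, n), l). n \<ge> 1 \<and> l > 0 \<and> m > 0 \<and> l + m > 0 \<and> m + int n > 0 \<and> l + m + int n > 0}"
  let ?D2 = "{((m, n), l). n \<ge> 1 \<and> l < 0 \<and> m > 0 \<and> l + m > 0 \<and> m + int n > 0 \<and> l + m + int n > 0}"
  let ?D3 = "{((m, n), l). n \<ge> 1 \<and> l < 0 \<and> m > 0 \<and> l + m < 0 \<and> m + int n > 0 \<and> l + m + int n > 0}"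
  let ?D4 = "{((m, n), l). n \<ge> 1 \<and> l < 0 \<and> m > 0 \<and> l + m < 0 \<and> m + int n > 0 \<and> l + m + int n < 0}"
  let ?D5 = "{((m, n), l). n \<ge> 1 \<and> l > 0 \<and> m < 0 \<and> l + m > 0 \<and> m + int n > 0 \<and> l + m + int n > 0}"
  let ?D6 = "{((m, n), l). n \<ge> 1 \<and> l > 0 \<and> m < 0 \<and> l + m > 0 \<and> m + int n < 0 \<and> l + m + int n > 0}"
  let ?D7 = "{((m, n), l). n \<ge> 1 \<and> l > 0 \<and> m < 0 \<and> l + m < 0 \<and> m + int n > 0 \<and> l + m + int n > 0}"
  let ?D8 = "{((m, n), l). n \<ge> 1 \<and> l > 0 \<and> m < 0 \<and> l + m < 0 \<and> m + int n < 0 \<and> l + m + int n > 0}"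
  let ?D9 = "{((m, n), l). n \<ge> 1 \<and> l > 0 \<and> m < 0 \<and> l + m < 0 \<and> m + int n < 0 \<and> l + m + int n < 0}"
  let ?D10 = "{((m, n), l). n \<ge> 1 \<and> l < 0 \<and> m < 0 \<and> l + m < 0 \<and> m + int n > 0 \<and> l + m + int n > 0}"
  let ?D11 = "{((m, n), l). n \<ge> 1 \<and> l < 0 \<and> m < 0 \<and> l + m < 0 \<and> m + int n > 0 \<and> l + m + int n < 0}"
  let ?D12 = "{((m, n), l). n \<ge> 1 \<and> l < 0 \<and> m < 0 \<and> l + m < 0 \<and> m + int n < 0 \<and> l + m + int n < 0}"
  have SS: "(su4_term (s1, s2, s3, s4, s5, s6) has_sum ?F (s1, s2, s3, s4, s5, s6)) index_triples"
    if "Re s1 \<ge> 1" "Re s2 \<ge> 1" "Re s3 \<ge> 1" "Re s4 \<ge> 1" "Re s5 \<ge> 1" "Re s6 \<ge> 1" for s1 s2 s3 s4 s5 s6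
    unfolding su4_sum_def using abs_summable_summable[OF su4_term_abs_summable[OF that]] by (rule has_sum_infsum)
  have h1: "(?f has_sum 1 * ?F (of_nat p, of_nat q, s, of_nat a, of_nat b, of_nat c)) (?D1 :: ((int \<times> nat) \<times> int) set)"
    by (intro chamber1 SS) (use assms in auto)
  have h2: "(?f has_sum (-1) ^ (p) * ?F (of_nat p, of_nat a, s, of_nat q, of_nat c, of_nat b)) (?D2 :: ((int \<times> nat) \<times> int) set)"
    by (intro chamber2 SS) (use assms in auto)
  have h3: "(?f has_sum (-1) ^ (p + a) * ?F (of_nat q, of_nat a, of_nat c, of_nat p, s, of_nat b)) (?D3 :: ((int \<times> nat) \<times> int) set)"
    by (intro chamber3 SS) (use assms in auto)
  have h4: "(?f has_sum (-1) ^ (p + a + c) * ?F (of_nat q, s, of_nat c, of_nat b, of_nat a, of_nat p)) (?D4 :: ((int \<times> nat) \<times> int) set)"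
    by (intro chamber4 SS) (use assms in auto)
  have h5: "(?f has_sum (-1) ^ (q) * ?F (of_nat a, of_nat q, of_nat b, of_nat p, s, of_nat c)) (?D5 :: ((int \<times> nat) \<times> int) set)"
    by (intro chamber5 SS) (use assms in auto)
  have h6: "(?f has_sum (-1) ^ (q + b) * ?F (of_nat a, s, of_nat b, of_nat c, of_nat q, of_nat p)) (?D6 :: ((int \<times> nat) \<times> int) set)"
    by (intro chamber6 SS) (use assms in auto)
  have h7: "(?f has_sum (-1) ^ (q + a) * ?F (of_nat a, of_nat p, of_nat b, of_nat q, of_nat c, s)) (?D7 :: ((int \<times> nat) \<times> int) set)"
    by (intro chamber7 SS) (use assms in auto)
  have h8: "(?f has_sum (-1) ^ (q + a + b) * ?F (of_nat a, of_nat c, of_nat b, s, of_nat p, of_nat q)) (?D8 :: ((int \<times> nat) \<times> int) set)"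
    by (intro chamber8 SS) (use assms in auto)
  have h9: "(?f has_sum (-1) ^ (q + a + b + c) * ?F (s, of_nat c, of_nat p, of_nat a, of_nat b, of_nat q)) (?D9 :: ((int \<times> nat) \<times> int) set)"
    by (intro chamber9 SS) (use assms in auto)
  have h10: "(?f has_sum (-1) ^ (p + q + a) * ?F (of_nat q, of_nat p, of_nat c, of_nat a, of_nat b, s)) (?D10 :: ((int \<times> nat) \<times> int) set)"
    by (intro chamber10 SS) (use assms in auto)
  have h11: "(?f has_sum (-1) ^ (p + q + a + c) * ?F (of_nat q, of_nat b, of_nat c, s, of_nat p, of_nat a)) (?D11 :: ((int \<times> nat) \<times> int) set)"
    by (intro chamber11 SS) (use assms in auto)
  have h12: "(?f has_sum (-1) ^ (p + q + a + b + c) * ?F (s, of_nat b, of_nat p, of_nat q, of_nat c, of_nat a)) (?D12 :: ((int \<times> nat) \<times> int) set)"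
    by (intro chamber12 SS) (use assms in auto)
  let ?U1 = "?D1" and ?v1 = "1 * ?F (of_nat p, of_nat q, s, of_nat a, of_nat b, of_nat c)"
  let ?U2 = "?U1 \<union> ?D2" and ?v2 = "?v1 + (-1) ^ (p) * ?F (of_nat p, of_nat a, s, of_nat q, of_nat c, of_nat b)"
  have u2: "(?f has_sum ?v2) ?U2"
    by (rule has_sum_Un_disjoint[OF h1 h2]) auto
  let ?U3 = "?U2 \<union> ?D3" and ?v3 = "?v2 + (-1) ^ (p + a) * ?F (of_nat q, of_nat a, of_nat c, of_nat p, s, of_nat b)"
  have u3: "(?f has_sum ?v3) ?U3"
    by (rule has_sum_Un_disjoint[OF u2 h3]) auto
  let ?U4 = "?U3 \<union> ?D4" and ?v4 = "?v3 + (-1) ^ (p + a + c) * ?F (of_nat q, s, of_nat c, of_nat b, of_nat a, of_nat p)"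
  have u4: "(?f has_sum ?v4) ?U4"
    by (rule has_sum_Un_disjoint[OF u3 h4]) auto
  let ?U5 = "?U4 \<union> ?D5" and ?v5 = "?v4 + (-1) ^ (q) * ?F (of_nat a, of_nat q, of_nat b, of_nat p, s, of_nat c)"
  have u5: "(?f has_sum ?v5) ?U5"
    by (rule has_sum_Un_disjoint[OF u4 h5]) auto
  let ?U6 = "?U5 \<union> ?D6" and ?v6 = "?v5 + (-1) ^ (q + b) * ?F (of_nat a, s, of_nat b, of_nat c, of_nat q, of_nat p)"
  have u6: "(?f has_sum ?v6) ?U6"
    by (rule has_sum_Un_disjoint[OF u5 h6]) auto
  let ?U7 = "?U6 \<union> ?D7" and ?v7 = "?v6 + (-1) ^ (q + a) * ?F (of_nat a, of_nat p, of_nat b, of_nat q, of_nat c, s)"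
  have u7: "(?f has_sum ?v7) ?U7"
    by (rule has_sum_Un_disjoint[OF u6 h7]) auto
  let ?U8 = "?U7 \<union> ?D8" and ?v8 = "?v7 + (-1) ^ (q + a + b) * ?F (of_nat a, of_nat c, of_nat b, s, of_nat p, of_nat q)"
  have u8: "(?f has_sum ?v8) ?U8"
    by (rule has_sum_Un_disjoint[OF u7 h8]) auto
  let ?U9 = "?U8 \<union> ?D9" and ?v9 = "?v8 + (-1) ^ (q + a + b + c) * ?F (s, of_nat c, of_nat p, of_nat a, of_nat b, of_nat q)"
  have u9: "(?f has_sum ?v9) ?U9"
    by (rule has_sum_Un_disjoint[OF u8 h9]) auto
  let ?U10 = "?U9 \<union> ?D10" and ?v10 = "?v9 + (-1) ^ (p + q + a) * ?F (of_nat q, of_nat p, of_nat c, of_nat a, of_nat b, s)"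
  have u10: "(?f has_sum ?v10) ?U10"
    by (rule has_sum_Un_disjoint[OF u9 h10]) auto
  let ?U11 = "?U10 \<union> ?D11" and ?v11 = "?v10 + (-1) ^ (p + q + a + c) * ?F (of_nat q, of_nat b, of_nat c, s, of_nat p, of_nat a)"
  have u11: "(?f has_sum ?v11) ?U11"
    by (rule has_sum_Un_disjoint[OF u10 h11]) auto
  let ?U12 = "?U11 \<union> ?D12" and ?v12 = "?v11 + (-1) ^ (p + q + a + b + c) * ?F (s, of_nat b, of_nat p, of_nat q, of_nat c, of_nat a)"
  have u12: "(?f has_sum ?v12) ?U12"
    by (rule has_sum_Un_disjoint[OF u11 h12]) auto
  \<comment> \<open>Of the 32 sign patterns of the five forms other than \<open>n\<close>, the
    omitted twenty are contradictory; linear integer arithmetic confirms it.\<close>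
  have "Sigma index_pairs (\<lambda>(m, n). - {0, - m, - (m + int n)}) = ?U12" (is "?L = ?R")
  proof (intro set_eqI iffI)
    fix x :: "(int \<times> nat) \<times> int" assume x: "x \<in> ?L"
    obtain m n l where [simp]: "x = ((m, n), l)" by (metis surj_pair)
    show "x \<in> ?R" using x by (simp add: index_pairs_def) presburger
  next
    fix x :: "(int \<times> nat) \<times> int" assume x: "x \<in> ?R"
    obtain m n l where [simp]: "x = ((m, n), l)" by (metis surj_pair)
    show "x \<in> ?L" using x by (simp add: index_pairs_def) presburger
  qed
  thus ?thesis using u12 by (simp only: S_fun_def Let_def mult_1)
qed

section \<open>The Mordell--Tornheim type sums\<close>

lemma int_inverse_squares_summable_on: "(\<lambda>l::int. 1 / real_of_int l ^ 2) summable_on A"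
proof -
  have "(\<lambda>l::int. 1 / real_of_int l ^ 2) summable_on range int"
    using inverse_squares_summable_on[of UNIV] by (subst summable_on_reindex) (auto simp: o_def)
  moreover have "(\<lambda>l::int. 1 / real_of_int l ^ 2) summable_on range (\<lambda>n. - int n)"
    using inverse_squares_summable_on[of UNIV] by (subst summable_on_reindex) (auto simp: o_def inj_on_def)
  ultimately have "(\<lambda>l::int. 1 / real_of_int l ^ 2) summable_on (range int \<union> range (\<lambda>n. - int n))"
    by (rule summable_on_union)
  also have "range int \<union> range (\<lambda>n. - int n) = UNIV"
    by (auto simp: image_iff) (metis int_cases2)
  finally show ?thesis by (rule summable_on_subset_banach) auto
qed

definition T_term :: "nat \<Rightarrow> complex \<Rightarrow> nat \<Rightarrow> complex \<Rightarrow> complex \<Rightarrow> int \<times> nat \<Rightarrow> complex" where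
  "T_term P s Q x y = (\<lambda>(l, m). x powi l * y ^ m / (of_int l ^ P * of_nat m powr s * of_int (l + int m) ^ Q))"

text \<open>The product 1/(uv) is at most 1/u^2 + 1/v^2, which separates the variables after a shift
  of \<open>l\<close> in the second summand. Exponents \<open>P = Q = 1\<close> are thereby
  included.\<close>

lemma T_term_summable_on:
  assumes PQ: "P \<ge> 1" "Q \<ge> 1" and x: "x = 1 \<or> x = -1" "y = 1 \<or> y = -1" and s: "Re s > 1"
  shows "T_term P s Q x y summable_on index_pairs"
proof (rule abs_summable_summable)
  let ?A = "UNIV \<times> {1..} :: (int \<times> nat) set"
  have 0: "(\<lambda>m::nat. real m powr (- Re s)) summable_on {1..}"
  proof -
    have "(\<lambda>m::nat. norm (of_nat m powr (-s) :: complex)) summable_on {1..}"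
      by (rule norm_powr_summable_on[OF s])
    also have "?this \<longleftrightarrow> ?thesis"
      by (rule summable_on_cong) (use norm_powr_real_powr[of "of_nat m" "-s" for m] in auto)
    finally show ?thesis .
  qed
  have 1: "(\<lambda>(l::int, m::nat). 1 / real_of_int l ^ 2 * real m powr (- Re s)) summable_on ?A"
    by (intro summable_on_times int_inverse_squares_summable_on 0) auto
  have 2: "(\<lambda>(l::int, m::nat). 1 / real_of_int (l + int m) ^ 2 * real m powr (- Re s)) summable_on ?A"
    using 1 by (rule summable_on_reindex_bij_witness[of _ "\<lambda>(l, m). (l + int m, m)" "\<lambda>(l, m). (l - int m, m)", THEN iffD1, rotated -1]) auto
  have "(\<lambda>(l::int, m::nat). (1 / real_of_int l ^ 2 + 1 / real_of_int (l + int m) ^ 2) * real m powr (- Re s)) summable_on ?A"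
    using summable_on_add[OF 1 2] by (simp add: case_prod_unfold distrib_right)
  hence 3: "(\<lambda>(l::int, m::nat). (1 / real_of_int l ^ 2 + 1 / real_of_int (l + int m) ^ 2) * real m powr (- Re s)) summable_on index_pairs"
    by (rule summable_on_subset_banach) (auto simp: index_pairs_def)
  show "(\<lambda>k. norm (T_term P s Q x y k)) summable_on index_pairs"
  proof (rule Infinite_Sum.abs_summable_on_comparison_test'[OF 3])
    fix k assume k: "k \<in> index_pairs"
    obtain l m where lm: "k = (l, m)" by (metis surj_pair)
    have nz: "l \<noteq> 0" "m \<ge> 1" "l + int m \<noteq> 0" using k by (auto simp: lm index_pairs_def)
    define u v where "u = \<bar>real_of_int l\<bar>" and "v = \<bar>real_of_int (l + int m)\<bar>"
    have uv: "u \<ge> 1" "v \<ge> 1" using nz unfolding u_def v_def by linarith+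
    have "1 / (u ^ P * v ^ Q) \<le> 1 / (u * v)"
      using uv PQ self_le_power[of u P] self_le_power[of v Q] by (intro divide_left_mono mult_mono) auto
    also have "\<dots> = 1 / u * (1 / v)" by simp
    also have "\<dots> \<le> (1 / u) ^ 2 + (1 / v) ^ 2"
    proof -
      have "2 * (1 / u * (1 / v)) \<le> (1 / u) ^ 2 + (1 / v) ^ 2"
        using sum_squares_bound[of "1 / u" "1 / v"] by (simp only: mult.assoc)
      moreover have "0 \<le> 1 / u * (1 / v)" using uv by simp
      ultimately show ?thesis by linarith
    qed
    also have "\<dots> = 1 / real_of_int l ^ 2 + 1 / real_of_int (l + int m) ^ 2"
      by (simp add: u_def v_def power_divide)
    finally have le: "1 / (u ^ P * v ^ Q) \<le> 1 / real_of_int l ^ 2 + 1 / real_of_int (l + int m) ^ 2" .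
    have "norm (x powi l * y ^ m) = 1" using x by (auto simp: norm_mult norm_power_int norm_power)
    moreover have "norm (of_nat m powr s :: complex) = real m powr Re s"
      using nz norm_powr_real_powr[of "of_nat m" s] by simp
    moreover have "norm (complex_of_int l) = u" "norm (complex_of_int (l + int m)) = v"
      unfolding u_def v_def by (simp_all only: norm_of_int)
    ultimately have "norm (T_term P s Q x y k) = 1 / (u ^ P * v ^ Q) * real m powr (- Re s)"
      by (simp add: T_term_def lm norm_divide norm_mult norm_power powr_minus field_simps del: of_int_add)
    thus "norm (T_term P s Q x y k) \<le> (case k of (l, m) \<Rightarrow>
        (1 / real_of_int l ^ 2 + 1 / real_of_int (l + int m) ^ 2) * real m powr (- Re s))"
      using mult_right_mono[OF le, of "real m powr (- Re s)"] by (simp add: lm)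
  qed
qed

section \<open>Closed forms in shifted zeta values\<close>

definition signed_zeta :: "complex \<Rightarrow> complex \<Rightarrow> complex" where
  "signed_zeta y s = (if y = 1 then riemann_zeta s else phi s)"

lemma signed_zeta_has_sum:
  assumes "y = 1 \<or> y = -1" "Re s > 1"
  shows "((\<lambda>m. y ^ m * of_nat m powr (- s)) has_sum signed_zeta y s) {1..}"
  using riemann_zeta_has_sum[OF assms(2)] phi_has_sum[OF assms(2)] assms(1) by (auto simp: signed_zeta_def)

lemma riemann_zeta_shift_analytic: "(\<lambda>s. riemann_zeta (s + of_nat k)) analytic_on {s. Re s > 1}"
proof -
  have "riemann_zeta \<circ> (\<lambda>s. s + of_nat k) analytic_on {s. Re s > 1}"
    by (intro analytic_on_compose analytic_intros analytic_on_subset[OF riemann_zeta_analytic]) auto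
  thus ?thesis by (simp add: o_def)
qed

lemma signed_zeta_shift_analytic: "(\<lambda>s. signed_zeta y (s + of_nat k)) analytic_on {s. Re s > 1}"
  unfolding signed_zeta_def phi_def
  by (cases "y = 1") (auto intro!: analytic_intros riemann_zeta_shift_analytic)

lemma zeta_expressible_sum:
  assumes "\<And>i. i \<in> I \<Longrightarrow> f i \<in> zeta_expressible"
  shows "(\<lambda>s. \<Sum>i\<in>I. f i s) \<in> zeta_expressible"
proof (cases "finite I")
  case True
  thus ?thesis using assms
  proof (induction rule: finite_induct)
    case empty thus ?case using zeta_expressible.const[of 0] by simp
  next
    case (insert i I)
    thus ?case using zeta_expressible.add[of "f i" "\<lambda>s. \<Sum>i\<in>I. f i s"] by simp
  qed
qed (use zeta_expressible.const[of 0] in simp)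

lemma zeta_expressible_of_nat: "(\<lambda>s. of_nat n) \<in> zeta_expressible"
  using zeta_expressible.const[of "of_nat n"] by simp

lemma zeta_expressible_minus_one_power: "(\<lambda>s. (-1) ^ n) \<in> zeta_expressible"
  using zeta_expressible.const[of "(-1) ^ n"] by (simp add: of_rat_power of_rat_minus)

lemma zeta_expressible_phi: "(\<lambda>s. phi (of_nat n)) \<in> zeta_expressible"
proof -
  have "(2::complex) powr (1 - of_nat n) - 1 = of_rat (2 / 2 ^ n - 1)"
    by (simp add: powr_diff of_rat_diff of_rat_divide of_rat_power of_rat_mult of_rat_inverse)
  moreover have "(\<lambda>s. of_rat (2 / 2 ^ n - 1) * riemann_zeta (of_int (int n))) \<in> zeta_expressible"
    by (intro zeta_expressible.intros)
  ultimately show ?thesis by (simp add: phi_def)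
qed

lemma zeta_expressible_window_coeff: "(\<lambda>s. window_coeff x i) \<in> zeta_expressible"
proof -
  have "(\<lambda>s. 2 * riemann_zeta (of_nat i)) \<in> zeta_expressible" "(\<lambda>s. 2 * phi (of_nat i)) \<in> zeta_expressible"
    using zeta_expressible.mult[OF zeta_expressible_of_nat[of 2] zeta_expressible.zeta_value[of "int i"]]
      zeta_expressible.mult[OF zeta_expressible_of_nat[of 2] zeta_expressible_phi[of i]] by simp_all
  moreover have "(\<lambda>s. -1) \<in> zeta_expressible" "(\<lambda>s. 0) \<in> zeta_expressible"
    using zeta_expressible.const[of "-1"] zeta_expressible.const[of 0] by (simp_all add: of_rat_minus)
  ultimately show ?thesis unfolding window_coeff_def by (auto split: if_splits)
qed

lemma zeta_expressible_signed_zeta_shift: "(\<lambda>s. signed_zeta y (s + of_nat k)) \<in> zeta_expressible"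
proof (cases "y = 1")
  case True
  thus ?thesis using zeta_expressible.zeta_shift[of "int k"] by (simp add: signed_zeta_def)
next
  case False
  have "(2::complex) powr (1 - (s + of_nat k)) - 1 = of_rat (2 / 2 ^ k) * 2 powr (- s) + of_rat (-1)" for s
    by (simp add: powr_diff powr_add powr_minus of_rat_divide of_rat_power of_rat_minus of_rat_mult of_rat_inverse divide_inverse)
  moreover have "(\<lambda>s. (of_rat (2 / 2 ^ k) * 2 powr (- s) + of_rat (-1)) * riemann_zeta (s + of_int (int k))) \<in> zeta_expressible"
    by (intro zeta_expressible.intros)
  ultimately show ?thesis using False by (simp add: signed_zeta_def phi_def)
qed

lemma has_sum_sum:
  fixes f :: "'i \<Rightarrow> 'a \<Rightarrow> complex"
  assumes "finite I" "\<And>i. i \<in> I \<Longrightarrow> (f i has_sum F i) A"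
  shows "((\<lambda>x. \<Sum>i\<in>I. f i x) has_sum (\<Sum>i\<in>I. F i)) A"
  using assms by (induction rule: finite_induct) (auto intro: has_sum_add)

text \<open>The pole evaluation with the two poles 0 and \<open>- m\<close>. The second carries
  \<open>x ^ m\<close>, which together with \<open>y ^ m\<close> gives the sign
  \<open>x * y\<close>.\<close>

lemma T_term_inner:
  assumes PQ: "P \<ge> 1" "Q \<ge> 1" and x: "x = 1 \<or> x = -1" and y: "y \<noteq> 0" and m: "m \<ge> 1"
    and sm: "(\<lambda>l. T_term P s Q x y (l, m)) summable_on (- {0, - int m})"
  shows "((\<lambda>l. T_term P s Q x y (l, m)) has_sum
     ((\<Sum>i=0..P. window_coeff x i * ((-1) ^ (P - i) * of_nat ((Q - 1 + (P - i)) choose (P - i))) *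
          (y ^ m * of_nat m powr (- (s + of_nat (P + Q - i)))))
   + (\<Sum>i=0..Q. window_coeff x i * ((-1) ^ P * of_nat ((P - 1 + (Q - i)) choose (Q - i))) *
          ((x * y) ^ m * of_nat m powr (- (s + of_nat (P + Q - i))))))) (- {0, - int m})"
proof -
  let ?m = "of_nat m :: complex"
  let ?W = "y ^ m / ?m powr s"
  \<comment> \<open>The third factor has exponent 0; its position \<open>2 * m\<close> only has to
    differ from 0 and \<open>m\<close>.\<close>
  let ?g = "\<lambda>l. x powi l / (of_int l ^ P * of_int (l + int m) ^ Q * of_int (l + 2 * int m) ^ 0)"
  let ?G = "laurent_family P Q 0 (of_int (int m)) (of_int (2 * int m))"
  have m0: "?m \<noteq> 0" and ms: "?m powr s \<noteq> 0" using m by auto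
  have tg: "T_term P s Q x y (l, m) = ?W * ?g l" for l by (simp add: T_term_def field_simps)
  show ?thesis
  proof -
    have "?g summable_on (- {0, - int m})"
      using summable_on_cmult_right[OF sm, of "inverse ?W"] y ms by (simp add: tg)
    hence "(?g has_sum (\<Sum>R\<in>{0, - int m}. x powi R * (\<Sum>i=0..P+Q. window_coeff x i * fls_nth (?G R) (- int i)))) (- {0, - int m})"
      using PQ m x by (intro laurent_family_has_sum) auto
    also have "(\<Sum>R\<in>{0, - int m}. x powi R * (\<Sum>i=0..P+Q. window_coeff x i * fls_nth (?G R) (- int i))) =
       (\<Sum>i=0..P+Q. window_coeff x i * fls_nth (?G 0) (- int i)) + x powi (- int m) * (\<Sum>i=0..P+Q. window_coeff x i * fls_nth (?G (- int m)) (- int i))"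
      using m by simp
    also have "x powi (- int m) = x ^ m" using x by (auto simp: power_int_minus power_inverse[symmetric])
    also have "(\<Sum>i=0..P+Q. window_coeff x i * fls_nth (?G 0) (- int i)) =
       (\<Sum>i=0..P. window_coeff x i * ((-1) ^ (P - i) * of_nat ((Q - 1 + (P - i)) choose (P - i)) / ?m ^ (P + Q - i)))"
    proof (intro sum.mono_neutral_cong_right ballI)
      have G: "?G 0 = fls_X_inv ^ P * fps_to_fls (inverse (lin ?m ^ Q))"
        using m0 by (simp add: laurent_family_def lin_inv_0 lin_inv_power)
      show "window_coeff x i * fls_nth (?G 0) (- int i) = 0" if "i \<in> {0..P+Q} - {0..P}" for i
        unfolding G X_inv_power_mult_nth using that by auto
      show "window_coeff x i * fls_nth (?G 0) (- int i) = window_coeff x i * ((-1) ^ (P - i) * of_nat ((Q - 1 + (P - i)) choose (P - i)) / ?m ^ (P + Q - i))"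
        if "i \<in> {0..P}" for i
        unfolding G X_inv_power_mult_nth using that PQ lin_inverse_power_nth[OF m0, of "Q - 1" "P - i"]
        by (simp add: algebra_simps del: power_Suc)
    qed auto
    also have "(\<Sum>i=0..P+Q. window_coeff x i * fls_nth (?G (- int m)) (- int i)) =
       (\<Sum>i=0..Q. window_coeff x i * ((-1) ^ P * of_nat ((P - 1 + (Q - i)) choose (Q - i)) / ?m ^ (P + Q - i)))"
    proof (intro sum.mono_neutral_cong_right ballI)
      have G: "?G (- int m) = fls_X_inv ^ Q * fps_to_fls (inverse (lin (- ?m) ^ P))"
        using m0 by (simp add: laurent_family_def lin_inv_0 lin_inv_power mult.commute)
      show "window_coeff x i * fls_nth (?G (- int m)) (- int i) = 0" if "i \<in> {0..P+Q} - {0..Q}" for i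
        unfolding G X_inv_power_mult_nth using that by auto
      show "window_coeff x i * fls_nth (?G (- int m)) (- int i) = window_coeff x i * ((-1) ^ P * of_nat ((P - 1 + (Q - i)) choose (Q - i)) / ?m ^ (P + Q - i))"
        if i: "i \<in> {0..Q}" for i
      proof -
        have "(- ?m) ^ (P + (Q - i)) = (-1) ^ (P + (Q - i)) * ?m ^ (P + Q - i)"
          using i by (subst power_minus) simp
        hence "fps_nth (inverse (lin (- ?m) ^ P)) (Q - i) =
            (-1) ^ (Q - i) * of_nat ((P - 1 + (Q - i)) choose (Q - i)) / ((-1) ^ (P + (Q - i)) * ?m ^ (P + Q - i))"
          using PQ lin_inverse_power_nth[of "- ?m" "P - 1" "Q - i"] m0 by (simp del: power_Suc)
        also have "\<dots> = (-1) ^ P * of_nat ((P - 1 + (Q - i)) choose (Q - i)) / ?m ^ (P + Q - i)"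
          by (auto simp: uminus_power_if power_add)
        finally show ?thesis unfolding G X_inv_power_mult_nth using i by simp
      qed
    qed auto
    finally have "((\<lambda>l. ?W * ?g l) has_sum (?W * ((\<Sum>i=0..P. window_coeff x i * ((-1) ^ (P - i) * of_nat ((Q - 1 + (P - i)) choose (P - i)) / ?m ^ (P + Q - i)))
       + x ^ m * (\<Sum>i=0..Q. window_coeff x i * ((-1) ^ P * of_nat ((P - 1 + (Q - i)) choose (Q - i)) / ?m ^ (P + Q - i)))))) (- {0, - int m})"
      by (rule has_sum_cmult_right)
    moreover have pf: "of_nat m powr (- (s + of_nat k)) = 1 / ?m powr s * (1 / ?m ^ k)" for k
      using m0 by (simp add: powr_minus powr_add divide_inverse del: minus_add_distrib)
    ultimately show ?thesis
      unfolding tg distrib_left sum_distrib_left pf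
      by (simp add: power_mult_distrib mult_ac)
  qed
qed

text \<open>Summing the inner values over \<open>m\<close> gives zeta or \<open>phi\<close> at
  \<open>s + (P + Q - i)\<close>. The shifts are not negative, so the closed form is analytic
  wherever the series converges.\<close>

lemma T_sum_expressible:
  assumes PQ: "P \<ge> 1" "Q \<ge> 1" and x: "x = 1 \<or> x = -1" "y = 1 \<or> y = -1"
  obtains f where "f \<in> zeta_expressible" "f analytic_on {s. Re s > 1}"
    "\<And>s. Re s > 1 \<Longrightarrow> (T_term P s Q x y has_sum f s) index_pairs"
proof
  let ?f = "\<lambda>s. (\<Sum>i=0..P. window_coeff x i * ((-1) ^ (P - i) * of_nat ((Q - 1 + (P - i)) choose (P - i))) * signed_zeta y (s + of_nat (P + Q - i)))
   + (\<Sum>i=0..Q. window_coeff x i * ((-1) ^ P * of_nat ((P - 1 + (Q - i)) choose (Q - i))) * signed_zeta (x * y) (s + of_nat (P + Q - i)))"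
  show "?f \<in> zeta_expressible"
    by (intro zeta_expressible.add zeta_expressible_sum zeta_expressible.mult zeta_expressible_window_coeff
        zeta_expressible_minus_one_power zeta_expressible_of_nat zeta_expressible_signed_zeta_shift)
  show "?f analytic_on {s. Re s > 1}"
    by (intro analytic_intros signed_zeta_shift_analytic)
  show "(T_term P s Q x y has_sum ?f s) index_pairs" if s: "Re s > 1" for s
  proof -
    obtain S where S: "(T_term P s Q x y has_sum S) index_pairs"
      using T_term_summable_on[OF PQ x s] by (auto simp: summable_on_def)
    \<comment> \<open>The coordinates are exchanged to make \<open>l\<close> the inner
      variable.\<close>
    hence S': "((\<lambda>(m, l). T_term P s Q x y (l, m)) has_sum S) (Sigma {1..} (\<lambda>m. - {0, - int m}))"
      by (rule has_sum_reindex_bij_witness[of _ prod.swap prod.swap, THEN iffD1, rotated -1]) (auto simp: index_pairs_def)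
    have "((\<lambda>m. (\<Sum>i=0..P. window_coeff x i * ((-1) ^ (P - i) * of_nat ((Q - 1 + (P - i)) choose (P - i))) *
          (y ^ m * of_nat m powr (- (s + of_nat (P + Q - i)))))
       + (\<Sum>i=0..Q. window_coeff x i * ((-1) ^ P * of_nat ((P - 1 + (Q - i)) choose (Q - i))) *
          ((x * y) ^ m * of_nat m powr (- (s + of_nat (P + Q - i)))))) has_sum S) {1..}"
    proof (rule has_sum_SigmaD[OF S'], unfold prod.case, rule T_term_inner[OF PQ x(1)])
      show "y \<noteq> 0" using x by auto
    next
      fix m :: nat assume m: "m \<in> {1..}"
      show "(\<lambda>l. T_term P s Q x y (l, m)) summable_on (- {0, - int m})"
        by (rule summable_on_SigmaD1[OF has_sum_imp_summable[OF S'] m])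
    qed auto
    moreover have "((\<lambda>m. (\<Sum>i=0..P. window_coeff x i * ((-1) ^ (P - i) * of_nat ((Q - 1 + (P - i)) choose (P - i))) *
          (y ^ m * of_nat m powr (- (s + of_nat (P + Q - i)))))
       + (\<Sum>i=0..Q. window_coeff x i * ((-1) ^ P * of_nat ((P - 1 + (Q - i)) choose (Q - i))) *
          ((x * y) ^ m * of_nat m powr (- (s + of_nat (P + Q - i)))))) has_sum ?f s) {1..}"
      using x s by (intro has_sum_add has_sum_sum has_sum_cmult_right signed_zeta_has_sum) auto
    ultimately have "S = ?f s" by (rule has_sum_unique)
    with S show ?thesis by simp
  qed
qed

lemma T_fun_expressible:
  assumes PQ: "P \<ge> 1" "Q \<ge> 1" and x: "x = 1 \<or> x = -1" "y = 1 \<or> y = -1"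
  obtains f where "f \<in> zeta_expressible" "\<And>s. T_fun P s Q x y = remove_sings f s"
    "\<And>s. Re s > 1 \<Longrightarrow> (T_term P s Q x y has_sum T_fun P s Q x y) index_pairs"
    "\<And>s. Re s > 1 \<Longrightarrow> T_fun P s Q x y = f s"
proof -
  obtain f where f: "f \<in> zeta_expressible" "f analytic_on {s. Re s > 1}"
    "\<And>s. Re s > 1 \<Longrightarrow> (T_term P s Q x y has_sum f s) index_pairs"
    using T_sum_expressible[OF assms] by blast
  have D: "{(l :: int, m :: nat). l \<noteq> 0 \<and> m \<ge> 1 \<and> l + int m \<noteq> 0} = index_pairs" by (simp add: index_pairs_def)
  have T: "T_fun P s Q x y = remove_sings f s" for s
    unfolding T_fun_def D
  proof (subst mero_ext_eq[OF zeta_expressible_meromorphic[OF f(1)] f(2)])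
    fix s :: complex assume "Re s > 1"
    from infsumI[OF f(3)[OF this]] show "f s = (\<Sum>\<^sub>\<infinity>(l, m)\<in>index_pairs. x powi l * y ^ m / (of_int l ^ P * of_nat m powr s * of_int (l + int m) ^ Q))"
      by (simp add: T_term_def)
  qed simp
  have T1: "T_fun P s Q x y = f s" if "Re s > 1" for s
    unfolding T using analytic_on_subset[OF f(2), of "{s}"] that by simp
  show thesis using that[OF f(1) T] f(3) T1 by simp
qed

lemma T_fun_shift_meromorphic:
  assumes "P \<ge> 1" "Q \<ge> 1" "x = 1 \<or> x = -1" "y = 1 \<or> y = -1"
  shows "(\<lambda>s. T_fun P (s + of_nat k) Q x y) meromorphic_on UNIV"
proof -
  obtain f where f: "f \<in> zeta_expressible" "\<And>s. T_fun P s Q x y = remove_sings f s"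
    using T_fun_expressible[OF assms] by metis
  have "remove_sings f meromorphic_on UNIV"
    by (intro remove_sings_meromorphic zeta_expressible_meromorphic f)
  hence "(\<lambda>s. remove_sings f (s + of_nat k)) meromorphic_on UNIV"
    by (rule meromorphic_on_compose) (auto intro!: analytic_intros)
  thus ?thesis by (simp add: f(2))
qed

text \<open>Needed because half of the right-hand side contains \<open>T_fun\<close> at shifted
  arguments.\<close>

lemma zeta_expressible_shift:
  "f \<in> zeta_expressible \<Longrightarrow> (\<lambda>s. f (s + of_nat k)) \<in> zeta_expressible"
proof (induction rule: zeta_expressible.induct)
  case two_powr
  have "(2::complex) powr (- (s + of_nat k)) = of_rat (1 / 2 ^ k) * 2 powr (- s)" for s
    by (simp add: powr_minus powr_add of_rat_divide of_rat_power of_rat_inverse divide_inverse del: minus_add_distrib)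
  thus ?case using zeta_expressible.mult[OF zeta_expressible.const[of "1 / 2 ^ k"] zeta_expressible.two_powr] by simp
next
  case (zeta_shift j)
  show ?case using zeta_expressible.zeta_shift[of "int k + j"] by (simp add: add.assoc)
qed (auto intro: zeta_expressible.intros)

section \<open>The identity in the half-plane of convergence\<close>

lemma T_term_mult_left:
  assumes "f1 = b + f"
  shows "x powi m * y ^ n / (of_int m ^ q * of_nat n powr s * of_int (m + int n) ^ b) *
      (k / (of_int m ^ e * of_int (m + int n) ^ f)) = k * T_term (q + e) s f1 x y (m, n)"
  by (simp add: T_term_def assms power_add mult_ac del: of_int_add)

lemma T_term_mult_right:
  assumes "n \<ge> 1" "f1 = b + f"
  shows "x powi m * y ^ n / (of_int m ^ q * of_nat n powr s * of_int (m + int n) ^ b) *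
      (k / (of_nat n ^ e * of_int (m + int n) ^ f)) = k * T_term q (s + of_nat e) f1 x y (m, n)"
proof -
  have "of_nat n powr (s + of_nat e) = (of_nat n powr s * of_nat n ^ e :: complex)"
    using assms by (simp add: powr_add)
  thus ?thesis by (simp add: T_term_def assms power_add mult_ac del: of_int_add)
qed

text \<open>Abstracting from \<open>T_fun\<close> allows the same expression to be formed from
  single terms \<open>T_term\<close>; linearity then passes from terms to sums.\<close>

definition rhs_gen :: "(nat \<Rightarrow> complex \<Rightarrow> nat \<Rightarrow> complex \<Rightarrow> complex \<Rightarrow> complex) \<Rightarrow>
    nat \<Rightarrow> nat \<Rightarrow> nat \<Rightarrow> nat \<Rightarrow> nat \<Rightarrow> complex \<Rightarrow> complex" where
  "rhs_gen T p q a b c s =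
     2 * (-1) ^ p *
       (\<Sum>j = 0..p div 2. phi (of_nat (2 * j)) *
         (\<Sum>w = 0..p - 2 * j.
            of_nat ((w + a - 1) choose w) * of_nat ((p + c - 2 * j - w - 1) choose (c - 1)) *
            T (q + a + w) s (p + b + c - 2 * j - w) 1 (-1)))
   + 2 * (-1) ^ (p + a) *
       (\<Sum>j = 0..c div 2. phi (of_nat (2 * j)) *
         (\<Sum>w = 0..c - 2 * j.
            of_nat ((w + a - 1) choose w) * of_nat ((p + c - 2 * j - w - 1) choose (p - 1)) *
            T q (s + of_nat (a + w)) (p + b + c - 2 * j - w) (-1) 1))
   + 2 * (-1) ^ p *
       (\<Sum>j = 0..a div 2. phi (of_nat (2 * j)) *
         (\<Sum>w = 0..p - 1.
            of_nat ((w + a - 2 * j) choose w) * of_nat ((p + c - 2 - w) choose (c - 1)) *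
            T (q + a - 2 * j + w + 1) s (p + b + c - 1 - w) (-1) (-1)))
   + 2 * (-1) ^ (p + a) *
       (\<Sum>j = 0..a div 2. phi (of_nat (2 * j)) *
         (\<Sum>w = 0..c - 1.
            of_nat ((w + a - 2 * j) choose w) * of_nat ((p + c - 2 - w) choose (p - 1)) *
            T q (s + of_nat (a - 2 * j + w + 1)) (p + b + c - 1 - w) (-1) (-1)))"

lemma rhs_fun_eq: "rhs_fun p q a b c s = rhs_gen T_fun p q a b c s"
  unfolding rhs_fun_def rhs_gen_def ..

lemma rhs_gen_has_sum:
  assumes "p \<ge> 1" "q \<ge> 1" "a \<ge> 1" "b \<ge> 1" "c \<ge> 1" "Re s > 1"
  shows "((\<lambda>k. rhs_gen (\<lambda>P s Q x y. T_term P s Q x y k) p q a b c s) has_sum rhs_fun p q a b c s) index_pairs"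
proof -
  have T: "(T_term P s Q x y has_sum T_fun P s Q x y) index_pairs"
    if "P \<ge> 1" "Q \<ge> 1" "x = 1 \<or> x = -1" "y = 1 \<or> y = -1" "Re s > 1" for P s Q x y
    using T_fun_expressible[OF that(1-4)] that(5) by metis
  show ?thesis
    unfolding rhs_fun_eq rhs_gen_def
    by (intro has_sum_add has_sum_cmult_right has_sum_sum T) (use assms in auto)
qed

text \<open>\<open>W\<close> collects what does not depend on \<open>l\<close>. Its sign
  \<open>(-1) ^ n\<close> times the pole signs 1, \<open>(-1) powi (m + n)\<close>,
  \<open>(-1) powi m\<close> gives the pairs (1, -1), (-1, 1), (-1, -1) of the four
  \<open>T_fun\<close> lines.\<close>

lemma inner_sum_eq_rhs_gen:
  fixes m :: int and n p q a b c :: nat and s :: complex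
  assumes "p \<ge> 1" "q \<ge> 1" "a \<ge> 1" "b \<ge> 1" "c \<ge> 1" "n \<ge> 1"
  defines "W \<equiv> (-1) ^ n / (of_int m ^ q * of_nat n powr s * of_int (m + int n) ^ b)"
  shows "W *
     (2 * (-1) ^ p * outer_pole_sum p a c (of_int m) (of_int (m + int n))
      + (-1) powi (m + int n) * (2 * (-1) ^ (p + a) * outer_pole_sum c a p (of_int (int n)) (of_int (m + int n)))
      + (-1) powi m * (2 * (-1) ^ p * middle_pole_sum p a c (of_int m) (of_int (m + int n))
                     + 2 * (-1) ^ (p + a) * middle_pole_sum c a p (of_int (int n)) (of_int (m + int n)))) =
     rhs_gen (\<lambda>P s Q x y. T_term P s Q x y (m, n)) p q a b c s"
proof -
  let ?d = "of_int m ^ q * of_nat n powr s * of_int (m + int n) ^ b :: complex"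
  have W1: "W = 1 powi m * (-1) ^ n / ?d" unfolding W_def by simp
  have W2: "W * (-1) powi (m + int n) = (-1) powi m * 1 ^ n / ?d"
    unfolding W_def by (auto simp: power_int_minus_left uminus_power_if)
  have W3: "W * (-1) powi m = (-1) powi m * (-1) ^ n / ?d" unfolding W_def by simp
  have 1: "W * outer_pole_sum p a c (of_int m) (of_int (m + int n)) =
     (\<Sum>j = 0..p div 2. phi (of_nat (2 * j)) *
         (\<Sum>w = 0..p - 2 * j.
            of_nat ((w + a - 1) choose w) * of_nat ((p + c - 2 * j - w - 1) choose (c - 1)) *
            T_term (q + a + w) s (p + b + c - 2 * j - w) 1 (-1) (m, n)))"
    unfolding outer_pole_sum_def sum_distrib_left[of W] mult.left_commute[of W]
  proof (rule sum.cong[OF refl], rule arg_cong2[of _ _ _ _ "(*)", OF refl], rule sum.cong[OF refl])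
    fix j w assume "j \<in> {0..p div 2}" "w \<in> {0..p - 2 * j}"
    hence e: "p + b + c - 2 * j - w = b + (p + c - 2 * j - w)" by auto
    show "W * (of_nat ((w + a - 1) choose w) * of_nat ((p + c - 2 * j - w - 1) choose (c - 1)) /
            (of_int m ^ (a + w) * of_int (m + int n) ^ (p + c - 2 * j - w))) =
          of_nat ((w + a - 1) choose w) * of_nat ((p + c - 2 * j - w - 1) choose (c - 1)) *
            T_term (q + a + w) s (p + b + c - 2 * j - w) 1 (-1) (m, n)"
      unfolding W1 T_term_mult_left[OF e] by (simp only: add.assoc)
  qed
  have 2: "(W * (-1) powi (m + int n)) * outer_pole_sum c a p (of_int (int n)) (of_int (m + int n)) =
     (\<Sum>j = 0..c div 2. phi (of_nat (2 * j)) *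
         (\<Sum>w = 0..c - 2 * j.
            of_nat ((w + a - 1) choose w) * of_nat ((p + c - 2 * j - w - 1) choose (p - 1)) *
            T_term q (s + of_nat (a + w)) (p + b + c - 2 * j - w) (-1) 1 (m, n)))"
    unfolding outer_pole_sum_def sum_distrib_left[of "W * (-1) powi (m + int n)"] mult.left_commute[of "W * (-1) powi (m + int n)"]
  proof (rule sum.cong[OF refl], rule arg_cong2[of _ _ _ _ "(*)", OF refl], rule sum.cong[OF refl])
    fix j w assume "j \<in> {0..c div 2}" "w \<in> {0..c - 2 * j}"
    hence e: "p + b + c - 2 * j - w = b + (c + p - 2 * j - w)" by auto
    show "W * (-1) powi (m + int n) * (of_nat ((w + a - 1) choose w) * of_nat ((c + p - 2 * j - w - 1) choose (p - 1)) /
            (of_int (int n) ^ (a + w) * of_int (m + int n) ^ (c + p - 2 * j - w))) =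
          of_nat ((w + a - 1) choose w) * of_nat ((p + c - 2 * j - w - 1) choose (p - 1)) *
            T_term q (s + of_nat (a + w)) (p + b + c - 2 * j - w) (-1) 1 (m, n)"
      unfolding W2 of_int_of_nat_eq T_term_mult_right[OF assms(6) e] by (simp only: add.commute)
  qed
  have 3: "(W * (-1) powi m) * middle_pole_sum p a c (of_int m) (of_int (m + int n)) =
     (\<Sum>j = 0..a div 2. phi (of_nat (2 * j)) *
         (\<Sum>w = 0..p - 1.
            of_nat ((w + a - 2 * j) choose w) * of_nat ((p + c - 2 - w) choose (c - 1)) *
            T_term (q + a - 2 * j + w + 1) s (p + b + c - 1 - w) (-1) (-1) (m, n)))"
    unfolding middle_pole_sum_def sum_distrib_left[of "W * (-1) powi m"] mult.left_commute[of "W * (-1) powi m"]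
  proof (rule sum.cong[OF refl], rule arg_cong2[of _ _ _ _ "(*)", OF refl], rule sum.cong[OF refl])
    fix j w assume "j \<in> {0..a div 2}" "w \<in> {0..p - 1}"
    hence e: "p + b + c - 1 - w = b + (p + c - 1 - w)" and e': "q + a - 2 * j + w + 1 = q + (a - 2 * j + w + 1)"
      using assms by auto
    show "W * (-1) powi m * (of_nat ((w + a - 2 * j) choose w) * of_nat ((p + c - 2 - w) choose (c - 1)) /
            (of_int m ^ (a - 2 * j + w + 1) * of_int (m + int n) ^ (p + c - 1 - w))) =
          of_nat ((w + a - 2 * j) choose w) * of_nat ((p + c - 2 - w) choose (c - 1)) *
            T_term (q + a - 2 * j + w + 1) s (p + b + c - 1 - w) (-1) (-1) (m, n)"
      unfolding W3 e' by (rule T_term_mult_left[OF e])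
  qed
  have 4: "(W * (-1) powi m) * middle_pole_sum c a p (of_int (int n)) (of_int (m + int n)) =
     (\<Sum>j = 0..a div 2. phi (of_nat (2 * j)) *
         (\<Sum>w = 0..c - 1.
            of_nat ((w + a - 2 * j) choose w) * of_nat ((p + c - 2 - w) choose (p - 1)) *
            T_term q (s + of_nat (a - 2 * j + w + 1)) (p + b + c - 1 - w) (-1) (-1) (m, n)))"
    unfolding middle_pole_sum_def sum_distrib_left[of "W * (-1) powi m"] mult.left_commute[of "W * (-1) powi m"]
  proof (rule sum.cong[OF refl], rule arg_cong2[of _ _ _ _ "(*)", OF refl], rule sum.cong[OF refl])
    fix j w assume "j \<in> {0..a div 2}" "w \<in> {0..c - 1}"
    hence e: "p + b + c - 1 - w = b + (c + p - 1 - w)" using assms by auto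
    show "W * (-1) powi m * (of_nat ((w + a - 2 * j) choose w) * of_nat ((c + p - 2 - w) choose (p - 1)) /
            (of_int (int n) ^ (a - 2 * j + w + 1) * of_int (m + int n) ^ (c + p - 1 - w))) =
          of_nat ((w + a - 2 * j) choose w) * of_nat ((p + c - 2 - w) choose (p - 1)) *
            T_term q (s + of_nat (a - 2 * j + w + 1)) (p + b + c - 1 - w) (-1) (-1) (m, n)"
      unfolding W3 of_int_of_nat_eq T_term_mult_right[OF assms(6) e] by (simp only: add.commute)
  qed
  show ?thesis
    unfolding rhs_gen_def 1[symmetric] 2[symmetric] 3[symmetric] 4[symmetric]
    by (simp add: algebra_simps del: of_int_add)
qed

text \<open>Two evaluations of one unordered sum: by chambers, and by fibres in \<open>l\<close>.
  Summability of the fibres comes from that of the whole, so the window evaluation applies to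
  each.\<close>

lemma S_fun_SU4_eq_rhs_fun:
  assumes "p \<ge> 1" "q \<ge> 1" "a \<ge> 1" "b \<ge> 1" "c \<ge> 1" "Re s > 1"
  shows "S_fun su4_sum p q a b c s = rhs_fun p q a b c s"
proof -
  have hs: "(lattice_term p q a b c s has_sum S_fun su4_sum p q a b c s) (Sigma index_pairs (\<lambda>(m, n). - {0, - m, - (m + int n)}))"
    by (rule lattice_term_has_sum[OF assms])
  have "((\<lambda>k. rhs_gen (\<lambda>P s Q x y. T_term P s Q x y k) p q a b c s) has_sum S_fun su4_sum p q a b c s) index_pairs"
  proof (rule has_sum_SigmaD[OF hs])
    fix k assume k: "k \<in> index_pairs"
    obtain m n where [simp]: "k = (m, n)" by (metis surj_pair)
    have mn: "m \<noteq> 0" "n \<ge> 1" "m + int n \<noteq> 0" using k by (auto simp: index_pairs_def)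
    define W where "W = (-1) ^ n / (of_int m ^ q * of_nat n powr s * of_int (m + int n) ^ b :: complex)"
    let ?g = "\<lambda>l. (-1) powi l / (of_int l ^ p * of_int (l + m) ^ a * of_int (l + (m + int n)) ^ c) :: complex"
    have "complex_of_int (m + int n) \<noteq> 0" using mn(3) unfolding of_int_eq_0_iff .
    hence W0: "W \<noteq> 0" using mn unfolding W_def by (simp del: of_int_add)
    have ct: "lattice_term p q a b c s ((m, n), l) = W * ?g l" for l
    proof -
      have "(-1) powi (l + int n) = ((-1) powi l * (-1) ^ n :: complex)"
        by (auto simp: power_int_minus_left uminus_power_if)
      thus ?thesis by (simp add: lattice_term_def W_def mult_ac add.assoc del: of_int_add)
    qed
    have "(\<lambda>(k, l). lattice_term p q a b c s (k, l)) summable_on (Sigma index_pairs (\<lambda>(m, n). - {0, - m, - (m + int n)}))"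
      using has_sum_imp_summable[OF hs] by simp
    from summable_on_SigmaD1[OF this k]
    have "(\<lambda>l. W * ?g l) summable_on (- {0, - m, - (m + int n)})" by (simp add: ct)
    hence sm: "?g summable_on (- {0, - m, - (m + int n)})"
      using summable_on_cmult_right'[OF W0] by blast
    show "((\<lambda>l. lattice_term p q a b c s (k, l)) has_sum rhs_gen (\<lambda>P s Q x y. T_term P s Q x y k) p q a b c s)
        (case k of (m, n) \<Rightarrow> - {0, - m, - (m + int n)})"
      using has_sum_cmult_right[OF alternating_l_sum[OF assms(1,3,5) mn(1) _ mn(3) sm], of W] mn
        inner_sum_eq_rhs_gen[OF assms(1-5) mn(2), of m s]
      by (simp add: ct W_def)
  qed
  thus ?thesis using rhs_gen_has_sum[OF assms] by (rule has_sum_unique)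
qed

section \<open>Continuation along complex lines\<close>

lemma holomorphic6_on_compose:
  assumes "holomorphic6_on f V" "(e1 t, e2 t, e3 t, e4 t, e5 t, e6 t) \<in> V"
    and "e1 holomorphic_on UNIV" "e2 holomorphic_on UNIV" "e3 holomorphic_on UNIV"
      "e4 holomorphic_on UNIV" "e5 holomorphic_on UNIV" "e6 holomorphic_on UNIV"
  shows "\<exists>d. ((\<lambda>t. f (e1 t, e2 t, e3 t, e4 t, e5 t, e6 t)) has_field_derivative d) (at t)"
proof -
  let ?e = "\<lambda>t. (e1 t, e2 t, e3 t, e4 t, e5 t, e6 t)"
  have D: "(e has_derivative (*) (deriv e t)) (at t)" if "e holomorphic_on UNIV" for e
    using holomorphic_derivI[OF that, of t] by (simp add: has_field_derivative_def)
  from assms(1,2) obtain d1 d2 d3 d4 d5 d6 where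
    f: "(f has_derivative (\<lambda>(v1, v2, v3, v4, v5, v6). d1 * v1 + d2 * v2 + d3 * v3 + d4 * v4 + d5 * v5 + d6 * v6)) (at (?e t))"
    unfolding holomorphic6_on_def by blast
  have "(?e has_derivative (\<lambda>h. (deriv e1 t * h, deriv e2 t * h, deriv e3 t * h, deriv e4 t * h, deriv e5 t * h, deriv e6 t * h))) (at t)"
    by (intro has_derivative_Pair D assms)
  from has_derivative_compose[OF this f]
  have "((\<lambda>t. f (?e t)) has_derivative (*) (d1 * deriv e1 t + d2 * deriv e2 t + d3 * deriv e3 t + d4 * deriv e4 t + d5 * deriv e5 t + d6 * deriv e6 t)) (at t)"
    by (rule has_derivative_eq_rhs) (auto simp: algebra_simps)
  thus ?thesis unfolding has_field_derivative_def by blast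
qed

text \<open>A local quotient pulls back to a meromorphic function unless the denominator vanishes
  identically along the curve. The set of parameters where that happens is open and closed, and
  \<open>t0\<close> lies outside it.\<close>

lemma meromorphic6_compose:
  assumes "meromorphic6 F P"
    and e: "e1 holomorphic_on UNIV" "e2 holomorphic_on UNIV" "e3 holomorphic_on UNIV"
      "e4 holomorphic_on UNIV" "e5 holomorphic_on UNIV" "e6 holomorphic_on UNIV"
    and reg: "(e1 t0, e2 t0, e3 t0, e4 t0, e5 t0, e6 t0) \<notin> P"
  shows "(\<lambda>t. F (e1 t, e2 t, e3 t, e4 t, e5 t, e6 t)) meromorphic_on UNIV"
proof -
  let ?e = "\<lambda>t. (e1 t, e2 t, e3 t, e4 t, e5 t, e6 t)"
  have cont: "continuous_on UNIV ?e"
    using e by (intro continuous_intros holomorphic_on_imp_continuous_on)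
  have local: "\<exists>r>0. \<exists>g h. (\<lambda>t. g (?e t)) holomorphic_on ball t r \<and> (\<lambda>t. h (?e t)) holomorphic_on ball t r \<and>
     (\<forall>u\<in>ball t r. ?e u \<in> P \<longleftrightarrow> h (?e u) = 0) \<and> (\<forall>u\<in>ball t r. ?e u \<notin> P \<longrightarrow> F (?e u) = g (?e u) / h (?e u))" for t
  proof -
    from assms(1) obtain V g h where V: "open V" "?e t \<in> V" "holomorphic6_on g V" "holomorphic6_on h V"
      "P \<inter> V = {w \<in> V. h w = 0}" "\<forall>w\<in>V - P. F w = g w / h w"
      unfolding meromorphic6_def by meson
    have "open (?e -` V)" using V(1) cont by (intro open_vimage) auto
    then obtain r where r: "r > 0" "ball t r \<subseteq> ?e -` V" using V(2) unfolding open_contains_ball by blast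
    have hol: "(\<lambda>t. f (?e t)) holomorphic_on ball t r" if "holomorphic6_on f V" for f
      unfolding holomorphic_on_open[OF open_ball]
      using holomorphic6_on_compose[OF that _ e] r by blast
    show ?thesis using r V hol[OF V(3)] hol[OF V(4)] by (intro exI[of _ r] conjI exI[of _ g] exI[of _ h]) blast+
  qed
  have dich: "(\<exists>r>0. \<forall>u\<in>ball t r. ?e u \<in> P) \<or> eventually (\<lambda>u. ?e u \<notin> P) (at t)" for t
  proof -
    obtain r g h where r: "r > 0" and h: "(\<lambda>t. h (?e t)) holomorphic_on ball t r"
      and P: "\<And>u. u \<in> ball t r \<Longrightarrow> ?e u \<in> P \<longleftrightarrow> h (?e u) = 0"
      using local[of t] by blast
    \<comment> \<open>The dichotomy for holomorphic functions of one variable: identically zero, or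
      zero only at isolated points.\<close>
    have "(\<forall>u\<in>ball t r. h (?e u) = 0) \<or> (\<forall>\<^sub>\<approx>u\<in>ball t r. h (?e u) \<noteq> 0)"
      using h by (intro nicely_meromorphic_imp_constant_or_avoid analytic_on_imp_nicely_meromorphic_on)
        (auto simp: analytic_on_open)
    thus ?thesis
    proof
      assume "\<forall>u\<in>ball t r. h (?e u) = 0"
      thus ?thesis using r P by blast
    next
      assume "\<forall>\<^sub>\<approx>u\<in>ball t r. h (?e u) \<noteq> 0"
      hence "eventually (\<lambda>u. h (?e u) \<noteq> 0) (at t)" using r by (auto simp: eventually_cosparse_open_eq)
      moreover have "eventually (\<lambda>u. u \<in> ball t r) (at t)" using r by (intro eventually_at_in_open') auto
      ultimately have "eventually (\<lambda>u. ?e u \<notin> P) (at t)" by eventually_elim (use P in auto)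
      thus ?thesis ..
    qed
  qed
  define A where "A = {t. \<exists>r>0. \<forall>u\<in>ball t r. ?e u \<in> P}"
  have "open A" unfolding open_contains_ball
  proof
    fix t assume "t \<in> A"
    then obtain r where r: "r > 0" "\<forall>u\<in>ball t r. ?e u \<in> P" by (auto simp: A_def)
    have "u \<in> A" if u: "u \<in> ball t r" for u
    proof -
      obtain r' where "r' > 0" "ball u r' \<subseteq> ball t r" using openE[OF open_ball u] by metis
      thus ?thesis using r unfolding A_def by blast
    qed
    thus "\<exists>r>0. ball t r \<subseteq> A" using r(1) by blast
  qed
  \<comment> \<open>Near a parameter outside \<open>A\<close> the curve meets \<open>P\<close> at
    most at that parameter, so no nearby ball is mapped into \<open>P\<close>.\<close>
  moreover have "open (- A)" unfolding open_contains_ball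
  proof
    fix t assume t: "t \<in> - A"
    hence "eventually (\<lambda>u. ?e u \<notin> P) (at t)" using dich[of t] by (auto simp: A_def)
    then obtain d where d: "d > 0" "\<And>u. u \<noteq> t \<Longrightarrow> dist u t < d \<Longrightarrow> ?e u \<notin> P"
      unfolding eventually_at by auto
    have "u \<notin> A" if "u \<in> ball t d" for u
    proof (cases "u = t")
      case False
      hence "?e u \<notin> P" using d(2)[of u] that by (simp add: dist_commute)
      thus ?thesis unfolding A_def using centre_in_ball by blast
    qed (use t in auto)
    thus "\<exists>r>0. ball t r \<subseteq> - A" using d(1) by blast
  qed
  hence "closed A" by (simp add: closed_def)
  moreover have "t0 \<notin> A" using reg unfolding A_def using centre_in_ball by blast
  ultimately have "A = {}" using clopen[of A] by auto
  hence ev: "eventually (\<lambda>u. ?e u \<notin> P) (at t)" for t using dich[of t] unfolding A_def by blast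
  show ?thesis
  proof (subst meromorphic_on_meromorphic_at, intro ballI)
    fix t
    obtain r g h where r: "r > 0" and gh: "(\<lambda>t. g (?e t)) holomorphic_on ball t r" "(\<lambda>t. h (?e t)) holomorphic_on ball t r"
      and F: "\<And>u. u \<in> ball t r \<Longrightarrow> ?e u \<notin> P \<Longrightarrow> F (?e u) = g (?e u) / h (?e u)"
      using local[of t] by blast
    have an: "(\<lambda>t. g (?e t)) analytic_on {t}" "(\<lambda>t. h (?e t)) analytic_on {t}"
      using gh r by (auto intro: holomorphic_on_imp_analytic_at)
    have "eventually (\<lambda>u. u \<in> ball t r) (at t)" using r by (intro eventually_at_in_open') auto
    hence "eventually (\<lambda>u. F (?e u) = g (?e u) / h (?e u)) (at t)" using ev[of t] by eventually_elim (rule F)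
    hence "(\<lambda>t. F (?e t)) meromorphic_on {t} \<longleftrightarrow> (\<lambda>t. g (?e t) / h (?e t)) meromorphic_on {t}"
      by (intro meromorphic_on_cong) auto
    also have "\<dots>" by (intro meromorphic_intros analytic_on_imp_meromorphic_on an)
    finally show "(\<lambda>t. F (?e t)) meromorphic_on {t}" .
  qed
qed

text \<open>The parameter 2 gives a point of absolute convergence, which by definition of the
  continuation is regular.\<close>

lemma is_zeta3_SU4_compose:
  assumes F: "is_zeta3_SU4 F"
    and e: "e1 holomorphic_on UNIV" "e2 holomorphic_on UNIV" "e3 holomorphic_on UNIV"
      "e4 holomorphic_on UNIV" "e5 holomorphic_on UNIV" "e6 holomorphic_on UNIV"
    and re: "\<And>t. Re t > 1 \<Longrightarrow> Re (e1 t) \<ge> 1" "\<And>t. Re t > 1 \<Longrightarrow> Re (e2 t) \<ge> 1" "\<And>t. Re t > 1 \<Longrightarrow> Re (e3 t) \<ge> 1"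
      "\<And>t. Re t > 1 \<Longrightarrow> Re (e4 t) \<ge> 1" "\<And>t. Re t > 1 \<Longrightarrow> Re (e5 t) \<ge> 1" "\<And>t. Re t > 1 \<Longrightarrow> Re (e6 t) \<ge> 1"
  shows "(\<lambda>t. F (e1 t, e2 t, e3 t, e4 t, e5 t, e6 t)) meromorphic_on UNIV"
proof -
  from F obtain P where P: "meromorphic6 F P" and
    c: "\<And>z. (\<lambda>k. norm (su4_term z k)) summable_on index_triples \<Longrightarrow> z \<notin> P"
    unfolding is_zeta3_SU4_def continues_series6_def index_triples_def by blast
  have "(e1 2, e2 2, e3 2, e4 2, e5 2, e6 2) \<notin> P"
    by (intro c su4_term_abs_summable re) auto
  thus ?thesis by (intro meromorphic6_compose[OF P e])
qed

lemma is_zeta3_SU4_eq: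
  assumes F: "is_zeta3_SU4 F"
    and "Re s1 \<ge> 1" "Re s2 \<ge> 1" "Re s3 \<ge> 1" "Re s4 \<ge> 1" "Re s5 \<ge> 1" "Re s6 \<ge> 1"
  shows "F (s1, s2, s3, s4, s5, s6) = su4_sum (s1, s2, s3, s4, s5, s6)"
  using F su4_term_abs_summable[OF assms(2-)]
  unfolding is_zeta3_SU4_def continues_series6_def index_triples_def su4_sum_def by blast

lemma S_fun_meromorphic:
  assumes "is_zeta3_SU4 F" "p \<ge> 1" "q \<ge> 1" "a \<ge> 1" "b \<ge> 1" "c \<ge> 1"
  shows "(\<lambda>s. S_fun F p q a b c s) meromorphic_on UNIV"
  unfolding S_fun_def Let_def
  by (intro meromorphic_on_add meromorphic_on_mult meromorphic_on_const is_zeta3_SU4_compose[OF assms(1)])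
     (use assms in \<open>auto intro!: holomorphic_intros\<close>)

lemma rhs_fun_meromorphic:
  assumes "p \<ge> 1" "q \<ge> 1" "a \<ge> 1" "b \<ge> 1" "c \<ge> 1"
  shows "(\<lambda>s. rhs_fun p q a b c s) meromorphic_on UNIV"
proof -
  have T: "(\<lambda>s. T_fun P s Q x y) meromorphic_on UNIV" if "P \<ge> 1" "Q \<ge> 1" "x = 1 \<or> x = -1" "y = 1 \<or> y = -1" for P Q x y
    using T_fun_shift_meromorphic[OF that, of 0] by simp
  show ?thesis
    unfolding rhs_fun_def
    by (intro meromorphic_on_add meromorphic_on_mult meromorphic_on_const meromorphic_on_sum T T_fun_shift_meromorphic)
       (use assms in auto)
qed

text \<open>Agreement is demanded only on the half-plane: sums and products of functions with filled
  singularities may differ from the closed form at isolated points elsewhere.\<close>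

definition right_expressible :: "(complex \<Rightarrow> complex) \<Rightarrow> bool" where
  "right_expressible g \<longleftrightarrow> (\<exists>f\<in>zeta_expressible. \<forall>s. Re s > 1 \<longrightarrow> g s = f s)"

lemma right_expressibleI: "f \<in> zeta_expressible \<Longrightarrow> right_expressible f"
  unfolding right_expressible_def by blast

lemma right_expressible_add:
  "right_expressible f \<Longrightarrow> right_expressible g \<Longrightarrow> right_expressible (\<lambda>s. f s + g s)"
  unfolding right_expressible_def using zeta_expressible.add by fastforce

lemma right_expressible_mult:
  "right_expressible f \<Longrightarrow> right_expressible g \<Longrightarrow> right_expressible (\<lambda>s. f s * g s)"
  unfolding right_expressible_def using zeta_expressible.mult by fastforce

lemma right_expressible_sum:
  assumes "\<And>i. i \<in> I \<Longrightarrow> right_expressible (f i)"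
  shows "right_expressible (\<lambda>s. \<Sum>i\<in>I. f i s)"
proof -
  have "\<forall>i\<in>I. \<exists>g. g \<in> zeta_expressible \<and> (\<forall>s. Re s > 1 \<longrightarrow> f i s = g s)"
    using assms unfolding right_expressible_def by blast
  then obtain g where g: "\<And>i. i \<in> I \<Longrightarrow> g i \<in> zeta_expressible"
      "\<And>i s. i \<in> I \<Longrightarrow> Re s > 1 \<Longrightarrow> f i s = g i s"
    using bchoice[of I "\<lambda>i g. g \<in> zeta_expressible \<and> (\<forall>s. Re s > 1 \<longrightarrow> f i s = g s)"] by blast
  thus ?thesis unfolding right_expressible_def
    by (intro bexI[of _ "\<lambda>s. \<Sum>i\<in>I. g i s"] zeta_expressible_sum) auto
qed

lemma right_expressible_T_fun:
  assumes "P \<ge> 1" "Q \<ge> 1" "x = 1 \<or> x = -1" "y = 1 \<or> y = -1"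
  shows "right_expressible (\<lambda>s. T_fun P (s + of_nat k) Q x y)"
proof -
  obtain f where f: "f \<in> zeta_expressible" "\<And>s. Re s > 1 \<Longrightarrow> T_fun P s Q x y = f s"
    using T_fun_expressible[OF assms] by metis
  show ?thesis unfolding right_expressible_def
    by (intro bexI[OF _ zeta_expressible_shift[OF f(1), of k]]) (auto simp: f(2))
qed

lemma right_expressible_rhs_fun:
  assumes "p \<ge> 1" "q \<ge> 1" "a \<ge> 1" "b \<ge> 1" "c \<ge> 1"
  shows "right_expressible (\<lambda>s. rhs_fun p q a b c s)"
proof -
  have T: "right_expressible (\<lambda>s. T_fun P s Q x y)" if "P \<ge> 1" "Q \<ge> 1" "x = 1 \<or> x = -1" "y = 1 \<or> y = -1" for P Q x y
    using right_expressible_T_fun[OF that, of 0] by simp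
  have two: "(\<lambda>s. 2) \<in> zeta_expressible" using zeta_expressible_of_nat[of 2] by simp
  show ?thesis
    unfolding rhs_fun_def
    by (intro right_expressible_add right_expressible_mult right_expressible_sum T right_expressible_T_fun
          right_expressibleI[OF two] right_expressibleI[OF zeta_expressible_minus_one_power]
          right_expressibleI[OF zeta_expressible_phi] right_expressibleI[OF zeta_expressible_of_nat])
       (use assms in auto)
qed

theorem theorem5p1:
  fixes p q a b c :: nat
  assumes "p \<ge> 1" and "q \<ge> 1" and "a \<ge> 1" and "b \<ge> 1" and "c \<ge> 1"
  shows "(\<forall>F2. is_zeta3_SU4 F2 \<longrightarrow>
            (\<forall>s. (\<lambda>s. S_fun F2 p q a b c s) analytic_on {s} \<longrightarrow>
                 (\<lambda>s. rhs_fun p q a b c s) analytic_on {s} \<longrightarrow>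
                 S_fun F2 p q a b c s = rhs_fun p q a b c s))
       \<and> (\<exists>f\<in>zeta_expressible.
            \<forall>s. (\<lambda>s. rhs_fun p q a b c s) analytic_on {s} \<longrightarrow> f analytic_on {s} \<longrightarrow>
                rhs_fun p q a b c s = f s)"
proof (intro conjI allI impI)
  fix F2 s
  assume F: "is_zeta3_SU4 F2" and an: "(\<lambda>s. S_fun F2 p q a b c s) analytic_on {s}" "(\<lambda>s. rhs_fun p q a b c s) analytic_on {s}"
  \<comment> \<open>For \<open>Re t > 1\<close> all twelve arguments have real parts at least 1, so
    any continuation equals the series there.\<close>
  have eq: "S_fun F2 p q a b c t = rhs_fun p q a b c t" if "Re t > 1" for t
  proof -
    have "S_fun F2 p q a b c t = S_fun su4_sum p q a b c t"
      unfolding S_fun_def Let_def using assms that by (simp add: is_zeta3_SU4_eq[OF F])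
    thus ?thesis using S_fun_SU4_eq_rhs_fun[OF assms that] by simp
  qed
  \<comment> \<open>Analyticity of each complete side suffices; single terms may still be singular
    at \<open>s\<close>.\<close>
  show "S_fun F2 p q a b c s = rhs_fun p q a b c s"
    by (rule analytic_eq_of_eventually_eq[OF an meromorphic_eq_eventually])
       (use S_fun_meromorphic[OF F assms] rhs_fun_meromorphic[OF assms] eq in auto)
next
  obtain f where f: "f \<in> zeta_expressible" "\<And>s. Re s > 1 \<Longrightarrow> rhs_fun p q a b c s = f s"
    using right_expressible_rhs_fun[OF assms] unfolding right_expressible_def by blast
  show "\<exists>f\<in>zeta_expressible. \<forall>s. (\<lambda>s. rhs_fun p q a b c s) analytic_on {s} \<longrightarrow> f analytic_on {s} \<longrightarrow>
          rhs_fun p q a b c s = f s"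
  proof (intro bexI[OF _ f(1)] allI impI)
    fix s assume an: "(\<lambda>s. rhs_fun p q a b c s) analytic_on {s}" "f analytic_on {s}"
    show "rhs_fun p q a b c s = f s"
      by (rule analytic_eq_of_eventually_eq[OF an meromorphic_eq_eventually])
         (use rhs_fun_meromorphic[OF assms] zeta_expressible_meromorphic[OF f(1)] f(2) in auto)
  qed
qed

end
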